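(* Let $G$ be a (possibly infinite) simple graph and let $r \geq 3$ be an integer. The following are equivalent: (i) $G$ is $r$-locally chordal. (ii) $G$ is $r$-chordal and wheel-free. (iii) The $r$-local cover $G_r$ of $G$ is chordal. (iv) Every minimal $r$-local separator of $G$ is a clique.
   Context: All graphs are simple. A graph is chordal if every cycle of length at least $4$ has a chord; it is $r$-chordal if every cycle of length at least $4$ and at most $r$ has a chord. For a vertex $v$ and integer $r\ge 0$, the ball $B_G(v,r/2)$ is the subgraph of $G$ consisting of all vertices at distance at most $r/2$ from $v$ and all edges of $G$ for which the sum of the distances of its two endpoints to $v$ is strictly less than $r$. $G$ is $r$-locally chordal if $B_G(v,r/2)$ is chordal for every vertex $v$. A wheel $W_n$ ($n\ge 4$) is a cycle of length $n$ (the rim) plus a vertex (the hub) adjacent to all rim vertices; $G$ is wheel-free if it has no induced subgraph isomorphic to a wheel $W_n$ with $n\ge 4$. Coverings: a covering of $G$ is a surjective graph homomorphism $p\colon \hat G\to G$ that, for every vertex $\hat v$ of $\hat G$, restricts to a bijection from the edges incident to $\hat v$ to the edges incident to $p(\hat v)$; only coverings such that $p^{-1}(C)$ is connected for every component $C$ of $G$ are considered. A homomorphism $p\colon\hat G\to G$ is $r/2$-ball-preserving if for every vertex $\hat v$ it restricts to an isomorphism from $B_{\hat G}(\hat v,r/2)$ to $B_G(p(\hat v),r/2)$. The $r$-local covering $p_r\colon G_r\to G$ is the universal $r/2$-ball-preserving covering of $G$: it is $r/2$-ball-preserving and for every $r/2$-ball-preserving covering $p\colon\hat G\to G$ there is a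 covering $q\colon G_r\to\hat G$ with $p_r=p\circ q$. $G_r$ is called the $r$-local cover. Local separators: for $X\subseteq V(G)$, an $X$-walk is a walk whose first and last vertices lie in $X$ and which otherwise avoids $X$. A walk is $r$-local if it is a walk in a cycle of $G$ of length at most $r$ or a walk traversing a single edge. $\partial X$ is the set of edges with exactly one endpoint in $X$. The $r$-local components at $X$ are the classes of the transitive closure of the relation on $\partial X$ given by $e\sim_r f$ iff $e=f$ or $e,f$ are the first and last edges of an $r$-local $X$-walk. For vertices $u,w$ at distance $2$ and a vertex $v$ with $uv,vw\in E(G)$, a set $X\subseteq V(G)$ is an $r$-local $u$--$w$ separator with respect to $v$ if $u,w\notin X$, $v\in X$, and $uv$ and $vw$ lie in distinct $r$-local components at $X$. $X$ is a minimal $r$-local separator of $G$ if there exist vertices $u,w$ at distance $2$ and $v$ with $uv,vw\in E(G)$ such that $X$ is an inclusion-minimal $r$-local $u$--$w$ separator with respect to $v$. A clique is a vertex set inducing a complete subgraph. *)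

theory Defs
  imports Main "HOL-Library.Extended_Nat"
begin

record 'a ugraph =
  verts :: "'a set"
  edges :: "'a set set"

definition simple_graph :: "'a ugraph \<Rightarrow> bool" where
  "simple_graph G \<longleftrightarrow> (\<forall>e\<in>edges G. e \<subseteq> verts G \<and> card e = 2)"

definition induced :: "'a ugraph \<Rightarrow> 'a set \<Rightarrow> 'a ugraph" where
  "induced G S = \<lparr>verts = verts G \<inter> S, edges = {e \<in> edges G. e \<subseteq> S}\<rparr>"

definition graph_iso :: "('a \<Rightarrow> 'b) \<Rightarrow> 'a ugraph \<Rightarrow> 'b ugraph \<Rightarrow> bool" where
  "graph_iso f G H \<longleftrightarrow>
     bij_betw f (verts G) (verts H) \<and> (\<lambda>e. f ` e) ` edges G = edges H"

definition graph_hom :: "('a \<Rightarrow> 'b) \<Rightarrow> 'a ugraph \<Rightarrow> 'b ugraph \<Rightarrow> bool" where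
  "graph_hom f G H \<longleftrightarrow>
     f ` verts G \<subseteq> verts H \<and> (\<forall>e\<in>edges G. f ` e \<in> edges H)"

subsection \<open>Walks, distance, cycles\<close>

text \<open>A walk is the nonempty list of its vertices; its length as a walk is one less than its
  length as a list.\<close>

definition walk :: "'a ugraph \<Rightarrow> 'a list \<Rightarrow> bool" where
  "walk G xs \<longleftrightarrow>
     xs \<noteq> [] \<and> set xs \<subseteq> verts G \<and> successively (\<lambda>x y. {x, y} \<in> edges G) xs"

definition walk_betw :: "'a ugraph \<Rightarrow> 'a \<Rightarrow> 'a list \<Rightarrow> 'a \<Rightarrow> bool" where
  "walk_betw G u xs v \<longleftrightarrow> walk G xs \<and> hd xs = u \<and> last xs = v"

definition gdist :: "'a ugraph \<Rightarrow> 'a \<Rightarrow> 'a \<Rightarrow> enat" where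
  "gdist G u v = (INF xs\<in>{xs. walk_betw G u xs v}. enat (length xs - 1))"

text \<open>A cycle is the list of its vertices in cyclic order, without repeating the first one, so
  that its length is the length of the list.\<close>

definition cycle_edges :: "'a list \<Rightarrow> 'a set set" where
  "cycle_edges c = {{c ! i, c ! (Suc i mod length c)} | i. i < length c}"

definition cycle_graph :: "'a list \<Rightarrow> 'a ugraph" where
  "cycle_graph c = \<lparr>verts = set c, edges = cycle_edges c\<rparr>"

definition cycle :: "'a ugraph \<Rightarrow> 'a list \<Rightarrow> bool" where
  "cycle G c \<longleftrightarrow>
     3 \<le> length c \<and> distinct c \<and> set c \<subseteq> verts G \<and> cycle_edges c \<subseteq> edges G"

definition has_chord :: "'a ugraph \<Rightarrow> 'a list \<Rightarrow> bool" where
  "has_chord G c \<longleftrightarrow> (\<exists>e\<in>edges G. e \<subseteq> set c \<and> e \<notin> cycle_edges c)"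

subsection \<open>Chordality\<close>

definition chordal :: "'a ugraph \<Rightarrow> bool" where
  "chordal G \<longleftrightarrow> (\<forall>c. cycle G c \<and> 4 \<le> length c \<longrightarrow> has_chord G c)"

definition r_chordal :: "nat \<Rightarrow> 'a ugraph \<Rightarrow> bool" where
  "r_chordal r G \<longleftrightarrow> (\<forall>c. cycle G c \<and> 4 \<le> length c \<and> length c \<le> r \<longrightarrow> has_chord G c)"

text \<open>\<open>half_ball G v r\<close> is the ball of radius \<open>r/2\<close> around \<open>v\<close>.\<close>

definition half_ball :: "'a ugraph \<Rightarrow> 'a \<Rightarrow> nat \<Rightarrow> 'a ugraph" where
  "half_ball G v r =
     \<lparr>verts = {u \<in> verts G. 2 * gdist G v u \<le> enat r},
      edges = {e \<in> edges G. (\<Sum>x\<in>e. gdist G v x) < enat r}\<rparr>"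

definition r_locally_chordal :: "nat \<Rightarrow> 'a ugraph \<Rightarrow> bool" where
  "r_locally_chordal r G \<longleftrightarrow> (\<forall>v\<in>verts G. chordal (half_ball G v r))"

text \<open>The rim of \<open>wheel n\<close> consists of \<open>0, \<dots>, n - 1\<close>, and its hub is \<open>n\<close>.\<close>

definition wheel :: "nat \<Rightarrow> nat ugraph" where
  "wheel n =
     \<lparr>verts = {0..n}, edges = cycle_edges [0..<n] \<union> {{i, n} | i. i < n}\<rparr>"

definition wheel_free :: "'a ugraph \<Rightarrow> bool" where
  "wheel_free G \<longleftrightarrow>
     \<not> (\<exists>n\<ge>4. \<exists>S\<subseteq>verts G. \<exists>f. graph_iso f (induced G S) (wheel n))"

subsection \<open>Coverings\<close>

definition connected_graph :: "'a ugraph \<Rightarrow> bool" where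
  "connected_graph G \<longleftrightarrow>
     verts G \<noteq> {} \<and> (\<forall>u\<in>verts G. \<forall>v\<in>verts G. \<exists>xs. walk_betw G u xs v)"

definition components :: "'a ugraph \<Rightarrow> 'a ugraph set" where
  "components G = (\<lambda>v. induced G {u. \<exists>xs. walk_betw G v xs u}) ` verts G"

definition preimage_graph :: "('b \<Rightarrow> 'a) \<Rightarrow> 'b ugraph \<Rightarrow> 'a ugraph \<Rightarrow> 'b ugraph" where
  "preimage_graph p H C =
     \<lparr>verts = {x \<in> verts H. p x \<in> verts C}, edges = {e \<in> edges H. p ` e \<in> edges C}\<rparr>"

definition covering :: "('b \<Rightarrow> 'a) \<Rightarrow> 'b ugraph \<Rightarrow> 'a ugraph \<Rightarrow> bool" where
  "covering p H G \<longleftrightarrow>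
     simple_graph H \<and> simple_graph G \<and>
     graph_hom p H G \<and>
     p ` verts H = verts G \<and> (\<lambda>e. p ` e) ` edges H = edges G \<and>
     (\<forall>x\<in>verts H. bij_betw (\<lambda>e. p ` e) {e \<in> edges H. x \<in> e} {e \<in> edges G. p x \<in> e}) \<and>
     (\<forall>C\<in>components G. connected_graph (preimage_graph p H C))"

definition ball_preserving :: "nat \<Rightarrow> ('b \<Rightarrow> 'a) \<Rightarrow> 'b ugraph \<Rightarrow> 'a ugraph \<Rightarrow> bool" where
  "ball_preserving r p H G \<longleftrightarrow>
     graph_hom p H G \<and>
     (\<forall>x\<in>verts H. graph_iso p (half_ball H x r) (half_ball G (p x) r))"

text \<open>The universal property quantifies over the coverings whose vertices have type
  \<^typ>\<open>'a list\<close>, where \<^typ>\<open>'a\<close> is the vertex type of \<open>G\<close>. By lemma \<open>covering_embeds_in_lists\<close>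
  below, every covering of \<open>G\<close>, on whatever vertex type, is isomorphic to one of these.\<close>

definition r_local_covering :: "nat \<Rightarrow> ('b \<Rightarrow> 'a) \<Rightarrow> 'b ugraph \<Rightarrow> 'a ugraph \<Rightarrow> bool" where
  "r_local_covering r p H G \<longleftrightarrow>
     covering p H G \<and> ball_preserving r p H G \<and>
     (\<forall>(K :: 'a list ugraph) p'. covering p' K G \<and> ball_preserving r p' K G \<longrightarrow>
        (\<exists>q. covering q H K \<and> (\<forall>x\<in>verts H. p x = p' (q x))))"

text \<open>The \<open>r\<close>-local cover is determined up to isomorphism by its universal property; we choose a
  representative on the vertex type \<^typ>\<open>'a list\<close>.\<close>

definition r_local_cover :: "nat \<Rightarrow> 'a ugraph \<Rightarrow> 'a list ugraph" where
  "r_local_cover r G = (SOME H. \<exists>p. r_local_covering r p H G)"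

subsection \<open>Local separators\<close>

definition X_walk :: "'a ugraph \<Rightarrow> 'a set \<Rightarrow> 'a list \<Rightarrow> bool" where
  "X_walk G X xs \<longleftrightarrow>
     walk G xs \<and> hd xs \<in> X \<and> last xs \<in> X \<and> set (butlast (tl xs)) \<inter> X = {}"

definition r_local_walk :: "nat \<Rightarrow> 'a ugraph \<Rightarrow> 'a list \<Rightarrow> bool" where
  "r_local_walk r G xs \<longleftrightarrow>
     (\<exists>c. cycle G c \<and> length c \<le> r \<and> walk (cycle_graph c) xs) \<or>
     (walk G xs \<and> length xs = 2)"

definition edge_boundary :: "'a ugraph \<Rightarrow> 'a set \<Rightarrow> 'a set set" where
  "edge_boundary G X = {e \<in> edges G. card (e \<inter> X) = 1}"

definition first_edge :: "'a list \<Rightarrow> 'a set" where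
  "first_edge xs = {xs ! 0, xs ! 1}"

definition last_edge :: "'a list \<Rightarrow> 'a set" where
  "last_edge xs = {xs ! (length xs - 2), xs ! (length xs - 1)}"

definition r_local_rel :: "nat \<Rightarrow> 'a ugraph \<Rightarrow> 'a set \<Rightarrow> ('a set \<times> 'a set) set" where
  "r_local_rel r G X =
     {(e, f). e \<in> edge_boundary G X \<and> f \<in> edge_boundary G X \<and>
        (e = f \<or> (\<exists>xs. X_walk G X xs \<and> r_local_walk r G xs \<and> 2 \<le> length xs \<and>
                       e = first_edge xs \<and> f = last_edge xs))}"

definition r_local_components :: "nat \<Rightarrow> 'a ugraph \<Rightarrow> 'a set \<Rightarrow> 'a set set set" where
  "r_local_components r G X = edge_boundary G X // (r_local_rel r G X)\<^sup>+"

definition r_local_separator ::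
    "nat \<Rightarrow> 'a ugraph \<Rightarrow> 'a \<Rightarrow> 'a \<Rightarrow> 'a \<Rightarrow> 'a set \<Rightarrow> bool" where
  "r_local_separator r G u v w X \<longleftrightarrow>
     X \<subseteq> verts G \<and> u \<notin> X \<and> w \<notin> X \<and> v \<in> X \<and>
     (\<exists>C\<in>r_local_components r G X. \<exists>D\<in>r_local_components r G X.
        C \<noteq> D \<and> {u, v} \<in> C \<and> {v, w} \<in> D)"

definition minimal_r_local_separator :: "nat \<Rightarrow> 'a ugraph \<Rightarrow> 'a set \<Rightarrow> bool" where
  "minimal_r_local_separator r G X \<longleftrightarrow>
     (\<exists>u\<in>verts G. \<exists>w\<in>verts G. \<exists>v\<in>verts G.
        gdist G u w = 2 \<and> {u, v} \<in> edges G \<and> {v, w} \<in> edges G \<and>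
        r_local_separator r G u v w X \<and>
        (\<forall>Y. Y \<subset> X \<longrightarrow> \<not> r_local_separator r G u v w Y))"

definition clique :: "'a ugraph \<Rightarrow> 'a set \<Rightarrow> bool" where
  "clique G X \<longleftrightarrow> X \<subseteq> verts G \<and> (\<forall>x\<in>X. \<forall>y\<in>X. x \<noteq> y \<longrightarrow> {x, y} \<in> edges G)"

subsection \<open>Coverings embed in lists\<close>

lemma covering_unique_lift:
  assumes cov: "covering p H G"
    and "walk H xs" "walk H ys" "map p xs = map p ys" "hd xs = hd ys"
  shows "xs = ys"
  using assms(2-)
proof (induction xs arbitrary: ys rule: induct_list012)
  case 1
  then show ?case by simp
next
  case (2 x)
  then show ?case by (cases ys) auto
next
  case (3 x x' xs)
  then obtain y' ys' where ys: "ys = x # y' # ys'"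
    by (cases ys; cases "tl ys") auto
  have e: "{x, x'} \<in> edges H" "{x, y'} \<in> edges H" and x: "x \<in> verts H"
    using 3 ys by (auto simp: walk_def)
  have "inj_on (\<lambda>e. p ` e) {e \<in> edges H. x \<in> e}"
    using cov x by (auto simp: covering_def bij_betw_def)
  moreover have "p ` {x, x'} = p ` {x, y'}"
    using 3 ys by auto
  ultimately have eq: "{x, x'} = {x, y'}"
    by (rule inj_onD) (use e in auto)
  have "x \<noteq> x'"
    using cov e(1) by (force simp: covering_def simple_graph_def)
  then have "x' = y'"
    using eq by (metis doubleton_eq_iff)
  moreover have "x' # xs = y' # ys'"
    using 3 ys \<open>x' = y'\<close> by (intro "3.IH"(2)) (auto simp: walk_def)
  ultimately show ?case
    using ys by simp
qed

lemma covering_embeds_in_lists: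
  fixes p :: "'b \<Rightarrow> 'a"
  assumes cov: "covering p H G"
  shows "\<exists>f :: 'b \<Rightarrow> 'a list. inj_on f (verts H)"
proof -
  define K where "K x = {y \<in> verts H. \<exists>xs. walk_betw G (p x) xs (p y)}" for x
  have walkK: "\<exists>xs. walk_betw H a xs b" if "x \<in> verts H" "a \<in> K x" "b \<in> K x" for x a b
  proof -
    define C where "C = induced G {u. \<exists>xs. walk_betw G (p x) xs u}"
    have "C \<in> components G"
      using that cov by (auto simp: C_def components_def covering_def graph_hom_def)
    then have con: "connected_graph (preimage_graph p H C)"
      using cov by (auto simp: covering_def)
    have "a \<in> verts (preimage_graph p H C)" "b \<in> verts (preimage_graph p H C)"
      using that cov
      by (auto simp: preimage_graph_def C_def induced_def K_def covering_def graph_hom_def)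
    with con obtain xs where "walk_betw (preimage_graph p H C) a xs b"
      by (auto simp: connected_graph_def)
    then have "walk_betw H a xs b"
      unfolding walk_betw_def walk_def preimage_graph_def
      by (auto intro: successively_mono)
    then show ?thesis by blast
  qed
  have self: "x \<in> K x" if "x \<in> verts H" for x
  proof -
    have "walk_betw G (p x) [p x] (p x)"
      using that cov by (auto simp: walk_betw_def walk_def covering_def graph_hom_def)
    then show ?thesis using that by (auto simp: K_def)
  qed
  define b where "b x = (SOME a. a \<in> K x)" for x
  define W where "W x = (SOME xs. walk_betw H (b x) xs x)" for x
  have bK: "b x \<in> K x" if "x \<in> verts H" for x
    unfolding b_def using self[OF that] by (rule someI)
  have W: "walk_betw H (b x) (W x) x" if "x \<in> verts H" for x
    unfolding W_def using walkK[OF that bK[OF that] self[OF that]] by (rule someI_ex)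
  have "inj_on (\<lambda>x. map p (W x)) (verts H)"
  proof (rule inj_onI)
    fix x y
    assume xy: "x \<in> verts H" "y \<in> verts H" and eq: "map p (W x) = map p (W y)"
    have ne: "W x \<noteq> []" "W y \<noteq> []"
      using W xy by (auto simp: walk_betw_def walk_def)
    have "last (map p (W x)) = last (map p (W y))"
      using eq by simp
    then have "p x = p y"
      using W[OF xy(1)] W[OF xy(2)] ne by (simp add: last_map walk_betw_def)
    then have "K x = K y"
      by (simp add: K_def)
    then have "b x = b y"
      by (simp add: b_def)
    then have "W x = W y"
      using W[OF xy(1)] W[OF xy(2)] eq
      by (intro covering_unique_lift[OF cov]) (auto simp: walk_betw_def)
    then show "x = y"
      using W[OF xy(1)] W[OF xy(2)] by (simp add: walk_betw_def)
  qed
  then show ?thesis by blast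
qed

end

theory Submission
  imports Defs
begin

text \<open>
  Call a closed walk triangulable if the polygon with these corners has a triangulation without
  interior vertices whose diagonals join equal or adjacent vertices. If \<open>G\<close> is \<open>r\<close>-chordal, closed walks
  of length at most \<open>r\<close> are triangulable; if \<open>G\<close> is wheel-free, neighbourhoods of vertices are chordal,
  so a corner can be cut off from a triangulated polygon by retriangulating its fan. Hence every closed
  walk that is null-homotopic modulo closed walks of length at most \<open>r\<close> is triangulable. Cycles of the
  \<open>r\<close>-local cover project to such walks, and triangulations lift, so cycles of the cover have chords.

  Conversely, balls of chordal graphs are chordal, because the neighbours of a vertex that are closer to
  the centre form a clique, and the covering map is an isomorphism on balls.

  A local separator lifts to a separator of the chordal cover, which contains a clique separating the
  lifted vertices; the image of this clique is again a local separator. If all minimal local separators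
  are cliques, then such a separator of two vertices of an induced cycle or of a wheel would provide a
  chord of the cycle or of the rim.
\<close>

section \<open>Triangulated closed walks\<close>

text \<open>A cycle of the cover may be arbitrarily long, so neither the bound \<open>r\<close> nor
  the neighbourhood of a single vertex controls it; all that is known about its projection is that
  it can be contracted. A contraction fills the closed walk with triangles that in general use
  interior vertices, and such a filling says nothing about chords of the boundary. The point is
  therefore to keep the filling free of interior vertices during the whole homotopy: inserting a
  corner is harmless, whereas deleting one would push it into the interior. Labels may repeat
  because projections and the intermediate walks of a homotopy are not injective; corners become
  distinct only after lifting.

  The bound \<open>3 \<le> r\<close> makes triangles lift to triangles, lets triangles count as
  short cycles, and puts the rim of a wheel into the ball around its hub.

  In infinite graphs minimal local separators need a compactness argument: every local connection is
  witnessed by finitely many vertices.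

  The implications form two circles through (iii): (i), (ii), (iii), (i) and (iii), (iv), (ii),
  (iii).\<close>

text \<open>A list is read as a polygon whose corners are labelled in cyclic order; a triangulation is rooted
  at the side from the last to the first corner, and \<open>glue\<close> adds the triangle at that side. As \<open>R\<close>
  will be reflexive, sides and diagonals may join equal labels.\<close>

inductive triangulable :: "('a \<Rightarrow> 'a \<Rightarrow> bool) \<Rightarrow> 'a list \<Rightarrow> bool" for R where
  single: "triangulable R [x]"
| pair: "R x y \<Longrightarrow> triangulable R [x, y]"
| glue: "triangulable R (xs @ [y]) \<Longrightarrow> triangulable R (y # ys) \<Longrightarrow> xs \<noteq> [] \<Longrightarrow> ys \<noteq> [] \<Longrightarrow>
    R (hd xs) (last ys) \<Longrightarrow> triangulable R (xs @ y # ys)"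

lemma triangulable_successively: "triangulable R xs \<Longrightarrow> successively R xs"
  by (induction rule: triangulable.induct) (auto simp: successively_append_iff successively_Cons)

lemma triangulable_root: "triangulable R xs \<Longrightarrow> 2 \<le> length xs \<Longrightarrow> R (hd xs) (last xs)"
  by (induction rule: triangulable.induct) auto

text \<open>\<open>L @ [t]\<close> arises from \<open>Z @ [t]\<close> by replacing each step with a triangulable segment. Splitting off
  the common last vertex \<open>t\<close> makes refinements compose by appending.\<close>

inductive refines :: "('a \<Rightarrow> 'a \<Rightarrow> bool) \<Rightarrow> 'a list \<Rightarrow> 'a list \<Rightarrow> 'a \<Rightarrow> bool" for R where
  nil: "refines R [] [] t"
| segment: "triangulable R (S @ [hd (L @ [t])]) \<Longrightarrow> S \<noteq> [] \<Longrightarrow> refines R L Z t \<Longrightarrow>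
    refines R (S @ L) (hd S # Z) t"

lemma refines_hd: "refines R L Z t \<Longrightarrow> hd (L @ [t]) = hd (Z @ [t])"
  by (induction rule: refines.induct) auto

lemma refines_Nil_iff: "refines R L Z t \<Longrightarrow> L = [] \<longleftrightarrow> Z = []"
  by (induction rule: refines.induct) auto

lemma refines_append:
  assumes "refines R L1 Z1 y" "refines R L2 Z2 t" "y = hd (L2 @ [t])"
  shows "refines R (L1 @ L2) (Z1 @ Z2) t"
  using assms
proof (induction rule: refines.induct)
  case (segment S L y Z)
  have "hd (L @ [y]) = hd ((L @ L2) @ [t])"
    using segment by (cases L) auto
  then show ?case
    using segment refines.segment[of R S "L @ L2" t "Z @ Z2"] by auto
qed auto

lemma refines_split:
  "refines R L (Z1 @ Z2) t \<Longrightarrow>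
    \<exists>L1 L2. L = L1 @ L2 \<and> refines R L1 Z1 (hd (L2 @ [t])) \<and> refines R L2 Z2 t"
proof (induction Z1 arbitrary: L)
  case Nil
  then show ?case by (auto intro: refines.nil)
next
  case (Cons z Z1)
  from Cons.prems obtain S L' where S: "L = S @ L'" "triangulable R (S @ [hd (L' @ [t])])" "S \<noteq> []"
      "refines R L' (Z1 @ Z2) t" "z = hd S"
    by (auto elim: refines.cases)
  from Cons.IH[OF S(4)] obtain L1 L2 where L: "L' = L1 @ L2" "refines R L1 Z1 (hd (L2 @ [t]))"
      "refines R L2 Z2 t" by blast
  have "hd (L' @ [t]) = hd (L1 @ [hd (L2 @ [t])])"
    using L by (cases L1) auto
  then have "refines R (S @ L1) (z # Z1) (hd (L2 @ [t]))"
    using S L refines.segment[of R S L1 "hd (L2 @ [t])" Z1] by auto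
  then show ?case using S L by (metis append.assoc)
qed

lemma refines_walk: "successively R (L @ [t]) \<Longrightarrow> refines R L L t"
proof (induction L)
  case (Cons x L)
  have "triangulable R ([x] @ [hd (L @ [t])])"
    using Cons by (cases L) (auto intro: triangulable.pair)
  then show ?case
    using Cons refines.segment[of R "[x]" L t L] by (cases L) (auto intro: refines.nil)
qed (auto intro: refines.nil)

text \<open>Each triangulated segment is attached along its side of the coarse polygon
  \<open>Z @ [t]\<close>. The root side is not subdivided, so it stays the root side, and the
  triangles of the coarse polygon are kept one by one.\<close>

lemma triangulable_refines:
  "triangulable R (Z @ [t]) \<Longrightarrow> refines R L Z t \<Longrightarrow> triangulable R (L @ [t])"
proof (induction "Z @ [t]" arbitrary: Z t L rule: triangulable.induct)
  case (single x)
  then have "Z = []" "L = []" by (auto simp: refines_Nil_iff)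
  then show ?case by (auto intro: triangulable.single)
next
  case (pair x y)
  then have Z: "Z = [x]" "t = y" by (cases Z; auto)+
  from pair.prems obtain S where "L = S" "triangulable R (S @ [y])"
    unfolding Z by (auto elim!: refines.cases[of R L "[x]"] dest: refines_Nil_iff)
  then show ?case using Z by simp
next
  case (glue xs y ys)
  obtain ys' where ys: "ys = ys' @ [t]" and Z: "Z = xs @ y # ys'"
    using glue.hyps by (cases ys rule: rev_cases) auto
  obtain L1 L2 where L: "L = L1 @ L2" "refines R L1 xs (hd (L2 @ [t]))" "refines R L2 (y # ys') t"
    using refines_split[of R L xs "y # ys'" t] glue.prems Z by auto
  have y: "hd (L2 @ [t]) = y" using refines_hd[OF L(3)] by simp
  have "L2 \<noteq> []" using refines_Nil_iff[OF L(3)] by simp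
  then obtain L2' where L2: "L2 = y # L2'" using y by (cases L2) auto
  have 1: "triangulable R (L1 @ [y])" using glue.hyps(2)[of xs y L1] L(2) y by simp
  have 2: "triangulable R (y # L2' @ [t])" using glue.hyps(4)[of "y # ys'" t L2] ys L(3) L2 by simp
  have "L1 \<noteq> []" using refines_Nil_iff[OF L(2)] glue.hyps by simp
  moreover have "hd L1 = hd xs"
    using refines_hd[OF L(2)] \<open>L1 \<noteq> []\<close> glue.hyps by simp
  ultimately show ?case
    using triangulable.glue[OF 1 2] glue.hyps ys L L2 by simp
qed

text \<open>\<open>Z @ [x]\<close> is the outer boundary of the fan of triangles at the last corner
  \<open>y\<close>; what the fan cuts off are the segments refining \<open>Z\<close>. The root
  triangle belongs to the fan and contributes \<open>hd xs\<close>; the other triangles at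
  \<open>y\<close> lie in the right part, where \<open>y\<close> is again the last corner.\<close>

lemma triangulable_fan_last:
  "triangulable R (L @ [x, y]) \<Longrightarrow>
    \<exists>Z. refines R L Z x \<and> successively R (Z @ [x]) \<and> (\<forall>z\<in>set (Z @ [x]). R z y)"
proof (induction "L @ [x, y]" arbitrary: L rule: triangulable.induct)
  case (pair a b)
  then show ?case by (intro exI[of _ "[]"]) (auto intro: refines.nil)
next
  case (glue xs m ys)
  obtain M where M: "m # ys = M @ [x, y]" "L = xs @ M"
  proof (cases ys rule: rev_cases)
    case (snoc ys' b)
    then have "xs @ m # ys' = L @ [x]" "b = y" using glue.hyps(8) by auto
    then show ?thesis using that[of "butlast (m # ys')"] snoc
      by (metis append.assoc append_Cons append_Nil append_butlast_last_id butlast_append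
          butlast_snoc last_appendR last_snoc list.distinct(1))
  qed (use glue.hyps in auto)
  from glue.hyps(4)[OF M(1)] obtain Z where Z: "refines R M Z x" "successively R (Z @ [x])"
      "\<forall>z\<in>set (Z @ [x]). R z y" by blast
  have m: "hd (M @ [x]) = m" using M by (cases M) auto
  have "refines R (xs @ M) (hd xs # Z) x"
    using refines.segment[of R xs M x Z] m Z glue.hyps by simp
  moreover have "R (hd xs) m"
    using triangulable_root[OF glue.hyps(1)] glue.hyps(5) by (cases xs) auto
  then have "successively R (hd xs # Z @ [x])"
    using Z(2) refines_hd[OF Z(1)] m by (cases Z) auto
  moreover have "last ys = y" using M glue.hyps(6) by (cases M) (auto split: if_splits)
  then have "R (hd xs) y" using glue.hyps by simp
  ultimately show ?case using Z M by (intro exI[of _ "hd xs # Z"]) auto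
qed auto

text \<open>The mirror image for the first corner. Now the recursion enters the left part, so fan
  vertices are added at the end and the detached last vertex \<open>t\<close> changes from step to
  step.\<close>

lemma triangulable_fan_hd:
  "triangulable R (y # z # B) \<Longrightarrow>
    \<exists>B' Z t. z # B = B' @ [t] \<and> refines R B' Z t \<and> successively R (Z @ [t]) \<and>
      (\<forall>x\<in>set (Z @ [t]). R y x)"
proof (induction "y # z # B" arbitrary: B rule: triangulable.induct)
  case pair
  then show ?case by (intro exI[of _ "[]"] exI[of _ z]) (auto intro: refines.nil)
next
  case (glue xs m ys)
  obtain B1 where B1: "xs @ [m] = y # z # B1" "B = B1 @ ys"
    using glue.hyps(5,8)
    by (cases xs; cases "tl xs") auto
  from glue.hyps(2)[OF B1(1)] obtain B' Z t where Z: "z # B1 = B' @ [t]" "refines R B' Z t"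
      "successively R (Z @ [t])" "\<forall>x\<in>set (Z @ [t]). R y x" by blast
  have t: "t = m"
    using B1 Z(1) by (metis last.simps last_snoc list.distinct(1))
  obtain ys' t' where ys: "ys = ys' @ [t']" using glue.hyps(6) by (cases ys rule: rev_cases) auto
  \<comment> \<open>The part behind the apex \<open>m\<close> contains no triangle at
    \<open>y\<close> and becomes one segment.\<close>
  have "refines R (m # ys') [m] t'"
    using refines.segment[of R "m # ys'" "[]" t' "[]"] glue.hyps(3) ys by (auto intro: refines.nil)
  then have "refines R (B' @ m # ys') (Z @ [m]) t'"
    using refines_append[OF Z(2)] t by simp
  moreover have "R m t'" using triangulable_root[OF glue.hyps(3)] ys by simp
  then have "successively R ((Z @ [m]) @ [t'])"
    using Z(3) t by (simp add: successively_append_iff)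
  moreover have "hd xs = y" using B1(1) glue.hyps(5) by (cases xs) auto
  then have "R y t'" using glue.hyps ys by simp
  moreover have "z # B = (B' @ m # ys') @ [t']"
    using Z(1) B1(2) ys t by simp
  ultimately show ?case using Z(4) t by (intro exI[of _ "B' @ m # ys'"] exI[of _ "Z @ [m]"] exI[of _ t'])
      auto
qed

text \<open>Locates a corner \<open>y\<close> with its two neighbours relative to the apex
  \<open>m\<close> of the root triangle. Since both parts contain the apex, all three corners lie in
  one part unless \<open>y\<close> is the apex.\<close>

lemma append_Cons_eq_append_Cons3:
  "xs @ m # ys = A @ x # y # z # B \<Longrightarrow>
    (\<exists>A'. A = xs @ A' \<and> m # ys = A' @ x # y # z # B) \<or> (xs = A @ [x] \<and> m = y \<and> ys = z # B) \<or>
    (\<exists>B'. xs @ [m] = A @ x # y # z # B' \<and> B = B' @ ys)"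
proof (induction xs arbitrary: A)
  case (Cons a xs)
  show ?case
  proof (cases A)
    case Nil
    then have "a = x" "xs @ m # ys = y # z # B" using Cons by auto
    then show ?thesis using Nil by (cases xs; cases "tl xs") auto
  next
    case (Cons b A')
    then show ?thesis using Cons.IH[of A'] Cons.prems by auto
  qed
qed auto

text \<open>The abstract form of chordal neighbourhoods. It speaks of closed walks instead of cycles
  because the boundary of a fan may repeat labels, and for reflexive \<open>R\<close> may even
  contain \<open>y\<close>.\<close>

definition links_triangulable :: "('a \<Rightarrow> 'a \<Rightarrow> bool) \<Rightarrow> bool" where
  "links_triangulable R \<longleftrightarrow> (\<forall>y Z. Z \<noteq> [] \<longrightarrow> successively R Z \<longrightarrow> R (last Z) (hd Z) \<longrightarrow>
     (\<forall>z\<in>set Z. R y z) \<longrightarrow> triangulable R Z)"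

text \<open>The triangles at the deleted corner \<open>y\<close> form a fan, whose outer boundary together with the new
  edge \<open>x z\<close> is a closed walk in the neighbourhood of \<open>y\<close>. Retriangulating the latter suffices.\<close>

lemma triangulable_delete:
  assumes sym: "symp R"
    and link: "links_triangulable R"
    and "triangulable R (A @ x # y # z # B)" "R x z"
  shows "triangulable R (A @ x # z # B)"
  using assms(3)
proof (induction "A @ x # y # z # B" arbitrary: A B rule: triangulable.induct)
  case (glue xs m ys)
  consider A' where "A = xs @ A'" "m # ys = A' @ x # y # z # B"
    | "xs = A @ [x]" "m = y" "ys = z # B"
    | B' where "xs @ [m] = A @ x # y # z # B'" "B = B' @ ys"
    using append_Cons_eq_append_Cons3[OF glue.hyps(8)] by blast
  then show ?case
  proof cases
    case 1
    obtain ys' where ys': "A' @ x # z # B = m # ys'" "ys' \<noteq> []" "last ys' = last ys"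
      using 1(2) by (cases A') auto
    show ?thesis
      using triangulable.glue[OF glue.hyps(1), of ys'] glue.hyps(4)[OF 1(2)] ys' glue.hyps(5,7) 1(1) by simp
  next
    \<comment> \<open>The deleted corner is the apex. Its fan consists of the fan at the last corner
      of the left part, the root triangle, and the fan at the first corner of the right part; the
      root side from \<open>t\<close> to \<open>hd xs\<close> lies on the boundary of this
      fan.\<close>
    case 2
    obtain Z1 where Z1: "refines R A Z1 x" "successively R (Z1 @ [x])" "\<forall>z\<in>set (Z1 @ [x]). R z y"
      using triangulable_fan_last[of R A x y] glue.hyps(1) 2 by auto
    obtain B' Z2 t where Z2: "z # B = B' @ [t]" "refines R B' Z2 t" "successively R (Z2 @ [t])"
      "\<forall>x\<in>set (Z2 @ [t]). R y x"
      using triangulable_fan_hd[of R y z B] glue.hyps(3) 2 by auto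
    have z: "z = hd (B' @ [t])" "hd (Z2 @ [t]) = z"
      using Z2(1) refines_hd[OF Z2(2)] by (metis list.sel(1))+
    have "refines R [x] [x] z"
      using refines.segment[of R "[x]" "[]" z "[]"] \<open>R x z\<close>
      by (auto intro: refines.nil triangulable.pair)
    then have "refines R (A @ [x]) (Z1 @ [x]) z"
      using refines_append[OF Z1(1)] by simp
    then have ref: "refines R ((A @ [x]) @ B') ((Z1 @ [x]) @ Z2) t"
      by (rule refines_append[OF _ Z2(2) z(1)])
    have "last ys = t" using 2 Z2(1) by (metis last_snoc)
    then have "R t (hd xs)" using glue.hyps(7) sym by (auto dest: sympD)
    moreover have "hd xs = hd (Z1 @ [x])" using 2 refines_hd[OF Z1(1)] by simp
    moreover have "successively R ((Z1 @ [x]) @ Z2 @ [t])"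
      by (subst successively_append_iff) (use Z1(2) Z2(3) z \<open>R x z\<close> in auto)
    ultimately have "triangulable R ((Z1 @ [x]) @ Z2 @ [t])"
      using Z1(3) Z2(4) sym by (intro link[unfolded links_triangulable_def, rule_format, of _ y])
        (auto simp: hd_append dest: sympD split: if_splits)
    then have "triangulable R (((Z1 @ [x]) @ Z2) @ [t])" by simp
    from triangulable_refines[OF this ref] show ?thesis
      using Z2(1) by simp
  next
    case 3
    obtain xs' where xs': "A @ x # z # B' = xs' @ [m]" "xs' \<noteq> []" "hd xs' = hd xs"
      using 3(1)
      by (cases B' rule: rev_cases; cases A) auto
    have "triangulable R (xs' @ m # ys)"
      using triangulable.glue[of R xs' m ys] glue.hyps(2)[OF 3(1)] xs' glue.hyps(3,6,7) by simp
    moreover have "A @ x # z # B = xs' @ m # ys"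
      using xs'(1) 3(2) by (metis append.assoc append_Cons append_Nil)
    ultimately show ?thesis by simp
  qed
qed auto

text \<open>The direction that needs no condition on neighbourhoods: the triangle
  \<open>x y z\<close> is attached to the side \<open>x z\<close>.\<close>

lemma triangulable_insert:
  assumes "reflp R" "triangulable R (A @ x # z # B)" "R x y" "R y z"
  shows "triangulable R (A @ x # y # z # B)"
proof -
  obtain B' t where B: "z # B = B' @ [t]"
    by (metis append_butlast_last_id list.distinct(1))
  have s: "successively R (A @ x # z # B)" using triangulable_successively assms by blast
  have z: "hd (B' @ [t]) = z" using B by (metis list.sel(1))
  have "R x z" using s by (auto simp: successively_append_iff)
  then have "triangulable R ([x, y] @ [hd (B' @ [t])])"
    using triangulable.glue[of R "[x]" y "[z]"] assms z by (auto intro: triangulable.pair)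
  moreover have "refines R B' B' t"
    using s unfolding B
    by (intro refines_walk) (auto simp: successively_append_iff successively_Cons)
  ultimately have "refines R ([x, y] @ B') (x # B') t"
    using refines.segment[of R "[x, y]" B' t B'] by simp
  moreover have "refines R A A x"
    using s by (intro refines_walk) (auto simp: successively_append_iff)
  ultimately have "refines R (A @ [x, y] @ B') (A @ x # B') t"
    using refines_append[of R A A x] by simp
  then show ?thesis
    using triangulable_refines[of R "A @ x # B'" t "A @ [x, y] @ B'"] assms(2) B by simp
qed

text \<open>Joins two polygons along an arbitrary side of the first, whereas \<open>glue\<close>
  works only at the root triangle.\<close>

lemma triangulable_diagonal:
  assumes "triangulable R (A @ x # y # B)" "triangulable R (x # M @ [y])"
  shows "triangulable R (A @ x # M @ y # B)"
proof -
  obtain B' t where B: "y # B = B' @ [t]"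
    by (metis append_butlast_last_id list.distinct(1))
  have s: "successively R (A @ x # y # B)" using triangulable_successively assms by blast
  have z: "hd (B' @ [t]) = y" using B by (metis list.sel(1))
  have "refines R B' B' t"
    using s unfolding B
    by (intro refines_walk) (auto simp: successively_append_iff successively_Cons)
  then have "refines R ((x # M) @ B') (x # B') t"
    using refines.segment[of R "x # M" B' t B'] z assms(2) by simp
  moreover have "refines R A A x"
    using s by (intro refines_walk) (auto simp: successively_append_iff)
  ultimately have "refines R (A @ (x # M) @ B') (A @ x # B') t"
    using refines_append[of R A A x] by simp
  then show ?thesis
    using triangulable_refines[of R "A @ x # B'" t "A @ (x # M) @ B'"] assms(1) B by simp
qed

section \<open>Closed walks of a graph as labelled polygons\<close>

definition ladj :: "'a ugraph \<Rightarrow> 'a \<Rightarrow> 'a \<Rightarrow> bool" where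
  "ladj G x y \<longleftrightarrow> x = y \<or> {x, y} \<in> edges G"

lemma ladj_refl: "ladj G x x"
  by (simp add: ladj_def)

lemma ladj_sym: "ladj G x y \<Longrightarrow> ladj G y x"
  by (auto simp: ladj_def insert_commute)

lemma reflp_ladj: "reflp (ladj G)"
  by (simp add: reflp_def ladj_refl)

lemma symp_ladj: "symp (ladj G)"
  by (auto simp: symp_def ladj_sym)

lemma successively_ladj_rev: "successively (ladj G) F \<Longrightarrow> successively (ladj G) (rev F)"
proof -
  assume F: "successively (ladj G) F"
  have "(\<lambda>x y. ladj G y x) = ladj G" by (intro ext) (metis ladj_sym)
  then show ?thesis unfolding successively_rev using F by metis
qed

lemma edge_verts:
  assumes "simple_graph G" "{x, y} \<in> edges G"
  shows "x \<in> verts G" "y \<in> verts G" "x \<noteq> y"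
  using assms by (auto simp: simple_graph_def)

lemma edgeE:
  assumes "simple_graph G" "e \<in> edges G"
  obtains x y where "e = {x, y}" "x \<noteq> y"
  using assms by (metis simple_graph_def card_2_iff)

lemma cycle_edges_Suc: "Suc i < length c \<Longrightarrow> {c ! i, c ! Suc i} \<in> cycle_edges c"
  unfolding cycle_edges_def by (auto intro!: exI[of _ i])

lemma cycle_edges_last:
  assumes "c \<noteq> []"
  shows "{c ! 0, c ! (length c - 1)} \<in> cycle_edges c"
proof -
  have "Suc (length c - 1) mod length c = 0" using assms by (cases c) auto
  then show ?thesis
    using assms unfolding cycle_edges_def
    by (auto intro!: exI[of _ "length c - 1"] simp: insert_commute)
qed

lemma cycle_edgesE:
  assumes "e \<in> cycle_edges c"
  obtains i where "Suc i < length c" "e = {c ! i, c ! Suc i}"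
    | "c \<noteq> []" "e = {c ! 0, c ! (length c - 1)}"
proof -
  from assms obtain i where i: "i < length c" "e = {c ! i, c ! (Suc i mod length c)}"
    by (auto simp: cycle_edges_def)
  show ?thesis
  proof (cases "Suc i < length c")
    case True
    then show ?thesis using i that(1) by auto
  next
    case False
    then have "Suc i = length c" using i by simp
    then have "i = length c - 1" "Suc i mod length c = 0" "c \<noteq> []" by auto
    then show ?thesis using i that(2) by (simp add: insert_commute)
  qed
qed

text \<open>Chords are described by positions: \<open>i + 2 \<le> j\<close>, with the pair of first
  and last position excluded, means that the positions are not cyclically consecutive. The same
  condition describes diagonals of closed walks with repeated vertices.\<close>

lemma has_chordE:
  assumes "simple_graph G" "has_chord G c"
  obtains i j where "i + 2 \<le> j" "j < length c" "\<not> (i = 0 \<and> j = length c - 1)"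
    "{c ! i, c ! j} \<in> edges G"
proof -
  obtain e where e: "e \<in> edges G" "e \<subseteq> set c" "e \<notin> cycle_edges c"
    using assms by (auto simp: has_chord_def)
  obtain x y where xy: "e = {x, y}" "x \<noteq> y" using edgeE[OF assms(1) e(1)] by blast
  have "\<exists>i j. i < j \<and> j < length c \<and> e = {c ! i, c ! j}"
  proof -
    obtain i j where "c ! i = x" "c ! j = y" "i < length c" "j < length c"
      using xy e by (auto simp: in_set_conv_nth)
    then show ?thesis using xy
      by (metis insert_commute linorder_neqE_nat)
  qed
  then obtain i j where ij: "i < j" "j < length c" "e = {c ! i, c ! j}" by blast
  have "j \<noteq> Suc i" using cycle_edges_Suc[of i c] ij e by auto
  moreover have "\<not> (i = 0 \<and> j = length c - 1)" using cycle_edges_last[of c] ij e by force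
  ultimately show ?thesis using that[of i j] ij e by auto
qed

lemma has_chordI:
  assumes "distinct c" "{c ! i, c ! j} \<in> edges G" "i + 2 \<le> j" "j < length c"
    "\<not> (i = 0 \<and> j = length c - 1)"
  shows "has_chord G c"
proof -
  have "{c ! i, c ! j} \<notin> cycle_edges c"
  proof
    assume "{c ! i, c ! j} \<in> cycle_edges c"
    then show False
    proof (cases rule: cycle_edgesE)
      case (1 k)
      then have "c ! i = c ! k \<and> c ! j = c ! Suc k \<or> c ! i = c ! Suc k \<and> c ! j = c ! k"
        by (simp add: doubleton_eq_iff)
      moreover have "i < length c" "k < length c" using assms 1 by auto
      ultimately have "i = k \<and> j = Suc k \<or> i = Suc k \<and> j = k"
        using assms(1,4) 1(1) by (metis nth_eq_iff_index_eq)
      then show ?thesis using assms by auto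
    next
      case 2
      then have "c ! i = c ! 0 \<and> c ! j = c ! (length c - 1) \<or> c ! i = c ! (length c - 1) \<and> c ! j = c ! 0"
        by (auto simp: doubleton_eq_iff)
      moreover have "length c - 1 < length c" "0 < length c" "i < length c" using assms by auto
      ultimately have "i = 0 \<and> j = length c - 1 \<or> i = length c - 1 \<and> j = 0"
        using assms(1,4) by (metis nth_eq_iff_index_eq)
      then show ?thesis using assms by auto
    qed
  qed
  then show ?thesis
    using assms unfolding has_chord_def by (intro bexI[of _ "{c ! i, c ! j}"]) auto
qed

text \<open>Without a diagonal the walk would have no repetition and hence be a chordless
  cycle.\<close>

lemma closed_walk_diagonal:
  assumes G: "simple_graph G"
    and c: "successively (ladj G) c" "ladj G (last c) (hd c)" "4 \<le> length c"
    and chord: "cycle G c \<Longrightarrow> has_chord G c"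
  shows "\<exists>i j. i + 2 \<le> j \<and> j < length c \<and> \<not> (i = 0 \<and> j = length c - 1) \<and> ladj G (c ! i) (c ! j)"
proof (rule ccontr)
  let ?n = "length c"
  assume "\<not> ?thesis"
  then have no: "\<not> ladj G (c ! i) (c ! j)" if "i + 2 \<le> j" "j < ?n" "\<not> (i = 0 \<and> j = ?n - 1)" for i j
    using that by blast
  have step: "ladj G (c ! i) (c ! Suc i)" if "Suc i < ?n" for i
    using c(1) that by (auto simp: successively_conv_nth)
  have close: "ladj G (c ! 0) (c ! (?n - 1))"
    using c(2,3) by (metis hd_conv_nth ladj_sym last_conv_nth length_0_conv not_numeral_le_zero)
  have ne: "c ! i \<noteq> c ! j" if "i < j" "j < ?n" for i j
  proof
    assume eq: "c ! i = c ! j"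
    \<comment> \<open>Equal entries at non-consecutive positions are a diagonal themselves. If
      consecutive entries are equal, a step at one of them becomes a diagonal from the other; the
      cases differ only in the neighbouring position that is used.\<close>
    consider "i + 2 \<le> j" "\<not> (i = 0 \<and> j = ?n - 1)" | "i = 0" "j = ?n - 1" | "j = Suc i" "i = 0"
      | k where "i = Suc k" "j = Suc (Suc k)"
      using \<open>i < j\<close> by (cases i) force+
    then show False
    proof cases
      case 1
      then show ?thesis using no[of i j] that eq by (simp add: ladj_refl)
    next
      case 2
      have n: "Suc (?n - 2) = ?n - 1" "Suc (?n - 2) < ?n" "0 + 2 \<le> ?n - 2" "?n - 2 \<noteq> ?n - 1"
        using c(3) by arith+
      have "ladj G (c ! (?n - 1)) (c ! (?n - 2))"
        using step[OF n(2)] n(1) by (auto intro: ladj_sym)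
      then show ?thesis using no[OF n(3)] n 2 eq by simp
    next
      case 3
      have "Suc 1 \<noteq> ?n - 1" using c(3) by arith
      then show ?thesis using 3 no[of 0 "Suc 1"] step[of 1] eq c(3) by auto
    next
      case 4
      have "\<not> (k = 0 \<and> Suc (Suc k) = ?n - 1)" using c(3) by arith
      then show ?thesis using 4 no[of k "Suc (Suc k)"] step[of k] eq c(3) that by auto
    qed
  qed
  then have d: "distinct c"
    by (auto simp: distinct_conv_nth) (metis linorder_neqE_nat)
  have E: "{c ! i, c ! Suc i} \<in> edges G" if "Suc i < ?n" for i
    using step[OF that] ne[of i "Suc i"] that by (auto simp: ladj_def)
  have E': "{c ! 0, c ! (?n - 1)} \<in> edges G"
    using close ne[of 0 "?n - 1"] c(3) by (auto simp: ladj_def)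
  have ce: "cycle_edges c \<subseteq> edges G"
    by (rule subsetI, erule cycle_edgesE) (use E E' in auto)
  have "c ! i \<in> verts G" if "i < ?n" for i
  proof (cases "Suc i < ?n")
    case True
    then show ?thesis using E edge_verts[OF G] by blast
  next
    case False
    then have "i = ?n - 1" using that by auto
    then show ?thesis using E' edge_verts[OF G] by blast
  qed
  then have "cycle G c"
    using d ce c(3) by (auto simp: cycle_def in_set_conv_nth)
  then obtain i j where "i + 2 \<le> j" "j < ?n" "\<not> (i = 0 \<and> j = ?n - 1)" "{c ! i, c ! j} \<in> edges G"
    using has_chordE[OF G chord] by metis
  then show False using no by (auto simp: ladj_def)
qed

lemma list_split_two:
  assumes "i < j" "j < length c"
  shows "c = take i c @ c ! i # take (j - i - 1) (drop (Suc i) c) @ c ! j # drop (Suc j) c"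
proof -
  have "drop (Suc i) c = take (j - i - 1) (drop (Suc i) c) @ drop (j - i - 1) (drop (Suc i) c)"
    by (rule append_take_drop_id[symmetric])
  also have "drop (j - i - 1) (drop (Suc i) c) = c ! j # drop (Suc j) c"
    using assms by (simp add: Cons_nth_drop_Suc)
  finally have "drop i c = c ! i # take (j - i - 1) (drop (Suc i) c) @ c ! j # drop (Suc j) c"
    using assms by (metis Cons_nth_drop_Suc less_trans)
  then show ?thesis by (metis append_take_drop_id)
qed

text \<open>A diagonal splits the walk into two shorter closed walks, and both restrictions on
  cycles pass to them. The pair \<open>S\<close>, \<open>N\<close> serves two purposes: all vertices
  with bound \<open>r\<close> for \<open>r\<close>-chordality, and a closed neighbourhood with no
  effective bound for wheel-freeness.\<close>

lemma closed_walk_triangulable: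
  assumes G: "simple_graph G"
    and chord: "\<And>c. cycle G c \<Longrightarrow> set c \<subseteq> S \<Longrightarrow> 4 \<le> length c \<Longrightarrow> length c \<le> N \<Longrightarrow> has_chord G c"
  shows "c \<noteq> [] \<Longrightarrow> successively (ladj G) c \<Longrightarrow> ladj G (last c) (hd c) \<Longrightarrow> set c \<subseteq> S \<Longrightarrow>
    length c \<le> N \<Longrightarrow> triangulable (ladj G) c"
proof (induction "length c" arbitrary: c rule: less_induct)
  case less
  consider x where "c = [x]" | x y where "c = [x, y]" | x y z where "c = [x, y, z]" | "4 \<le> length c"
    using less.prems(1)
    by (cases c; cases "tl c"; cases "tl (tl c)"; cases "tl (tl (tl c))") auto
  then show ?case
  proof cases
    case 1
    then show ?thesis by (simp add: triangulable.single)
  next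
    case 2
    then show ?thesis using less by (auto intro: triangulable.pair)
  next
    case (3 x y z)
    then show ?thesis
      using less triangulable.glue[of "ladj G" "[x]" y "[z]"] by (auto intro: triangulable.pair ladj_sym)
  next
    case 4
    obtain i j where ij: "i + 2 \<le> j" "j < length c" "\<not> (i = 0 \<and> j = length c - 1)"
        "ladj G (c ! i) (c ! j)"
      using closed_walk_diagonal[OF G less.prems(2,3) 4] chord less.prems 4 by blast
    define A x M y B where "A = take i c" "x = c ! i" "M = take (j - i - 1) (drop (Suc i) c)"
      "y = c ! j" "B = drop (Suc j) c"
    note d = this
    have c: "c = A @ x # M @ y # B"
      using list_split_two[of i j c] ij unfolding d by simp
    have M: "M \<noteq> []" using ij by (simp add: d)
    have AB: "A \<noteq> [] \<or> B \<noteq> []" using ij by (auto simp: d)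
    have xy: "ladj G x y" using ij by (simp add: d)
    have "triangulable (ladj G) (x # M @ [y])"
      using less.prems xy AB M unfolding c
      by (intro less.hyps) (auto simp: c successively_append_iff successively_Cons intro: ladj_sym)
    moreover have "triangulable (ladj G) (A @ x # y # B)"
      using less.prems xy M unfolding c
      by (intro less.hyps) (auto simp: c successively_append_iff successively_Cons hd_append split: if_splits)
    ultimately show ?thesis unfolding c by (intro triangulable_diagonal)
  qed
qed

text \<open>With four corners, one of the two parts at the root triangle is more than a side; the
  leg of the root triangle bounding that part is a diagonal.\<close>

lemma triangulable_imp_diagonal:
  assumes "triangulable R c" "4 \<le> length c"
  shows "\<exists>i j. i + 2 \<le> j \<and> j < length c \<and> \<not> (i = 0 \<and> j = length c - 1) \<and> R (c ! i) (c ! j)"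
  using assms
proof cases
  case (glue xs y ys)
  show ?thesis
  proof (cases "2 \<le> length xs")
    case True
    have "R (hd (xs @ [y])) y" using triangulable_root[OF glue(2)] True by simp
    then have "R (c ! 0) (c ! length xs)"
      using glue True by (cases xs) auto
    then show ?thesis using True glue by (intro exI[of _ 0] exI[of _ "length xs"]) auto
  next
    case False
    then have 1: "length xs = 1" using glue(4) by (cases "length xs") auto
    then have 2: "2 \<le> length ys" using assms glue(1) by simp
    have "R y (last ys)" using triangulable_root[OF glue(3)] glue(5) by (cases ys) auto
    moreover have "c ! 1 = y" "c ! (length c - 1) = last ys"
      using glue 1 2 by (auto simp: nth_append last_conv_nth)
    ultimately show ?thesis using 1 2 glue(1) by (intro exI[of _ 1] exI[of _ "length c - 1"]) auto
  qed
qed auto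

section \<open>Combinatorial homotopy of walks\<close>

text \<open>Elementary homotopies with fixed ends: crossing a triangle and dropping a standing step.
  As \<open>R\<close> will be reflexive, \<open>x = z\<close> is allowed in \<open>corner\<close>,
  so backtracking is removed by \<open>corner\<close> followed by \<open>stay\<close>.\<close>

inductive shortcut :: "('a \<Rightarrow> 'a \<Rightarrow> bool) \<Rightarrow> 'a list \<Rightarrow> 'a list \<Rightarrow> bool" for R where
  corner: "R x y \<Longrightarrow> R y z \<Longrightarrow> R x z \<Longrightarrow> shortcut R (A @ x # y # z # B) (A @ x # z # B)"
| stay: "shortcut R (A @ x # x # B) (A @ x # B)"

abbreviation homotopic :: "('a \<Rightarrow> 'a \<Rightarrow> bool) \<Rightarrow> 'a list \<Rightarrow> 'a list \<Rightarrow> bool" where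
  "homotopic R \<equiv> equivclp (shortcut R)"

lemma homotopic_context: "homotopic R xs ys \<Longrightarrow> homotopic R (A @ xs @ B) (A @ ys @ B)"
proof (induction rule: equivclp_induct)
  case (step y z)
  have "shortcut R (A @ p @ B) (A @ q @ B)" if "shortcut R p q" for p q
    using that
  proof cases
    case (corner x y z A' B')
    then show ?thesis using shortcut.corner[of R x y z "A @ A'" "B' @ B"] by simp
  next
    case (stay A' x B')
    then show ?thesis using shortcut.stay[of R "A @ A'" x "B' @ B"] by simp
  qed
  then show ?case using step by (meson equivclp_into_equivclp)
qed auto

lemma triangulable_shortcut:
  assumes R: "reflp R" "symp R"
    and link: "links_triangulable R"
    and "shortcut R xs ys"
  shows "triangulable R xs \<longleftrightarrow> triangulable R ys"
  using assms(4)
proof cases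
  case (corner x y z A B)
  then show ?thesis using triangulable_delete[OF R(2) link, of A x y z B] triangulable_insert[OF R(1), of A x z B y]
    by blast
next
  case (stay A x B)
  have refl: "R x x" using R by (simp add: reflpD)
  \<comment> \<open>A standing step is a degenerate corner \<open>a x x\<close> or
    \<open>x x b\<close>, so a neighbour on either side reduces it to deletion and insertion;
    without any neighbour both lists are triangulable outright.\<close>
  consider "A = []" "B = []" | A' a where "A = A' @ [a]" | b B' where "B = b # B'"
    by (cases A rule: rev_cases; cases B) auto
  then show ?thesis
  proof cases
    case 1
    then show ?thesis using stay refl by (auto intro: triangulable.single triangulable.pair)
  next
    case 2
    have "R a x" if "triangulable R xs \<or> triangulable R ys"
      using that stay 2 by (auto dest!: triangulable_successively simp: successively_append_iff successively_Cons)
    then show ?thesis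
      using triangulable_delete[OF R(2) link, of A' a x x B] triangulable_insert[OF R(1), of A' a x B x]
        stay 2 refl by auto
  next
    case 3
    have "R x b" if "triangulable R xs \<or> triangulable R ys"
      using that stay 3 by (auto dest!: triangulable_successively simp: successively_append_iff successively_Cons)
    then show ?thesis
      using triangulable_delete[OF R(2) link, of A x x b B'] triangulable_insert[OF R(1), of A x b B' x]
        stay 3 refl by auto
  qed
qed

lemma triangulable_homotopic:
  assumes R: "reflp R" "symp R"
    and link: "links_triangulable R"
    and "homotopic R xs ys"
  shows "triangulable R xs \<longleftrightarrow> triangulable R ys"
  using assms(4)
proof (induction rule: equivclp_induct)
  case (step y z)
  then show ?case
    using triangulable_shortcut[OF R link, of y z] triangulable_shortcut[OF R link, of z y] by blast
qed simp

text \<open>Both parts collapse to the legs of the root triangle, which then collapses to the root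
  side.\<close>

lemma triangulable_imp_homotopic:
  "triangulable R xs \<Longrightarrow> 2 \<le> length xs \<Longrightarrow> homotopic R xs [hd xs, last xs]"
proof (induction rule: triangulable.induct)
  case (glue xs y ys)
  have "homotopic R (xs @ [y]) [hd xs, y]" using glue by (cases xs) auto
  then have 1: "homotopic R (xs @ y # ys) ([hd xs, y] @ ys)"
    using homotopic_context[of R "xs @ [y]" "[hd xs, y]" "[]" ys] by simp
  have "homotopic R (y # ys) [y, last ys]" using glue by (cases ys) auto
  then have 2: "homotopic R (hd xs # y # ys) (hd xs # [y, last ys])"
    using homotopic_context[of R "y # ys" "[y, last ys]" "[hd xs]" "[]"] by simp
  have "R (hd xs) y" using triangulable_root[OF glue.hyps(1)] glue by (cases xs) auto
  moreover have "R y (last ys)" using triangulable_root[OF glue.hyps(2)] glue by (cases ys) auto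
  ultimately have "shortcut R [hd xs, y, last ys] [hd xs, last ys]"
    using glue shortcut.corner[of R "hd xs" y "last ys" "[]" "[]"] by simp
  then have "homotopic R [hd xs, y, last ys] [hd xs, last ys]" by auto
  then show ?case using 1 2 glue by (auto intro: equivclp_trans)
qed auto

text \<open>The walk runs along \<open>xs\<close> backwards and then forwards. It is contracted from
  its turning point \<open>hd xs\<close>, where \<open>b a b\<close> shrinks to
  \<open>b\<close>.\<close>

lemma homotopic_spur:
  assumes "reflp R" "symp R" "xs \<noteq> []" "successively R xs"
  shows "homotopic R (rev xs @ tl xs) [last xs]"
  using assms(3,4)
proof (induction xs rule: induct_list012)
  case (3 a b xs)
  have "R a b" "R b a" "R b b" using 3 assms by (auto dest: sympD reflpD)
  then have "shortcut R [b, a, b] [b, b]" "shortcut R [b, b] [b]"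
    using shortcut.corner[of R b a b "[]" "[]"] shortcut.stay[of R "[]" b "[]"] by auto
  then have "homotopic R [b, a, b] [b]"
    by (meson equivclp_trans r_into_equivclp)
  from homotopic_context[OF this, of "rev xs" xs]
  have "homotopic R (rev (a # b # xs) @ tl (a # b # xs)) (rev (b # xs) @ tl (b # xs))" by simp
  moreover have "homotopic R (rev (b # xs) @ tl (b # xs)) [last (b # xs)]" using 3 by auto
  ultimately show ?case by (metis equivclp_trans last_ConsR list.distinct(1))
qed auto

section \<open>Walks and balls\<close>

lemma walk_single_iff: "walk G [x] \<longleftrightarrow> x \<in> verts G"
  by (simp add: walk_def)

lemma walk_appendD1: "walk G (xs @ ys) \<Longrightarrow> xs \<noteq> [] \<Longrightarrow> walk G xs"
  by (auto simp: walk_def successively_append_iff)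

lemma walk_appendD2: "walk G (xs @ ys) \<Longrightarrow> ys \<noteq> [] \<Longrightarrow> walk G ys"
  by (auto simp: walk_def successively_append_iff)

lemma walk_append_iff:
  "xs \<noteq> [] \<Longrightarrow> ys \<noteq> [] \<Longrightarrow>
    walk G (xs @ ys) \<longleftrightarrow> walk G xs \<and> walk G ys \<and> {last xs, hd ys} \<in> edges G"
  by (auto simp: walk_def successively_append_iff)

lemma walk_hd_in: "walk G xs \<Longrightarrow> hd xs \<in> verts G"
  by (auto simp: walk_def)

lemma walk_last_in: "walk G xs \<Longrightarrow> last xs \<in> verts G"
  by (auto simp: walk_def)

lemma walk_snoc:
  assumes "simple_graph G" "walk G xs" "{last xs, v} \<in> edges G"
  shows "walk G (xs @ [v])"
  using assms edge_verts[OF assms(1,3)] by (auto simp: walk_def successively_append_iff)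

lemma walk_rev: "walk G xs \<Longrightarrow> walk G (rev xs)"
  by (auto simp: walk_def insert_commute)

lemma walk_join:
  assumes "walk G xs" "walk G ys" "last xs = hd ys"
  shows "walk G (xs @ tl ys)" "hd (xs @ tl ys) = hd xs" "last (xs @ tl ys) = last ys"
    "length (xs @ tl ys) = length xs + length ys - 1"
  using assms by (cases ys; auto simp: walk_def successively_append_iff successively_Cons)+

lemma walk_take: "walk G xs \<Longrightarrow> 0 < n \<Longrightarrow> walk G (take n xs)"
  using walk_appendD1[of G "take n xs" "drop n xs"] by (auto simp: walk_def)

lemma walk_drop: "walk G xs \<Longrightarrow> n < length xs \<Longrightarrow> walk G (drop n xs)"
  using walk_appendD2[of G "take n xs" "drop n xs"] by auto

lemma graph_hom_edge:
  assumes "graph_hom p H G" "{x, y} \<in> edges H"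
  shows "{p x, p y} \<in> edges G"
proof -
  have "p ` {x, y} \<in> edges G" using assms unfolding graph_hom_def by blast
  then show ?thesis by simp
qed

lemma walk_map:
  assumes "graph_hom p H G" "walk H xs"
  shows "walk G (map p xs)"
proof -
  have "successively (\<lambda>x y. {p x, p y} \<in> edges G) xs"
    using assms(2) graph_hom_edge[OF assms(1)] by (simp add: walk_def successively_conv_nth)
  moreover have "p ` set xs \<subseteq> verts G" using assms by (auto simp: walk_def graph_hom_def)
  ultimately show ?thesis using assms(2) by (simp add: walk_def successively_map)
qed

lemma walk_betw_refl: "x \<in> verts G \<Longrightarrow> walk_betw G x [x] x"
  by (simp add: walk_betw_def walk_def)

lemma walk_betw_rev: "walk_betw G x xs y \<Longrightarrow> walk_betw G y (rev xs) x"
  by (auto simp: walk_betw_def walk_rev hd_rev last_rev)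

lemma walk_betw_trans: "walk_betw G x xs y \<Longrightarrow> walk_betw G y ys z \<Longrightarrow> walk_betw G x (xs @ tl ys) z"
  unfolding walk_betw_def by (metis walk_join(1-3))

lemma walk_betw_map:
  assumes "graph_hom p H G" "walk_betw H x xs y"
  shows "walk_betw G (p x) (map p xs) (p y)"
  using assms walk_map[OF assms(1)] by (auto simp: walk_betw_def walk_def hd_map last_map)

lemma walk_betw_edge:
  "simple_graph G \<Longrightarrow> {x, y} \<in> edges G \<Longrightarrow> walk_betw G x [x, y] y"
  by (auto simp: walk_betw_def walk_def edge_verts)

lemma gdist_le_iff: "gdist G u v \<le> enat k \<longleftrightarrow> (\<exists>xs. walk_betw G u xs v \<and> length xs \<le> Suc k)"
proof
  assume le: "gdist G u v \<le> enat k"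
  let ?A = "(\<lambda>xs. enat (length xs - 1)) ` {xs. walk_betw G u xs v}"
  have g: "gdist G u v = Inf ?A" by (simp add: gdist_def)
  have "?A \<noteq> {}"
  proof
    assume "?A = {}"
    then have "gdist G u v = \<infinity>" using g by (metis Inf_enat_def)
    then show False using le by simp
  qed
  then have "gdist G u v \<in> ?A"
    unfolding g by (metis Inf_enat_def LeastI ex_in_conv)
  then obtain xs where "walk_betw G u xs v" "gdist G u v = enat (length xs - 1)" by auto
  then show "\<exists>xs. walk_betw G u xs v \<and> length xs \<le> Suc k" using le by (intro exI[of _ xs]) auto
next
  assume "\<exists>xs. walk_betw G u xs v \<and> length xs \<le> Suc k"
  then obtain xs where xs: "walk_betw G u xs v" "length xs \<le> Suc k" by blast
  have "gdist G u v \<le> enat (length xs - 1)"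
    unfolding gdist_def by (rule INF_lower) (use xs in simp)
  also have "\<dots> \<le> enat k" using xs(2) by simp
  finally show "gdist G u v \<le> enat k" .
qed

lemma half_ball_vert_iff:
  "u \<in> verts (half_ball G v r) \<longleftrightarrow> (\<exists>xs. walk_betw G v xs u \<and> 2 * (length xs - 1) \<le> r)"
proof
  assume "u \<in> verts (half_ball G v r)"
  then have le: "2 * gdist G v u \<le> enat r" by (simp add: half_ball_def)
  then obtain k where k: "gdist G v u = enat k"
    by (cases "gdist G v u") (auto simp: numeral_eq_enat)
  obtain xs where "walk_betw G v xs u" "length xs \<le> Suc k"
    using gdist_le_iff[of G v u k] k by auto
  then show "\<exists>xs. walk_betw G v xs u \<and> 2 * (length xs - 1) \<le> r"
    using le k by (intro exI[of _ xs]) (auto simp: numeral_eq_enat)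
next
  assume "\<exists>xs. walk_betw G v xs u \<and> 2 * (length xs - 1) \<le> r"
  then obtain xs where xs: "walk_betw G v xs u" "2 * (length xs - 1) \<le> r" by blast
  have le: "gdist G v u \<le> enat (length xs - 1)"
    by (subst gdist_le_iff) (use xs(1) in \<open>auto intro!: exI[of _ xs]\<close>)
  then obtain k where k: "gdist G v u = enat k" by (cases "gdist G v u") auto
  then have "2 * gdist G v u \<le> enat r" using le xs(2) by (simp add: numeral_eq_enat)
  moreover have "u \<in> verts G" using xs walk_last_in by (auto simp: walk_betw_def)
  ultimately show "u \<in> verts (half_ball G v r)" by (simp add: half_ball_def)
qed

text \<open>Lists count vertices, so the two lengths exceed the sum of the numbers of steps by
  2.\<close>

lemma half_ball_edge_iff:
  assumes "simple_graph G"
  shows "{a, b} \<in> edges (half_ball G v r) \<longleftrightarrow> {a, b} \<in> edges G \<and>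
    (\<exists>xs ys. walk_betw G v xs a \<and> walk_betw G v ys b \<and> length xs + length ys < r + 2)"
    (is "_ \<longleftrightarrow> _ \<and> ?W")
proof (cases "{a, b} \<in> edges G")
  case True
  then have ab: "a \<noteq> b" using assms edge_verts by metis
  have "gdist G v a + gdist G v b < enat r \<longleftrightarrow> ?W"
  proof
    assume le: "gdist G v a + gdist G v b < enat r"
    then obtain k l where kl: "gdist G v a = enat k" "gdist G v b = enat l"
      by (cases "gdist G v a"; cases "gdist G v b") auto
    obtain xs ys where "walk_betw G v xs a" "length xs \<le> Suc k" "walk_betw G v ys b" "length ys \<le> Suc l"
      using gdist_le_iff[of G v a k] gdist_le_iff[of G v b l] kl by auto
    then show ?W using le kl by (intro exI[of _ xs] exI[of _ ys]) auto
  next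
    assume ?W
    then obtain xs ys where w: "walk_betw G v xs a" "walk_betw G v ys b" "length xs + length ys < r + 2"
      by blast
    have ne: "xs \<noteq> []" "ys \<noteq> []" using w by (auto simp: walk_betw_def walk_def)
    have "gdist G v a \<le> enat (length xs - 1)" "gdist G v b \<le> enat (length ys - 1)"
      unfolding gdist_le_iff using w by (intro exI[of _ xs] exI[of _ ys]; simp)+
    then have "gdist G v a + gdist G v b \<le> enat (length xs - 1) + enat (length ys - 1)"
      by (rule add_mono)
    also have "\<dots> < enat r" using w(3) ne by (cases xs; cases ys) auto
    finally show "gdist G v a + gdist G v b < enat r" .
  qed
  then show ?thesis using True ab by (simp add: half_ball_def)
qed (auto simp: half_ball_def)

text \<open>The distances of adjacent vertices from \<open>v\<close> differ by at most one; a sum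
  below \<open>r\<close> therefore puts both ends within \<open>r / 2\<close>.\<close>

lemma simple_graph_half_ball:
  assumes "simple_graph G"
  shows "simple_graph (half_ball G v r)"
  unfolding simple_graph_def
proof (intro ballI conjI)
  fix e assume e: "e \<in> edges (half_ball G v r)"
  then have "e \<in> edges G" by (simp add: half_ball_def)
  then show "card e = 2" using assms by (simp add: simple_graph_def)
  have sub: "b \<in> verts (half_ball G v r)" if ab: "{a, b} \<in> edges (half_ball G v r)" for a b
  proof -
    obtain xs ys where w: "walk_betw G v xs a" "walk_betw G v ys b" "length xs + length ys < r + 2"
        and E: "{a, b} \<in> edges G"
      using ab half_ball_edge_iff[OF assms] by blast
    show ?thesis
    proof (cases "length xs < length ys")
      case True
      have "walk_betw G v (xs @ [b]) b"
        using w(1) E walk_snoc[OF assms, of xs b] by (auto simp: walk_betw_def walk_def)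
      then show ?thesis unfolding half_ball_vert_iff
        using True w(3) by (intro exI[of _ "xs @ [b]"]) auto
    next
      case False
      then show ?thesis unfolding half_ball_vert_iff
        using w by (intro exI[of _ ys]) auto
    qed
  qed
  obtain a b where "e = {a, b}" using edgeE[OF assms \<open>e \<in> edges G\<close>] by blast
  then show "e \<subseteq> verts (half_ball G v r)"
    using sub[of a b] sub[of b a] e by (auto simp: insert_commute)
qed

section \<open>Coverings\<close>

lemma covering_simple: "covering p H G \<Longrightarrow> simple_graph H" "covering p H G \<Longrightarrow> simple_graph G"
  by (auto simp: covering_def)

lemma covering_hom: "covering p H G \<Longrightarrow> graph_hom p H G"
  by (simp add: covering_def)

lemma graph_hom_vert: "graph_hom p H G \<Longrightarrow> x \<in> verts H \<Longrightarrow> p x \<in> verts G"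
  by (auto simp: graph_hom_def)

lemma covering_lift_edge:
  assumes "covering p H G" "x \<in> verts H" "{p x, g} \<in> edges G"
  shows "\<exists>y. {x, y} \<in> edges H \<and> p y = g"
proof -
  have "{p x, g} \<in> (\<lambda>e. p ` e) ` {e \<in> edges H. x \<in> e}"
    using assms by (auto simp: covering_def bij_betw_def)
  then obtain e where e: "e \<in> edges H" "x \<in> e" "p ` e = {p x, g}" by auto
  obtain a b where "e = {a, b}" using edgeE[OF covering_simple(1)[OF assms(1)] e(1)] by blast
  then obtain y where y: "e = {x, y}" using e(2) by (auto simp: insert_commute)
  then have "{p x, p y} = {p x, g}" using e(3) by simp
  moreover have "p x \<noteq> g" using edge_verts[OF covering_simple(2)[OF assms(1)] assms(3)] by simp
  ultimately have "p y = g" by (auto simp: doubleton_eq_iff)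
  then show ?thesis using e y by auto
qed

lemma covering_unique_edge:
  assumes "covering p H G" "{x, y} \<in> edges H" "{x, z} \<in> edges H" "p y = p z"
  shows "y = z"
proof -
  have "walk H [x, y]" "walk H [x, z]"
    using assms edge_verts[OF covering_simple(1)[OF assms(1)]] by (auto simp: walk_def)
  then have "[x, y] = [x, z]"
    by (rule covering_unique_lift[OF assms(1)]) (use assms in auto)
  then show ?thesis by simp
qed

lemma covering_surj:
  assumes "covering p H G" "g \<in> verts G"
  shows "\<exists>x\<in>verts H. p x = g"
proof -
  have "p ` verts H = verts G" using assms(1) by (simp add: covering_def)
  then show ?thesis using assms(2) by (metis imageE)
qed

lemma walk_in_component:
  assumes "walk_betw G u xs v" "walk_betw G b ys u"
  shows "walk_betw (induced G {u. \<exists>xs. walk_betw G b xs u}) u xs v"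
proof -
  let ?S = "{u. \<exists>xs. walk_betw G b xs u}"
  have "x \<in> ?S" if x: "x \<in> set xs" for x
  proof -
    obtain as bs where xs: "xs = (as @ [x]) @ bs" using x by (metis append.assoc append_Cons append_Nil split_list)
    then have "walk_betw G u (as @ [x]) x"
      using assms(1) walk_appendD1[of G "as @ [x]" bs] by (auto simp: walk_betw_def hd_append)
    then show ?thesis using walk_betw_trans[OF assms(2)] by blast
  qed
  then have S: "set xs \<subseteq> ?S" by blast
  have "successively (\<lambda>x y. {x, y} \<in> edges (induced G ?S)) xs"
    using assms(1) S
    by (auto simp: walk_betw_def walk_def successively_conv_nth induced_def subset_iff)
  then show ?thesis using S assms(1) by (auto simp: walk_betw_def walk_def induced_def)
qed

lemma covering_connected:
  assumes cov: "covering p H G" and "x \<in> verts H" "y \<in> verts H" "walk_betw G (p x) ws (p y)"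
  shows "\<exists>xs. walk_betw H x xs y"
proof -
  define C where "C = induced G {u. \<exists>xs. walk_betw G (p x) xs u}"
  have px: "p x \<in> verts G" using cov assms(2) covering_hom graph_hom_vert by fast
  then have "C \<in> components G" by (auto simp: C_def components_def)
  then have con: "connected_graph (preimage_graph p H C)"
    using cov by (auto simp: covering_def)
  have "x \<in> verts (preimage_graph p H C)" "y \<in> verts (preimage_graph p H C)"
    using assms walk_betw_refl[OF px] covering_hom[OF cov] graph_hom_vert
    by (fastforce simp: preimage_graph_def C_def induced_def)+
  with con obtain xs where "walk_betw (preimage_graph p H C) x xs y"
    by (auto simp: connected_graph_def)
  then have "walk_betw H x xs y"
    unfolding walk_betw_def walk_def preimage_graph_def
    by (auto intro: successively_mono)
  then show ?thesis by blast
qed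

text \<open>The bijection between edges at a vertex is split into lifting and uniqueness of
  neighbours. For the condition on components it suffices to join vertices inside \<open>H\<close>:
  the image of a walk stays in one component, so the walk stays in its preimage.\<close>

lemma coveringI:
  assumes H: "simple_graph H" and G: "simple_graph G" and hom: "graph_hom p H G"
    and surj: "\<And>g. g \<in> verts G \<Longrightarrow> \<exists>x\<in>verts H. p x = g"
    and lift: "\<And>x g. x \<in> verts H \<Longrightarrow> {p x, g} \<in> edges G \<Longrightarrow> \<exists>y. {x, y} \<in> edges H \<and> p y = g"
    and unique: "\<And>x y z. {x, y} \<in> edges H \<Longrightarrow> {x, z} \<in> edges H \<Longrightarrow> p y = p z \<Longrightarrow> y = z"
    and conn: "\<And>x y ws. x \<in> verts H \<Longrightarrow> y \<in> verts H \<Longrightarrow> walk_betw G (p x) ws (p y) \<Longrightarrow>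
      \<exists>xs. walk_betw H x xs y"
  shows "covering p H G"
proof -
  have lift': "\<exists>e\<in>edges H. x \<in> e \<and> p ` e = f" if xf: "x \<in> verts H" "f \<in> edges G" "p x \<in> f" for x f
  proof -
    obtain a b where "f = {a, b}" using edgeE[OF G xf(2)] by blast
    then obtain g where g: "f = {p x, g}" using xf(3) by (auto simp: insert_commute)
    then obtain y where "{x, y} \<in> edges H" "p y = g" using lift[OF xf(1)] xf(2) by blast
    then show ?thesis using g by (intro bexI[of _ "{x, y}"]) auto
  qed
  have edges: "(\<lambda>e. p ` e) ` edges H = edges G"
  proof
    show "(\<lambda>e. p ` e) ` edges H \<subseteq> edges G" using hom by (auto simp: graph_hom_def)
    show "edges G \<subseteq> (\<lambda>e. p ` e) ` edges H"
    proof
      fix f assume f: "f \<in> edges G"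
      then obtain a b where ab: "f = {a, b}" using edgeE[OF G] by blast
      then obtain x where "x \<in> verts H" "p x = a" using surj edge_verts[OF G] f by blast
      then show "f \<in> (\<lambda>e. p ` e) ` edges H" using lift'[of x f] f ab by blast
    qed
  qed
  have bij: "bij_betw (\<lambda>e. p ` e) {e \<in> edges H. x \<in> e} {e \<in> edges G. p x \<in> e}" if x: "x \<in> verts H" for x
    unfolding bij_betw_def
  proof
    show "inj_on (\<lambda>e. p ` e) {e \<in> edges H. x \<in> e}"
    proof (rule inj_onI)
      fix e f assume ef: "e \<in> {e \<in> edges H. x \<in> e}" "f \<in> {e \<in> edges H. x \<in> e}" "p ` e = p ` f"
      have other: "\<exists>y. e' = {x, y} \<and> p x \<noteq> p y" if e': "e' \<in> {e \<in> edges H. x \<in> e}" for e'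
      proof -
        have "e' \<in> edges H" using e' by simp
        then obtain a b where "e' = {a, b}" by (rule edgeE[OF H])
        then obtain y where y: "e' = {x, y}" using e' by (auto simp: insert_commute)
        then show ?thesis using edge_verts(3)[OF G graph_hom_edge[OF hom]] e' by blast
      qed
      obtain y z where y: "e = {x, y}" "p x \<noteq> p y" and z: "f = {x, z}" "p x \<noteq> p z"
        using other ef(1,2) by meson
      then have "p y = p z" using ef(3) by (auto simp: doubleton_eq_iff)
      then show "e = f" using unique[of x y z] ef y z by auto
    qed
    show "(\<lambda>e. p ` e) ` {e \<in> edges H. x \<in> e} = {e \<in> edges G. p x \<in> e}"
    proof (intro equalityI subsetI)
      fix f assume "f \<in> {e \<in> edges G. p x \<in> e}"
      then show "f \<in> (\<lambda>e. p ` e) ` {e \<in> edges H. x \<in> e}" using lift'[OF x, of f] by auto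
    qed (use hom in \<open>auto simp: graph_hom_def\<close>)
  qed
  have conn': "connected_graph (preimage_graph p H C)" if C: "C \<in> components G" for C
  proof -
    obtain b where b: "b \<in> verts G" "C = induced G {u. \<exists>xs. walk_betw G b xs u}"
      using C by (auto simp: components_def)
    obtain x0 where x0: "x0 \<in> verts H" "p x0 = b" using surj b(1) by blast
    have "x0 \<in> verts (preimage_graph p H C)"
      using x0 b walk_betw_refl[OF b(1)] by (auto simp: preimage_graph_def induced_def)
    moreover have "\<exists>xs. walk_betw (preimage_graph p H C) x xs y"
      if xy: "x \<in> verts (preimage_graph p H C)" "y \<in> verts (preimage_graph p H C)" for x y
    proof -
      obtain as bs where as: "walk_betw G b as (p x)" and bs: "walk_betw G b bs (p y)" and
          V: "x \<in> verts H" "y \<in> verts H"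
        using xy b by (auto simp: preimage_graph_def induced_def)
      obtain xs where xs: "walk_betw H x xs y"
        using conn[OF V walk_betw_trans[OF walk_betw_rev[OF as] bs]] by blast
      have w: "walk_betw C (p x) (map p xs) (p y)"
        unfolding b(2) by (rule walk_in_component[OF walk_betw_map[OF hom xs] as])
      have "successively (\<lambda>x y. {x, y} \<in> edges (preimage_graph p H C)) xs"
        using w xs
        by (auto simp: walk_betw_def walk_def successively_map preimage_graph_def successively_conv_nth)
      then have "walk_betw (preimage_graph p H C) x xs y"
        using w xs by (auto simp: walk_betw_def walk_def preimage_graph_def)
      then show ?thesis by blast
    qed
    ultimately show ?thesis by (auto simp: connected_graph_def)
  qed
  show ?thesis
    using assms(1-3) surj edges bij conn' unfolding covering_def
    by (auto simp: graph_hom_def)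
qed

lemma lift_walk:
  assumes "simple_graph H"
    and lift: "\<And>x g. x \<in> verts H \<Longrightarrow> {p x, g} \<in> edges G \<Longrightarrow> \<exists>y. {x, y} \<in> edges H \<and> p y = g"
    and "walk G ws" "x \<in> verts H" "p x = hd ws"
  shows "\<exists>xs. walk H xs \<and> hd xs = x \<and> map p xs = ws"
  using assms(3-)
proof (induction ws rule: rev_induct)
  case (snoc g ws)
  show ?case
  proof (cases "ws = []")
    case True
    then show ?thesis using snoc by (intro exI[of _ "[x]"]) (auto simp: walk_def)
  next
    case False
    then have w: "walk G ws" "{last ws, g} \<in> edges G"
      using snoc.prems(1) by (auto simp: walk_append_iff)
    then obtain xs where xs: "walk H xs" "hd xs = x" "map p xs = ws" using snoc False by auto
    then have ne: "xs \<noteq> []" by (auto simp: walk_def)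
    then have "p (last xs) = last ws" using xs by (metis last_map)
    then obtain y where "{last xs, y} \<in> edges H" "p y = g" using lift walk_last_in[OF xs(1)] w by metis
    then show ?thesis using xs ne walk_snoc[OF assms(1) xs(1)] by (intro exI[of _ "xs @ [y]"]) auto
  qed
qed (simp add: walk_def)

lemma covering_lift_walk:
  assumes "covering p H G" "walk G ws" "x \<in> verts H" "p x = hd ws"
  obtains xs where "walk H xs" "hd xs = x" "map p xs = ws"
  using lift_walk[OF covering_simple(1)[OF assms(1)] covering_lift_edge[OF assms(1)] assms(2-)] by blast

lemma covering_lift_walk_betw:
  assumes "covering p H G" "walk_betw G (p x) ws g" "x \<in> verts H"
  obtains xs y where "walk_betw H x xs y" "p y = g" "length xs = length ws"
proof -
  obtain xs where xs: "walk H xs" "hd xs = x" "map p xs = ws"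
    using covering_lift_walk[OF assms(1) _ assms(3)] assms(2) unfolding walk_betw_def by metis
  then have "p (last xs) = g" using assms(2) by (auto simp: walk_betw_def walk_def last_map)
  then show ?thesis using that[of xs "last xs"] xs by (auto simp: walk_betw_def)
qed

text \<open>Neighbours of \<open>q x\<close> are compared through their images in \<open>G\<close>:
  they are lifted along \<open>p\<close>, and uniqueness for \<open>p'\<close> identifies the
  result.\<close>

lemma covering_factor:
  assumes p: "covering p H G" and p': "covering p' K G" and q: "graph_hom q H K"
    and eq: "\<forall>x\<in>verts H. p x = p' (q x)"
  shows "covering q H K"
proof (rule coveringI)
  show H: "simple_graph H" and K: "simple_graph K"
    using p p' by (auto simp: covering_simple)
  show "graph_hom q H K" by fact
  have E: "x \<in> verts H" "y \<in> verts H" if "{x, y} \<in> edges H" for x y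
    using edge_verts[OF H that] by auto
  show lift: "\<exists>y. {x, y} \<in> edges H \<and> q y = g" if xg: "x \<in> verts H" "{q x, g} \<in> edges K" for x g
  proof -
    have "{p x, p' g} \<in> edges G" using graph_hom_edge[OF covering_hom[OF p'] xg(2)] eq xg by simp
    then obtain y where y: "{x, y} \<in> edges H" "p y = p' g" using covering_lift_edge[OF p xg(1)] by blast
    then have "q y = g"
      using covering_unique_edge[OF p' graph_hom_edge[OF q y(1)] xg(2)] E eq by simp
    then show ?thesis using y by blast
  qed
  show "y = z" if "{x, y} \<in> edges H" "{x, z} \<in> edges H" "q y = q z" for x y z
    using covering_unique_edge[OF p that(1,2)] that E eq by metis
  show "\<exists>x\<in>verts H. q x = g" if g: "g \<in> verts K" for g
  proof -
    \<comment> \<open>The vertex \<open>q x\<close> may be another point over \<open>p' g\<close>,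
      but it is joined to \<open>g\<close> inside \<open>K\<close>; lifting the joining walk along
      \<open>q\<close> ends at a preimage of \<open>g\<close>.\<close>
    obtain x where x: "x \<in> verts H" "p x = p' g"
      using covering_surj[OF p] graph_hom_vert[OF covering_hom[OF p'] g] by metis
    then have "walk_betw G (p' (q x)) [p' g] (p' g)"
      using eq walk_betw_refl graph_hom_vert[OF covering_hom[OF p'] g] by simp
    then obtain ws where "walk_betw K (q x) ws g"
      using covering_connected[OF p' graph_hom_vert[OF q x(1)] g] by blast
    then have ws: "walk K ws" "hd ws = q x" "last ws = g" by (auto simp: walk_betw_def)
    obtain xs where "walk H xs" "map q xs = ws"
      using lift_walk[of H q K ws x] H lift ws x by metis
    then show ?thesis using ws walk_last_in[of H xs] by (metis last_map list.map_disc_iff walk_def)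
  qed
  show "\<exists>xs. walk_betw H x xs y" if "x \<in> verts H" "y \<in> verts H" "walk_betw K (q x) ws (q y)" for x y ws
    using covering_connected[OF p that(1,2)] walk_betw_map[OF covering_hom[OF p'] that(3)] that eq by metis
qed

text \<open>Every closed walk of length at most \<open>r\<close> lifts to closed walks only; the bound is \<open>r + 2\<close> because a
  walk has one vertex more than it has steps. For coverings this is equivalent to preserving balls.\<close>

definition short_walks_lift :: "nat \<Rightarrow> ('b \<Rightarrow> 'a) \<Rightarrow> 'b ugraph \<Rightarrow> bool" where
  "short_walks_lift r p H \<longleftrightarrow> (\<forall>xs ys. walk H xs \<longrightarrow> walk H ys \<longrightarrow> hd xs = hd ys \<longrightarrow>
     p (last xs) = p (last ys) \<longrightarrow> length xs + length ys \<le> r + 2 \<longrightarrow> last xs = last ys)"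

lemma short_walks_liftD:
  "short_walks_lift r p H \<Longrightarrow> walk_betw H x xs y \<Longrightarrow> walk_betw H x ys z \<Longrightarrow> p y = p z \<Longrightarrow>
    length xs + length ys \<le> r + 2 \<Longrightarrow> y = z"
  unfolding short_walks_lift_def walk_betw_def by metis

lemma ball_preservingI:
  assumes cov: "covering p H G" and sl: "short_walks_lift r p H"
  shows "ball_preserving r p H G"
  unfolding ball_preserving_def
proof (intro conjI ballI)
  note H = covering_simple(1)[OF cov] and G = covering_simple(2)[OF cov]
  show hom: "graph_hom p H G" using cov by (rule covering_hom)
  fix x assume x: "x \<in> verts H"
  have "inj_on p (verts (half_ball H x r))"
  proof (rule inj_onI)
    fix u v assume "u \<in> verts (half_ball H x r)" "v \<in> verts (half_ball H x r)" and eq: "p u = p v"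
    then obtain xs ys where xs: "walk_betw H x xs u" "2 * (length xs - 1) \<le> r"
      and ys: "walk_betw H x ys v" "2 * (length ys - 1) \<le> r" unfolding half_ball_vert_iff by blast
    have "length xs + length ys \<le> r + 2" using xs(2) ys(2) by linarith
    then show "u = v" using short_walks_liftD[OF sl xs(1) ys(1) eq] by simp
  qed
  moreover have "p ` verts (half_ball H x r) = verts (half_ball G (p x) r)"
  proof (intro equalityI subsetI)
    fix g assume "g \<in> p ` verts (half_ball H x r)"
    then show "g \<in> verts (half_ball G (p x) r)"
      unfolding half_ball_vert_iff image_iff Bex_def by (metis length_map walk_betw_map[OF hom])
  next
    fix g assume "g \<in> verts (half_ball G (p x) r)"
    then obtain ws where ws: "walk_betw G (p x) ws g" "2 * (length ws - 1) \<le> r"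
      unfolding half_ball_vert_iff by blast
    obtain xs y where "walk_betw H x xs y" "p y = g" "length xs = length ws"
      using covering_lift_walk_betw[OF cov ws(1) x] by blast
    then have "y \<in> verts (half_ball H x r)" unfolding half_ball_vert_iff using ws by metis
    then show "g \<in> p ` verts (half_ball H x r)" using \<open>p y = g\<close> by blast
  qed
  moreover have "(\<lambda>e. p ` e) ` edges (half_ball H x r) = edges (half_ball G (p x) r)"
  proof (intro equalityI subsetI)
    fix f assume "f \<in> (\<lambda>e. p ` e) ` edges (half_ball H x r)"
    then obtain e where e: "e \<in> edges (half_ball H x r)" "f = p ` e" by blast
    then obtain a b where ab: "e = {a, b}" using edgeE[OF simple_graph_half_ball[OF H]] by blast
    obtain xs ys where w: "walk_betw H x xs a" "walk_betw H x ys b" "length xs + length ys < r + 2"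
        and E: "{a, b} \<in> edges H"
      using e ab half_ball_edge_iff[OF H] by blast
    have "{p a, p b} \<in> edges (half_ball G (p x) r)"
      unfolding half_ball_edge_iff[OF G]
      using graph_hom_edge[OF hom E] walk_betw_map[OF hom w(1)] walk_betw_map[OF hom w(2)] w(3)
      by (metis length_map)
    then show "f \<in> edges (half_ball G (p x) r)" using e ab by simp
  next
    fix f assume f: "f \<in> edges (half_ball G (p x) r)"
    then obtain g h where gh: "f = {g, h}" using edgeE[OF simple_graph_half_ball[OF G]] by blast
    obtain us vs where w: "walk_betw G (p x) us g" "walk_betw G (p x) vs h" "length us + length vs < r + 2"
        and E: "{g, h} \<in> edges G"
      using f gh half_ball_edge_iff[OF G] by blast
    obtain xs a where xs: "walk_betw H x xs a" "p a = g" "length xs = length us"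
      using covering_lift_walk_betw[OF cov w(1) x] by blast
    obtain ys b where ys: "walk_betw H x ys b" "p b = h" "length ys = length vs"
      using covering_lift_walk_betw[OF cov w(2) x] by blast
    have "a \<in> verts H" using xs(1) walk_last_in by (auto simp: walk_betw_def)
    then obtain c where c: "{a, c} \<in> edges H" "p c = h"
      using covering_lift_edge[OF cov] E xs(2) by blast
    have "walk_betw H x (xs @ [c]) c"
      using walk_betw_trans[OF xs(1) walk_betw_edge[OF H c(1)]] by simp
    \<comment> \<open>The strict bound for edges of a ball matters here: it leaves room for the
      additional edge from \<open>a\<close> to \<open>c\<close>.\<close>
    then have "c = b"
      by (rule short_walks_liftD[OF sl _ ys(1)]) (use c ys w xs in auto)
    then have "{a, b} \<in> edges (half_ball H x r)"
      unfolding half_ball_edge_iff[OF H] using c xs ys w(3) by metis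
    then show "f \<in> (\<lambda>e. p ` e) ` edges (half_ball H x r)"
      using gh xs(2) ys(2) by (intro image_eqI[of _ _ "{a, b}"]) auto
  qed
  ultimately show "graph_iso p (half_ball H x r) (half_ball G (p x) r)"
    by (simp add: graph_iso_def bij_betw_def)
qed

text \<open>The ball around the middle vertex \<open>m\<close> of \<open>W\<close> is used. If it
  contains both ends, injectivity of \<open>p\<close> on the ball suffices; otherwise an edge of the
  ball must be lifted.\<close>

lemma ball_preserving_closed:
  assumes cov: "covering p H G" and bp: "ball_preserving r p H G"
    and W: "walk H W" "p (hd W) = p (last W)" "length W \<le> r + 1"
  shows "hd W = last W"
proof -
  note H = covering_simple(1)[OF cov] and G = covering_simple(2)[OF cov]
  define h m where "h = (length W - 1) div 2" and "m = W ! h"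
  have "(length W - 1) div 2 \<le> length W - 1" "0 < length W" using W(1) by (auto simp: walk_def)
  then have h: "h < length W" unfolding h_def by linarith
  have m: "m \<in> verts H" using W(1) h by (auto simp: walk_def m_def)
  have iso: "graph_iso p (half_ball H m r) (half_ball G (p m) r)"
    using bp m by (auto simp: ball_preserving_def)
  then have inj: "inj_on p (verts (half_ball H m r))" by (simp add: graph_iso_def bij_betw_def)
  have A: "walk_betw H m (rev (take (Suc h) W)) (hd W)"
    using walk_rev[OF walk_take[OF W(1), of "Suc h"]] h
    by (auto simp: walk_betw_def m_def hd_rev last_rev take_Suc_conv_app_nth hd_conv_nth)
  have B: "walk_betw H m (drop h W) (last W)"
    using walk_drop[OF W(1) h] h by (auto simp: walk_betw_def m_def hd_drop_conv_nth)
  have hd_in: "hd W \<in> verts (half_ball H m r)"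
    unfolding half_ball_vert_iff using A h W(3) by (intro exI[of _ "rev (take (Suc h) W)"]) (auto simp: h_def)
  show ?thesis
  proof (cases "2 * (length W - 1 - h) \<le> r")
    case True
    then have "last W \<in> verts (half_ball H m r)"
      unfolding half_ball_vert_iff using B by (intro exI[of _ "drop h W"]) auto
    then show ?thesis using inj hd_in W(2) by (auto dest: inj_onD)
  next
    case False
    \<comment> \<open>The remaining case: \<open>r\<close> is odd and \<open>W\<close> has exactly
      \<open>r\<close> steps, so the second half has \<open>h + 1\<close> steps, more than
      \<open>r / 2\<close>. The image of the last edge joins two vertices at distance at most
      \<open>h\<close> from \<open>p m\<close>; as \<open>2 * h < r\<close>, it belongs to the ball
      and lifts to an edge from \<open>z\<close> to \<open>hd W\<close>.\<close>
    then have r: "length W - 1 = Suc (2 * h)" "r = Suc (2 * h)" using W(3) h_def by linarith+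
    define z where "z = W ! (2 * h)"
    have "W \<noteq> []" using h by auto
    then have split: "W = butlast W @ [last W]" by simp
    have "length (butlast W) \<noteq> 0" using r(1) by simp
    then have nb: "butlast W \<noteq> []" by force
    have lz: "last (butlast W) = z" using r(1) nb
      by (auto simp: z_def last_conv_nth nth_butlast)
    have ez: "{z, last W} \<in> edges H" and wb: "walk H (butlast W)"
      using W(1) walk_append_iff[of "butlast W" "[last W]" H] split nb lz by auto
    have C: "walk_betw H m (drop h (butlast W)) z"
      using walk_drop[OF wb, of h] r h lz
      by (auto simp: walk_betw_def m_def hd_drop_conv_nth nth_butlast)
    have "{p z, p (hd W)} \<in> edges (half_ball G (p m) r)"
      unfolding half_ball_edge_iff[OF G]
    proof (intro conjI exI)
      show "{p z, p (hd W)} \<in> edges G" using graph_hom_edge[OF covering_hom[OF cov] ez] W(2) by simp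
      show "walk_betw G (p m) (map p (drop h (butlast W))) (p z)"
        "walk_betw G (p m) (map p (rev (take (Suc h) W))) (p (hd W))"
        using walk_betw_map[OF covering_hom[OF cov]] A C by blast+
      show "length (map p (drop h (butlast W))) + length (map p (rev (take (Suc h) W))) < r + 2"
        using r by simp
    qed
    then have "{p z, p (hd W)} \<in> (\<lambda>e. p ` e) ` edges (half_ball H m r)"
      using iso by (simp add: graph_iso_def)
    then obtain e where e: "e \<in> edges (half_ball H m r)" "p ` e = {p z, p (hd W)}"
      by (metis imageE)
    note BH = simple_graph_half_ball[OF H, of m r]
    obtain a b where ab: "e = {a, b}" "p a = p z" "p b = p (hd W)"
    proof -
      obtain a b where "e = {a, b}" using edgeE[OF BH e(1)] by blast
      then show ?thesis using e(2) that[of a b] that[of b a] by (auto simp: doubleton_eq_iff insert_commute)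
    qed
    have "z \<in> verts (half_ball H m r)"
      unfolding half_ball_vert_iff using C r by (intro exI[of _ "drop h (butlast W)"]) auto
    then have "a = z" "b = hd W"
      using ab edge_verts[OF BH] e(1) hd_in inj by (auto dest: inj_onD)
    then have "{z, hd W} \<in> edges H" using ab e by (auto simp: half_ball_def)
    then show ?thesis using covering_unique_edge[OF cov _ ez] W(2) by blast
  qed
qed

lemma ball_preservingD:
  assumes cov: "covering p H G" and bp: "ball_preserving r p H G"
  shows "short_walks_lift r p H"
  unfolding short_walks_lift_def
proof (intro allI impI)
  fix xs ys assume w: "walk H xs" "walk H ys" "hd xs = hd ys" "p (last xs) = p (last ys)"
    "length xs + length ys \<le> r + 2"
  have "last (rev xs) = hd ys" using w by (simp add: last_rev walk_def)
  note j = walk_join[OF walk_rev[OF w(1)] w(2) this]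
  have "hd (rev xs) = last xs" using w(1) by (simp add: hd_rev walk_def)
  then show "last xs = last ys"
    using ball_preserving_closed[OF cov bp j(1)] j w by simp
qed

section \<open>Construction of the local cover\<close>

text \<open>\<open>P\<close> followed by the reverse of \<open>Q\<close> is a closed walk of at most
  \<open>r\<close> steps, as the two lists together have two vertices more than steps. Taking one of
  them to be a single vertex inserts or removes a short closed walk.\<close>

definition swap_step :: "nat \<Rightarrow> 'a ugraph \<Rightarrow> 'a list \<Rightarrow> 'a list \<Rightarrow> bool" where
  "swap_step r G xs ys \<longleftrightarrow> walk G xs \<and> walk G ys \<and>
     (\<exists>A P Q B. xs = A @ P @ B \<and> ys = A @ Q @ B \<and> P \<noteq> [] \<and> Q \<noteq> [] \<and> hd P = hd Q \<and>
        last P = last Q \<and> length P + length Q \<le> r + 2)"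

abbreviation walk_htp :: "nat \<Rightarrow> 'a ugraph \<Rightarrow> 'a list \<Rightarrow> 'a list \<Rightarrow> bool" where
  "walk_htp r G \<equiv> (swap_step r G)\<^sup>*\<^sup>*"

lemma swap_step_sym: "swap_step r G xs ys \<Longrightarrow> swap_step r G ys xs"
  unfolding swap_step_def by (metis add.commute)

lemma walk_htp_sym: "walk_htp r G xs ys \<Longrightarrow> walk_htp r G ys xs"
  by (induction rule: rtranclp_induct) (auto intro: swap_step_sym converse_rtranclp_into_rtranclp)

lemma swap_step_ends: "swap_step r G xs ys \<Longrightarrow> walk G ys \<and> hd xs = hd ys \<and> last xs = last ys"
  unfolding swap_step_def by (auto simp: hd_append last_append)

lemma walk_htp_ends:
  "walk_htp r G xs ys \<Longrightarrow> walk G xs \<Longrightarrow> walk G ys \<and> hd ys = hd xs \<and> last ys = last xs"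
  by (induction rule: rtranclp_induct) (auto dest: swap_step_ends)

lemma swap_step_append:
  assumes "swap_step r G xs ys" "walk G (xs @ C)"
  shows "swap_step r G (xs @ C) (ys @ C)"
proof -
  obtain A P Q B where s: "xs = A @ P @ B" "ys = A @ Q @ B" "P \<noteq> []" "Q \<noteq> []" "hd P = hd Q"
      "last P = last Q" "length P + length Q \<le> r + 2"
    using assms(1) unfolding swap_step_def by blast
  have "walk G (ys @ C)"
  proof (cases "C = []")
    case False
    then show ?thesis
      using assms swap_step_ends[OF assms(1)] s(1-4) walk_append_iff[of xs C G] walk_append_iff[of ys C G]
      by auto
  qed (use swap_step_ends[OF assms(1)] in simp)
  then show ?thesis
    unfolding swap_step_def using assms(2) s
    by (intro conjI exI[of _ A] exI[of _ P] exI[of _ Q] exI[of _ "B @ C"]) auto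
qed

lemma walk_htp_append:
  "walk_htp r G xs ys \<Longrightarrow> walk G (xs @ C) \<Longrightarrow> walk_htp r G (xs @ C) (ys @ C)"
proof (induction rule: rtranclp_induct)
  case (step y z)
  then have "walk G (y @ C)" using walk_htp_ends by blast
  then show ?case using step swap_step_append by (meson rtranclp.rtrancl_into_rtrancl)
qed simp

text \<open>The predicate under \<open>SOME\<close> is the same for all vertices of a component, so
  they share their base vertex.\<close>

definition base_vertex :: "'a ugraph \<Rightarrow> 'a \<Rightarrow> 'a" where
  "base_vertex G u = (SOME b. \<exists>xs. walk_betw G b xs u)"

definition based_walks :: "'a ugraph \<Rightarrow> 'a list set" where
  "based_walks G = {xs. walk G xs \<and> hd xs = base_vertex G (last xs)}"

text \<open>Representatives instead of classes keep the vertices in the type \<open>'a list\<close>,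
  over which the universal property quantifies.\<close>

definition htp_rep :: "nat \<Rightarrow> 'a ugraph \<Rightarrow> 'a list \<Rightarrow> 'a list" where
  "htp_rep r G xs = (SOME ys. walk_htp r G xs ys)"

text \<open>Vertices are homotopy classes of walks starting at a base vertex of their component, each given by
  a chosen representative; the covering map is \<open>last\<close>.\<close>

definition walk_cover :: "nat \<Rightarrow> 'a ugraph \<Rightarrow> 'a list ugraph" where
  "walk_cover r G =
     \<lparr>verts = htp_rep r G ` based_walks G,
      edges = {{htp_rep r G xs, htp_rep r G (xs @ [v])} | xs v.
        xs \<in> based_walks G \<and> {last xs, v} \<in> edges G}\<rparr>"

lemma base_vertex_walk: "u \<in> verts G \<Longrightarrow> \<exists>xs. walk_betw G (base_vertex G u) xs u"
  unfolding base_vertex_def by (rule someI_ex) (blast dest: walk_betw_refl)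

lemma base_vertex_eq: "walk_betw G u xs v \<Longrightarrow> base_vertex G u = base_vertex G v"
proof -
  assume xs: "walk_betw G u xs v"
  have "(\<lambda>b. \<exists>ys. walk_betw G b ys u) = (\<lambda>b. \<exists>ys. walk_betw G b ys v)"
    using walk_betw_trans[OF _ xs] walk_betw_trans[OF _ walk_betw_rev[OF xs]] by (intro ext) blast
  then show ?thesis by (simp add: base_vertex_def)
qed

lemma htp_rep_htp: "walk_htp r G xs (htp_rep r G xs)"
  unfolding htp_rep_def by (rule someI[of _ xs]) simp

lemma htp_rep_eqI: "walk_htp r G xs ys \<Longrightarrow> htp_rep r G xs = htp_rep r G ys"
proof -
  assume xy: "walk_htp r G xs ys"
  have "walk_htp r G xs = walk_htp r G ys"
    using xy walk_htp_sym[OF xy] by (intro ext) (meson rtranclp_trans)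
  then show ?thesis by (simp add: htp_rep_def)
qed

lemma htp_rep_eqD: "htp_rep r G xs = htp_rep r G ys \<Longrightarrow> walk_htp r G xs ys"
  by (metis htp_rep_htp rtranclp_trans walk_htp_sym)

lemma htp_rep_idem: "htp_rep r G (htp_rep r G xs) = htp_rep r G xs"
  by (rule sym, rule htp_rep_eqI, rule htp_rep_htp)

lemma htp_rep_ends:
  assumes "walk G xs"
  shows "walk G (htp_rep r G xs)" "hd (htp_rep r G xs) = hd xs" "last (htp_rep r G xs) = last xs"
  using walk_htp_ends[OF htp_rep_htp assms] by auto

lemma based_walks_walk: "xs \<in> based_walks G \<Longrightarrow> walk G xs"
  by (simp add: based_walks_def)

lemma htp_rep_based: "xs \<in> based_walks G \<Longrightarrow> htp_rep r G xs \<in> based_walks G"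
  by (simp add: based_walks_def htp_rep_ends)

lemma based_walks_snoc_iff:
  assumes "simple_graph G" "walk G xs" "{last xs, v} \<in> edges G"
  shows "xs @ [v] \<in> based_walks G \<longleftrightarrow> xs \<in> based_walks G"
  using walk_snoc[OF assms] assms(2) base_vertex_eq[OF walk_betw_edge[OF assms(1,3)]]
  by (auto simp: based_walks_def walk_def)

lemma walk_cover_vert_iff:
  "x \<in> verts (walk_cover r G) \<longleftrightarrow> x \<in> based_walks G \<and> htp_rep r G x = x"
  by (auto simp: walk_cover_def htp_rep_based htp_rep_idem intro: image_eqI[OF sym])

text \<open>Edges are generated by extending a walk by one vertex. Seen from the longer walk, the
  same edge extends it by stepping back, since \<open>xs\<close> and
  \<open>(xs @ [v]) @ [last xs]\<close> differ by a swap of one vertex for three, which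
  \<open>2 \<le> r\<close> permits.\<close>

lemma walk_cover_edge_iff:
  assumes G: "simple_graph G" and r: "2 \<le> r" and x: "x \<in> verts (walk_cover r G)"
  shows "{x, y} \<in> edges (walk_cover r G) \<longleftrightarrow>
    (\<exists>v. {last x, v} \<in> edges G \<and> y = htp_rep r G (x @ [v]))"
proof
  have xb: "x \<in> based_walks G" "htp_rep r G x = x" using x by (auto simp: walk_cover_vert_iff)
  {
    assume "{x, y} \<in> edges (walk_cover r G)"
    then obtain xs v where xs: "{x, y} = {htp_rep r G xs, htp_rep r G (xs @ [v])}" "xs \<in> based_walks G"
        "{last xs, v} \<in> edges G" by (auto simp: walk_cover_def)
    have w: "walk G xs" "walk G (xs @ [v])"
      using xs(2,3) walk_snoc[OF G] by (auto simp: based_walks_def)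
    consider "x = htp_rep r G xs" "y = htp_rep r G (xs @ [v])"
      | "x = htp_rep r G (xs @ [v])" "y = htp_rep r G xs"
      using xs(1) by (auto simp: doubleton_eq_iff)
    then show "\<exists>v. {last x, v} \<in> edges G \<and> y = htp_rep r G (x @ [v])"
    proof cases
      case 1
      have "walk_htp r G (xs @ [v]) (x @ [v])"
        using walk_htp_append[OF htp_rep_htp w(2)] 1 by simp
      then show ?thesis using 1 xs(3) htp_rep_ends[OF w(1)] htp_rep_eqI by metis
    next
      case 2
      have w3: "walk G ((xs @ [v]) @ [last xs])"
        using walk_snoc[OF G w(2)] xs(3) by (simp add: insert_commute)
      have "walk_htp r G ((xs @ [v]) @ [last xs]) (x @ [last xs])"
        using walk_htp_append[OF htp_rep_htp w3] 2 by simp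
      moreover have "swap_step r G xs ((xs @ [v]) @ [last xs])"
        unfolding swap_step_def using w w3 r
        by (intro conjI exI[of _ "butlast xs"] exI[of _ "[last xs]"] exI[of _ "[last xs, v, last xs]"]
            exI[of _ "[]"]) (auto simp: walk_def)
      ultimately have "walk_htp r G xs (x @ [last xs])" by (meson converse_rtranclp_into_rtranclp)
      then have "y = htp_rep r G (x @ [last xs])" using 2 htp_rep_eqI by metis
      moreover have "{last x, last xs} \<in> edges G"
        using 2 htp_rep_ends[OF w(2)] xs(3) by (simp add: insert_commute)
      ultimately show ?thesis by blast
    qed
  }
  {
    assume "\<exists>v. {last x, v} \<in> edges G \<and> y = htp_rep r G (x @ [v])"
    then show "{x, y} \<in> edges (walk_cover r G)"
      using xb unfolding walk_cover_def by force
  }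
qed

lemma simple_graph_walk_cover:
  assumes G: "simple_graph G"
  shows "simple_graph (walk_cover r G)"
  unfolding simple_graph_def
proof (intro ballI)
  fix e assume "e \<in> edges (walk_cover r G)"
  then obtain xs v where e: "e = {htp_rep r G xs, htp_rep r G (xs @ [v])}" "xs \<in> based_walks G"
        "{last xs, v} \<in> edges G" by (auto simp: walk_cover_def)
  have w: "walk G xs" "walk G (xs @ [v])"
    using e(2,3) walk_snoc[OF G] by (auto simp: based_walks_def)
  then have "xs @ [v] \<in> based_walks G" using based_walks_snoc_iff[OF G w(1) e(3)] e(2) by simp
  moreover have "last xs \<noteq> v" using edge_verts[OF G e(3)] by simp
  then have "htp_rep r G xs \<noteq> htp_rep r G (xs @ [v])"
    using htp_rep_ends(3)[OF w(1)] htp_rep_ends(3)[OF w(2)] by (metis last_snoc)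
  ultimately show "e \<subseteq> verts (walk_cover r G) \<and> card e = 2"
    using e(1,2) by (auto simp: walk_cover_def)
qed

lemma graph_hom_walk_cover:
  assumes G: "simple_graph G"
  shows "graph_hom last (walk_cover r G) G"
  unfolding graph_hom_def
proof
  show "last ` verts (walk_cover r G) \<subseteq> verts G"
    using walk_last_in based_walks_walk by (force simp: walk_cover_vert_iff)
  show "\<forall>e\<in>edges (walk_cover r G). last ` e \<in> edges G"
  proof
    fix e assume "e \<in> edges (walk_cover r G)"
    then obtain xs v where e: "e = {htp_rep r G xs, htp_rep r G (xs @ [v])}" "xs \<in> based_walks G"
          "{last xs, v} \<in> edges G" by (auto simp: walk_cover_def)
    then have "walk G xs" "walk G (xs @ [v])" using walk_snoc[OF G] by (auto simp: based_walks_def)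
    then show "last ` e \<in> edges G" using e htp_rep_ends(3)[of G] by simp
  qed
qed

text \<open>The classes of the prefixes of \<open>xs\<close> form the required walk.\<close>

lemma walk_cover_connected_base:
  assumes G: "simple_graph G" and r: "2 \<le> r"
  shows "xs \<in> based_walks G \<Longrightarrow>
    \<exists>L. walk_betw (walk_cover r G) (htp_rep r G [hd xs]) L (htp_rep r G xs)"
proof (induction xs rule: rev_induct)
  case Nil
  then show ?case by (simp add: based_walks_def walk_def)
next
  case (snoc v xs)
  show ?case
  proof (cases "xs = []")
    case True
    then have "htp_rep r G [v] \<in> verts (walk_cover r G)"
      using snoc.prems by (auto simp: walk_cover_def)
    then show ?thesis using True walk_betw_refl by fastforce
  next
    case False
    have w: "walk G xs" "{last xs, v} \<in> edges G"
      using based_walks_walk[OF snoc.prems] False by (auto simp: walk_append_iff)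
    then have xb: "xs \<in> based_walks G" using snoc.prems based_walks_snoc_iff[OF G] by blast
    then obtain L where L: "walk_betw (walk_cover r G) (htp_rep r G [hd xs]) L (htp_rep r G xs)"
      using snoc.IH by blast
    have "{htp_rep r G xs, htp_rep r G (xs @ [v])} \<in> edges (walk_cover r G)"
      using xb w(2) by (auto simp: walk_cover_def)
    from walk_betw_trans[OF L walk_betw_edge[OF simple_graph_walk_cover[OF G] this]]
    show ?thesis using False by auto
  qed
qed

lemma covering_walk_cover:
  assumes G: "simple_graph G" and r: "2 \<le> r"
  shows "covering last (walk_cover r G) G"
proof (rule coveringI)
  let ?C = "walk_cover r G"
  show C: "simple_graph ?C" by (rule simple_graph_walk_cover[OF G])
  show "simple_graph G" by fact
  show "graph_hom last ?C G" by (rule graph_hom_walk_cover[OF G])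
  show "\<exists>x\<in>verts ?C. last x = g" if g: "g \<in> verts G" for g
  proof -
    obtain xs where "walk_betw G (base_vertex G g) xs g" using base_vertex_walk[OF g] by blast
    then have "xs \<in> based_walks G" "last xs = g" by (auto simp: walk_betw_def based_walks_def)
    then show ?thesis
      using htp_rep_ends(3)[OF based_walks_walk] by (intro bexI[of _ "htp_rep r G xs"]) (auto simp: walk_cover_def)
  qed
  have last_snoc': "last (htp_rep r G (x @ [v])) = v" if "x \<in> verts ?C" "{last x, v} \<in> edges G" for x v
    using htp_rep_ends(3)[OF walk_snoc[OF G _ that(2)]] that(1)
    by (simp add: walk_cover_vert_iff based_walks_walk)
  show "\<exists>y. {x, y} \<in> edges ?C \<and> last y = g" if "x \<in> verts ?C" "{last x, g} \<in> edges G" for x g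
    using walk_cover_edge_iff[OF G r that(1)] last_snoc'[OF that] that(2) by blast
  show "y = z" if xyz: "{x, y} \<in> edges ?C" "{x, z} \<in> edges ?C" "last y = last z" for x y z
  proof -
    have x: "x \<in> verts ?C" using edge_verts[OF C xyz(1)] by simp
    obtain v w where "y = htp_rep r G (x @ [v])" "z = htp_rep r G (x @ [w])" "{last x, v} \<in> edges G"
        "{last x, w} \<in> edges G"
      using walk_cover_edge_iff[OF G r x] xyz by blast
    then show ?thesis using last_snoc'[OF x] xyz(3) by metis
  qed
  show "\<exists>xs. walk_betw ?C x xs y"
    if xy: "x \<in> verts ?C" "y \<in> verts ?C" "walk_betw G (last x) ws (last y)" for x y ws
  proof -
    have x: "x \<in> based_walks G" "htp_rep r G x = x" and y: "y \<in> based_walks G" "htp_rep r G y = y"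
      using xy by (auto simp: walk_cover_vert_iff)
    have "hd x = hd y" using x y base_vertex_eq[OF xy(3)] by (simp add: based_walks_def)
    then show ?thesis
      using walk_cover_connected_base[OF G r x(1)] walk_cover_connected_base[OF G r y(1)] x y
      by (metis walk_betw_rev walk_betw_trans)
  qed
qed

text \<open>The endpoint of a walk in the cover is determined by its start, itself a walk of
  \<open>G\<close>, continued along the projection.\<close>

lemma walk_cover_walk_end:
  assumes G: "simple_graph G" and r: "2 \<le> r"
  shows "walk (walk_cover r G) L \<Longrightarrow> walk G (hd L @ tl (map last L)) \<and>
    last L = htp_rep r G (hd L @ tl (map last L))"
proof (induction L rule: rev_induct)
  case Nil
  then show ?case by (simp add: walk_def)
next
  case (snoc y M)
  show ?case
  proof (cases "M = []")
    case True
    then show ?thesis using snoc.prems by (auto simp: walk_single_iff walk_cover_vert_iff based_walks_walk)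
  next
    case False
    let ?w = "hd M @ tl (map last M)"
    have M: "walk (walk_cover r G) M" "{last M, y} \<in> edges (walk_cover r G)"
      using snoc.prems False by (auto simp: walk_append_iff)
    have IH: "walk G ?w" "last M = htp_rep r G ?w" using snoc.IH[OF M(1)] by auto
    obtain v where v: "{last (last M), v} \<in> edges G" "y = htp_rep r G (last M @ [v])"
      using walk_cover_edge_iff[OF G r walk_last_in[OF M(1)]] M(2) by blast
    have lw: "last ?w = last (last M)" using IH htp_rep_ends(3) by metis
    then have w: "walk G (?w @ [v])" using walk_snoc[OF G IH(1)] v by simp
    have "walk_htp r G (?w @ [v]) (last M @ [v])"
      using walk_htp_append[OF htp_rep_htp w] IH(2) by simp
    then have y: "y = htp_rep r G (?w @ [v])" using v htp_rep_eqI by metis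
    then have "last y = v" using htp_rep_ends(3)[OF w] by simp
    moreover have "hd (M @ [y]) @ tl (map last (M @ [y])) = ?w @ [last y]"
      using False by (cases M) auto
    ultimately show ?thesis using y w by simp
  qed
qed

lemma short_walks_lift_walk_cover:
  assumes G: "simple_graph G" and r: "2 \<le> r"
  shows "short_walks_lift r last (walk_cover r G)"
  unfolding short_walks_lift_def
proof (intro allI impI)
  let ?C = "walk_cover r G"
  fix xs ys assume w: "walk ?C xs" "walk ?C ys" "hd xs = hd ys" "last (last xs) = last (last ys)"
    "length xs + length ys \<le> r + 2"
  let ?x = "hd xs"
  have x: "walk G ?x" using walk_hd_in[OF w(1)] by (simp add: walk_cover_vert_iff based_walks_walk)
  \<comment> \<open>The projection starts where \<open>?x\<close> ends. Omitting the shared vertex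
    from \<open>?x\<close> instead exhibits the entire projections as the swapped pieces, with
    common prefix \<open>butlast ?x\<close>.\<close>
  have sp: "?x @ tl (map last zs) = butlast ?x @ map last zs" if "walk ?C zs" "hd zs = ?x" for zs
    using that x by (cases zs) (auto simp: walk_def)
  have "swap_step r G (?x @ tl (map last xs)) (?x @ tl (map last ys))"
    unfolding swap_step_def
  proof (intro conjI exI)
    show "walk G (?x @ tl (map last xs))" "walk G (?x @ tl (map last ys))"
      using walk_cover_walk_end[OF G r] w by metis+
    show "?x @ tl (map last xs) = butlast ?x @ map last xs @ []"
      "?x @ tl (map last ys) = butlast ?x @ map last ys @ []"
      using sp[of xs] sp[of ys] w by auto
    show "map last xs \<noteq> []" "map last ys \<noteq> []" using w by (auto simp: walk_def)
    show "hd (map last xs) = hd (map last ys)" "last (map last xs) = last (map last ys)"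
      using w by (auto simp: walk_def hd_map last_map)
    show "length (map last xs) + length (map last ys) \<le> r + 2" using w by simp
  qed
  then have "htp_rep r G (?x @ tl (map last xs)) = htp_rep r G (?x @ tl (map last ys))"
    by (intro htp_rep_eqI) auto
  then show "last xs = last ys" using walk_cover_walk_end[OF G r] w by metis
qed

text \<open>A class is sent to the end of the lift of its walk, starting at a chosen vertex over the
  base vertex. The lifting condition on \<open>K\<close> makes this independent of the
  representative.\<close>

lemma walk_cover_universal:
  assumes G: "simple_graph G" and r: "2 \<le> r"
    and cov: "covering p K G" and sl: "short_walks_lift r p K"
  shows "\<exists>q. covering q (walk_cover r G) K \<and> (\<forall>x\<in>verts (walk_cover r G). last x = p (q x))"
proof -
  let ?C = "walk_cover r G"
  note K = covering_simple(1)[OF cov]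
  define kb where "kb g = (SOME k. k \<in> verts K \<and> p k = g)" for g
  have kb: "kb g \<in> verts K" "p (kb g) = g" if "g \<in> verts G" for g
    using someI_ex[of "\<lambda>k. k \<in> verts K \<and> p k = g"] covering_surj[OF cov that]
    unfolding kb_def by blast+
  define lift where "lift xs = (SOME L. walk K L \<and> hd L = kb (hd xs) \<and> map p L = xs)" for xs
  have lift: "walk K (lift xs)" "hd (lift xs) = kb (hd xs)" "map p (lift xs) = xs" if "walk G xs" for xs
  proof -
    have "\<exists>L. walk K L \<and> hd L = kb (hd xs) \<and> map p L = xs"
      using covering_lift_walk[OF cov that kb(1)] kb(2) walk_hd_in[OF that] by metis
    then have "walk K (lift xs) \<and> hd (lift xs) = kb (hd xs) \<and> map p (lift xs) = xs"
      unfolding lift_def by (rule someI_ex)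
    then show "walk K (lift xs)" "hd (lift xs) = kb (hd xs)" "map p (lift xs) = xs" by auto
  qed
  have lift_eq: "L = lift xs" if "walk G xs" "walk K L" "hd L = kb (hd xs)" "map p L = xs" for L xs
    using covering_unique_lift[OF cov that(2) lift(1)[OF that(1)]] lift[OF that(1)] that by metis
  have step: "last (lift xs) = last (lift ys)" if s: "swap_step r G xs ys" for xs ys
  proof -
    obtain A P Q B where s': "xs = A @ P @ B" "ys = A @ Q @ B" "P \<noteq> []" "Q \<noteq> []" "hd P = hd Q"
        "last P = last Q" "length P + length Q \<le> r + 2" and w: "walk G xs" "walk G ys"
      using s unfolding swap_step_def by blast
    obtain LA LP LB where L: "lift xs = LA @ LP @ LB" "map p LA = A" "map p LP = P" "map p LB = B"
      using lift(3)[OF w(1)] s'(1) by (metis map_eq_append_conv)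
    have LP: "LP \<noteq> []" "walk K LP"
      using L s'(3) lift(1)[OF w(1)] by (auto simp: walk_def successively_append_iff)
    have "walk G Q" using w(2) s'(2,4) by (auto simp: walk_def successively_append_iff)
    moreover have "p (hd LP) = hd Q" using L(3) LP(1) s'(5) by (metis hd_map)
    ultimately obtain LQ where LQ: "walk K LQ" "hd LQ = hd LP" "map p LQ = Q"
      using covering_lift_walk[OF cov _ walk_hd_in[OF LP(2)]] by metis
    have ne: "LQ \<noteq> []" using LQ(1) by (simp add: walk_def)
    \<comment> \<open>The lifts of \<open>P\<close> and \<open>Q\<close> from a common start also
      end together, so the old remainder \<open>LB\<close> continues the lift of
      \<open>Q\<close>.\<close>
    have "last LP = last LQ"
    proof (rule sl[unfolded short_walks_lift_def, rule_format, OF LP(2) LQ(1)])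
      show "p (last LP) = p (last LQ)" using L(3) LQ(3) s'(6) LP(1) ne by (metis last_map)
      show "length LP + length LQ \<le> r + 2" using s'(7) L(3) LQ(3) by auto
    qed (use LQ in simp)
    then have "walk K (LA @ LQ @ LB)" "hd (LA @ LQ @ LB) = hd (lift xs)" "last (LA @ LQ @ LB) = last (lift xs)"
      using lift(1)[OF w(1)] LQ LP ne unfolding L(1)
      by (auto simp: walk_def successively_append_iff hd_append last_append)
    moreover have "hd xs = hd ys" using swap_step_ends[OF s] by simp
    ultimately show ?thesis
      using lift_eq[OF w(2), of "LA @ LQ @ LB"] L LQ s' lift(2)[OF w(1)] by simp
  qed
  have htp: "last (lift xs) = last (lift ys)" if "walk_htp r G xs ys" for xs ys
    using that by (induction rule: rtranclp_induct) (auto dest: step)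
  define q where "q x = last (lift x)" for x
  have qrep: "q (htp_rep r G xs) = q xs" for xs
    unfolding q_def using htp[OF htp_rep_htp] by metis
  have w: "walk G x" if "x \<in> verts ?C" for x using that by (simp add: walk_cover_vert_iff based_walks_walk)
  have "graph_hom q ?C K"
    unfolding graph_hom_def
  proof
    show "q ` verts ?C \<subseteq> verts K"
      using lift(1) w walk_last_in by (fastforce simp: q_def)
    show "\<forall>e\<in>edges ?C. q ` e \<in> edges K"
    proof
      fix e assume "e \<in> edges ?C"
      then obtain xs v where e: "e = {htp_rep r G xs, htp_rep r G (xs @ [v])}" "xs \<in> based_walks G"
          "{last xs, v} \<in> edges G" by (auto simp: walk_cover_def)
      have x: "walk G xs" "walk G (xs @ [v])" "xs \<noteq> []"
        using e walk_snoc[OF G] by (auto simp: based_walks_def walk_def)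
      note l = lift[OF x(2)]
      obtain L y where L: "lift (xs @ [v]) = L @ [y]" "map p L = xs" "p y = v"
        using l(3) by (auto simp: map_eq_append_conv)
      then have ne: "L \<noteq> []" using x by auto
      then have "walk K L" "{last L, y} \<in> edges K" using l(1) L(1) by (auto simp: walk_append_iff)
      moreover have "L = lift xs"
        using lift_eq[OF x(1) \<open>walk K L\<close>] l(2) L ne x(3) by simp
      ultimately have "{q xs, q (xs @ [v])} \<in> edges K" using L(1) by (simp add: q_def)
      then show "q ` e \<in> edges K" using e(1) qrep by simp
    qed
  qed
  moreover have "\<forall>x\<in>verts ?C. last x = p (q x)"
    unfolding q_def using lift w by (metis last_map walk_def)
  ultimately show ?thesis using covering_factor[OF covering_walk_cover[OF G r] cov] by blast
qed

lemma r_local_covering_walk_cover: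
  assumes G: "simple_graph G" and r: "2 \<le> r"
  shows "r_local_covering r last (walk_cover r G) G"
  unfolding r_local_covering_def
  using covering_walk_cover[OF assms] ball_preservingI[OF covering_walk_cover[OF assms] short_walks_lift_walk_cover[OF assms]]
    walk_cover_universal[OF assms] ball_preservingD by blast

lemma r_local_cover_exists:
  fixes G :: "'a ugraph"
  assumes "simple_graph G" "2 \<le> r"
  shows "\<exists>p. r_local_covering r p (r_local_cover r G) G"
  unfolding r_local_cover_def
  by (rule someI_ex) (use r_local_covering_walk_cover[OF assms] in blast)

section \<open>Chordal covers\<close>

text \<open>Without its repeated last vertex the walk is a polygon with at most \<open>r\<close>
  corners. Its triangulation collapses it to the root side, and the remaining walk runs along this
  side back and forth.\<close>

lemma closed_walk_homotopic:
  assumes G: "simple_graph G" and rc: "r_chordal r G"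
    and ws: "ws \<noteq> []" "successively (ladj G) ws" "hd ws = last ws" "length ws \<le> r + 1"
  shows "homotopic (ladj G) ws [hd ws]"
proof (cases ws rule: rev_cases)
  case Nil
  then show ?thesis using ws by simp
next
  case (snoc Q s)
  show ?thesis
  proof (cases "Q = []")
    case True
    then show ?thesis using snoc by simp
  next
    case False
    then have s: "hd Q = s" "hd ws = s" using snoc ws(3) by auto
    have Qs: "successively (ladj G) Q" "ladj G (last Q) s"
      using ws(2) False unfolding snoc by (auto simp: successively_append_iff)
    have tri: "triangulable (ladj G) Q"
      using closed_walk_triangulable[OF G, of UNIV r Q] rc False s Qs ws(4) snoc
      by (auto simp: r_chordal_def)
    have 1: "homotopic (ladj G) Q [s, last Q] \<or> Q = [s]"
      using triangulable_imp_homotopic[OF tri] False s(1)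
      by (cases Q; cases "tl Q") auto
    have "homotopic (ladj G) ws ([s, last Q] @ [s])"
      using 1
    proof
      assume "homotopic (ladj G) Q [s, last Q]"
      from homotopic_context[OF this, of "[]" "[s]"] show ?thesis using snoc by simp
    next
      assume Q: "Q = [s]"
      have "shortcut (ladj G) [s, s, s] [s, s]" using shortcut.stay[of "ladj G" "[s]" s "[]"] by simp
      then show ?thesis using Q snoc by (auto intro: equivclp_sym)
    qed
    moreover have "shortcut (ladj G) [s, last Q, s] [s, s]" "shortcut (ladj G) [s, s] [s]"
      using shortcut.corner[of "ladj G" s "last Q" s "[]" "[]"] shortcut.stay[of "ladj G" "[]" s "[]"] Qs(2)
      by (auto simp: ladj_refl ladj_sym)
    ultimately have "homotopic (ladj G) ws [s]"
      by (metis append_Cons append_Nil equivclp_trans r_into_equivclp)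
    then show ?thesis using s by simp
  qed
qed

lemma walk_successively_ladj: "walk G xs \<Longrightarrow> successively (ladj G) xs"
  by (auto simp: walk_def ladj_def successively_conv_nth)

text \<open>The walk \<open>P\<close>, reverse of \<open>Q\<close>, \<open>Q\<close> is contracted
  in two ways: its first two pieces form a short closed walk, which leaves \<open>Q\<close>, and its
  last two form a spur, which leaves \<open>P\<close>.\<close>

lemma swap_step_homotopic:
  assumes G: "simple_graph G" and rc: "r_chordal r G" and s: "swap_step r G xs ys"
  shows "homotopic (ladj G) xs ys"
proof -
  let ?R = "ladj G"
  obtain A P Q B where s': "xs = A @ P @ B" "ys = A @ Q @ B" "P \<noteq> []" "Q \<noteq> []" "hd P = hd Q"
      "last P = last Q" "length P + length Q \<le> r + 2" and w: "walk G xs" "walk G ys"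
    using s unfolding swap_step_def by blast
  have P: "walk G P" and Q: "walk G Q"
    using w s' by (auto simp: walk_def successively_append_iff)
  have lr: "last P = hd (rev Q)" using s' by (simp add: hd_rev)
  note j = walk_join[OF P walk_rev[OF Q] lr]
  have "homotopic ?R (P @ tl (rev Q)) [hd P]"
    using closed_walk_homotopic[OF G rc _ walk_successively_ladj[OF j(1)]] j s' by (simp add: last_rev)
  from homotopic_context[OF this, of "[]" "tl Q"]
  have 1: "homotopic ?R (P @ tl (rev Q) @ tl Q) Q" using s' by (cases Q) auto
  have "homotopic ?R (rev Q @ tl Q) [last Q]"
    by (rule homotopic_spur[OF reflp_ladj symp_ladj s'(4) walk_successively_ladj[OF Q]])
  from homotopic_context[OF this, of "butlast P" "[]"]
  have 2: "homotopic ?R (butlast P @ rev Q @ tl Q) (butlast P @ [last P])" using s' by simp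
  have "butlast P @ rev Q = P @ tl (rev Q)"
    using s'(3,4) lr by (metis append.assoc append_Cons append_Nil append_butlast_last_id hd_Cons_tl
        rev_is_Nil_conv)
  then have "butlast P @ rev Q @ tl Q = P @ tl (rev Q) @ tl Q" by (metis append.assoc)
  then have "homotopic ?R P Q" using 1 2 s'(3) by (metis append_butlast_last_id equivclp_sym equivclp_trans)
  then show ?thesis unfolding s'(1,2) by (rule homotopic_context)
qed

lemma walk_htp_homotopic:
  assumes "simple_graph G" "r_chordal r G"
  shows "walk_htp r G xs ys \<Longrightarrow> homotopic (ladj G) xs ys"
  by (induction rule: rtranclp_induct) (auto intro: equivclp_trans swap_step_homotopic[OF assms])

text \<open>The edge from \<open>p a\<close> to \<open>p c\<close> lifts to an edge from
  \<open>a\<close> to some \<open>d\<close>. The walks \<open>[a, b, c]\<close> and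
  \<open>[a, d]\<close> have five vertices in total, which is at most \<open>r + 2\<close>, so
  \<open>d = c\<close>.\<close>

lemma triangle_lift:
  assumes cov: "covering p H G" and sl: "short_walks_lift r p H" and r: "3 \<le> r"
    and "ladj H a b" "ladj H b c" "ladj G (p a) (p c)"
  shows "ladj H a c"
proof (cases "a = b \<or> b = c")
  case True
  then show ?thesis using assms by auto
next
  case False
  note H = covering_simple(1)[OF cov]
  have e: "{a, b} \<in> edges H" "{b, a} \<in> edges H" "{b, c} \<in> edges H"
    using False assms(4,5) by (auto simp: ladj_def insert_commute)
  show ?thesis
  proof (cases "p a = p c")
    case True
    then show ?thesis using covering_unique_edge[OF cov e(2,3)] by (simp add: ladj_def)
  next
    case False
    then have "{p a, p c} \<in> edges G" using assms(6) by (simp add: ladj_def)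
    then obtain d where d: "{a, d} \<in> edges H" "p d = p c"
      using covering_lift_edge[OF cov edge_verts(1)[OF H e(1)]] by blast
    have "walk_betw H a [a, b, c] c"
      using walk_betw_trans[OF walk_betw_edge[OF H e(1)] walk_betw_edge[OF H e(3)]] by simp
    then have "d = c"
      by (rule short_walks_liftD[OF sl walk_betw_edge[OF H d(1)]]) (use d r in auto)
    then show ?thesis using d by (simp add: ladj_def)
  qed
qed

text \<open>Every triangle is lifted from its two legs, so no assumption on the root side of
  \<open>xs\<close> is needed: it comes last, as the third side of the root triangle.\<close>

lemma triangulable_lift:
  assumes cov: "covering p H G" and sl: "short_walks_lift r p H" and r: "3 \<le> r"
  shows "triangulable (ladj G) ws \<Longrightarrow> map p xs = ws \<Longrightarrow> successively (ladj H) xs \<Longrightarrow>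
    triangulable (ladj H) xs"
proof (induction arbitrary: xs rule: triangulable.induct)
  case (single x)
  then have "xs = [hd xs]" by (cases xs) auto
  then show ?case using triangulable.single[of "ladj H" "hd xs"] by simp
next
  case (pair x y)
  then have "length xs = 2" by (metis length_map length_Cons list.size(3) numeral_2_eq_2)
  then obtain a b where "xs = [a, b]" by (cases xs; cases "tl xs") auto
  then show ?case using pair.prems(2) by (auto intro: triangulable.pair)
next
  case (glue us y vs)
  obtain as b bs where xs: "xs = as @ b # bs" "map p as = us" "p b = y" "map p bs = vs"
  proof -
    have m: "map p (take (length us) xs) = us" "map p (drop (length us) xs) = y # vs"
      using glue.prems(1) by (simp_all flip: take_map drop_map)
    have "drop (length us) xs = hd (drop (length us) xs) # tl (drop (length us) xs)"
      using m(2) by (cases "drop (length us) xs") auto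
    then show ?thesis
      using that[of "take (length us) xs" "hd (drop (length us) xs)" "tl (drop (length us) xs)"] m
      by (metis append_take_drop_id list.inject list.simps(9))
  qed
  have ne: "as \<noteq> []" "bs \<noteq> []" using xs glue.hyps by auto
  have 1: "triangulable (ladj H) (as @ [b])"
    using glue.IH(1)[of "as @ [b]"] xs glue.prems(2) by (auto simp: successively_append_iff)
  have 2: "triangulable (ladj H) (b # bs)"
    using glue.IH(2)[of "b # bs"] xs glue.prems(2) by (auto simp: successively_append_iff)
  have "ladj H (hd as) b" using triangulable_root[OF 1] ne by (cases as) auto
  moreover have "ladj H b (last bs)" using triangulable_root[OF 2] ne by (cases bs) auto
  moreover have "ladj G (p (hd as)) (p (last bs))"
    using glue.hyps(5) xs ne by (metis hd_map last_map)
  ultimately have "ladj H (hd as) (last bs)" by (rule triangle_lift[OF cov sl r])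
  then show ?case using triangulable.glue[OF 1 2 ne] xs by simp
qed

lemma cycle_walk:
  assumes "cycle G c"
  shows "walk G c" "{last c, hd c} \<in> edges G"
proof -
  have c: "3 \<le> length c" "set c \<subseteq> verts G" "cycle_edges c \<subseteq> edges G"
    using assms by (auto simp: cycle_def)
  then have "c \<noteq> []" by auto
  then show "{last c, hd c} \<in> edges G"
    using cycle_edges_last[of c] c by (auto simp: last_conv_nth hd_conv_nth insert_commute)
  show "walk G c"
    using c \<open>c \<noteq> []\<close> cycle_edges_Suc[of _ c] by (auto simp: walk_def successively_conv_nth)
qed

text \<open>Let \<open>x = hd L\<close>, a walk of \<open>G\<close>. Going around \<open>L\<close>
  returns to the class of \<open>x\<close>, so \<open>x\<close> followed by the projection is
  homotopic to \<open>x\<close>; prepending the reverse of \<open>x\<close> cancels it on both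
  sides.\<close>

lemma walk_cover_closed_homotopic:
  assumes G: "simple_graph G" and r: "2 \<le> r" and rc: "r_chordal r G"
    and L: "walk (walk_cover r G) L" "hd L = last L"
  shows "homotopic (ladj G) (map last L) [last (hd L)]"
proof -
  let ?R = "ladj G" and ?x = "hd L" and ?b = "map last L"
  have x: "?x \<in> verts (walk_cover r G)" by (rule walk_hd_in[OF L(1)])
  then have wx: "walk G ?x" "?x \<noteq> []" by (auto simp: walk_cover_vert_iff based_walks_def walk_def)
  have "htp_rep r G (?x @ tl ?b) = htp_rep r G ?x"
    using walk_cover_walk_end[OF G r L(1)] L(2) x by (simp add: walk_cover_vert_iff)
  then have "homotopic ?R (?x @ tl ?b) ?x"
    by (intro walk_htp_homotopic[OF G rc] htp_rep_eqD)
  from homotopic_context[OF this, of "butlast (rev ?x)" "[]"]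
  have 1: "homotopic ?R (butlast (rev ?x) @ ?x @ tl ?b) (butlast (rev ?x) @ ?x)" by simp
  have "butlast (rev ?x) @ ?x = rev ?x @ tl ?x"
    using wx(2) by (metis append.assoc append_Cons append_Nil append_butlast_last_id hd_Cons_tl last_rev
        rev_is_Nil_conv)
  moreover have spur: "homotopic ?R (rev ?x @ tl ?x) [last ?x]"
    by (rule homotopic_spur[OF reflp_ladj symp_ladj wx(2) walk_successively_ladj[OF wx(1)]])
  ultimately have 2: "homotopic ?R ((rev ?x @ tl ?x) @ tl ?b) [last ?x]"
    using 1 by (metis append.assoc equivclp_trans)
  from homotopic_context[OF spur, of "[]" "tl ?b"]
  have "homotopic ?R ((rev ?x @ tl ?x) @ tl ?b) ([last ?x] @ tl ?b)" by simp
  moreover have "[last ?x] @ tl ?b = ?b" using L(1) by (cases L) (auto simp: walk_def)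
  ultimately show ?thesis using 2 by (metis equivclp_sym equivclp_trans)
qed

text \<open>A closed walk lists its starting vertex twice, a polygon only once. Appending one more
  step to \<open>last c\<close> creates a spur on one side of the equivalence and the root side on
  the other.\<close>

lemma homotopic_closed_walkD:
  assumes R: "reflp R" "symp R" and c: "c \<noteq> []" "R (last c) (hd c)"
    and h: "homotopic R (c @ [hd c]) [hd c]"
  shows "homotopic R c [hd c, last c]"
proof -
  let ?g = "hd c" and ?l = "last c"
  have "R ?l ?g" "R ?g ?l" "R ?l ?l" using R c by (auto dest: sympD reflpD)
  then have "shortcut R [?l, ?g, ?l] [?l, ?l]" "shortcut R [?l, ?l] [?l]"
    using shortcut.corner[of R ?l ?g ?l "[]" "[]"] shortcut.stay[of R "[]" ?l "[]"] by auto
  then have "homotopic R [?l, ?g, ?l] [?l]"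
    by (meson equivclp_trans r_into_equivclp)
  from homotopic_context[OF this, of "butlast c" "[]"]
  have "homotopic R (c @ [?g, ?l]) c"
    using c(1) by (metis append.assoc append_Cons append_Nil append_Nil2 append_butlast_last_id)
  moreover from homotopic_context[OF h, of "[]" "[?l]"]
  have "homotopic R (c @ [?g, ?l]) [?g, ?l]" by simp
  ultimately show ?thesis by (metis equivclp_sym equivclp_trans)
qed

lemma r_chordal_links_imp_chordal_cover:
  fixes G :: "'a ugraph"
  assumes G: "simple_graph G" and r: "3 \<le> r" and rc: "r_chordal r G"
    and link: "links_triangulable (ladj G)" and loc: "r_local_covering r p H G"
  shows "chordal H"
  unfolding chordal_def
proof (intro allI impI)
  fix c assume "cycle H c \<and> 4 \<le> length c"
  then have c: "cycle H c" "4 \<le> length c" by auto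
  then have ne: "c \<noteq> []" and d: "distinct c" by (auto simp: cycle_def)
  have r2: "2 \<le> r" using r by simp
  have cov: "covering p H G" and bp: "ball_preserving r p H G"
    using loc by (auto simp: r_local_covering_def)
  have sl: "short_walks_lift r p H" by (rule ball_preservingD[OF cov bp])
  obtain q where q: "covering q H (walk_cover r G)" "\<forall>x\<in>verts H. p x = last (q x)"
    using loc r_local_covering_walk_cover[OF G r2] unfolding r_local_covering_def by blast
  note H = covering_simple(1)[OF cov]
  have "walk H (c @ [hd c])" by (rule walk_snoc[OF H cycle_walk[OF c(1)]])
  then have w: "walk (walk_cover r G) (map q (c @ [hd c]))"
    by (rule walk_map[OF covering_hom[OF q(1)]])
  have V: "set c \<subseteq> verts H" using c by (simp add: cycle_def)
  have "map last (map q (c @ [hd c])) = map p (c @ [hd c])"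
    using q(2) V ne by (auto simp: subset_iff)
  moreover have "homotopic (ladj G) (map last (map q (c @ [hd c]))) [last (hd (map q (c @ [hd c])))]"
    by (rule walk_cover_closed_homotopic[OF G r2 rc w]) (use ne in \<open>simp add: hd_map\<close>)
  moreover have "last (hd (map q (c @ [hd c]))) = p (hd c)"
    using q(2) V ne by (simp add: hd_map hd_append subset_iff)
  ultimately have "homotopic (ladj G) (map p (c @ [hd c])) [p (hd c)]" by metis
  then have "homotopic (ladj G) (map p c @ [hd (map p c)]) [hd (map p c)]"
    using ne by (simp add: hd_map)
  moreover have l: "ladj G (last (map p c)) (hd (map p c))"
    using graph_hom_edge[OF covering_hom[OF cov] cycle_walk(2)[OF c(1)]] ne
    by (simp add: ladj_def hd_map last_map)
  ultimately have "homotopic (ladj G) (map p c) [hd (map p c), last (map p c)]"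
    using homotopic_closed_walkD[OF reflp_ladj symp_ladj, of "map p c" G] ne by simp
  moreover have "triangulable (ladj G) [hd (map p c), last (map p c)]"
    by (rule triangulable.pair[of "ladj G", OF ladj_sym[OF l]])
  ultimately have "triangulable (ladj G) (map p c)"
    using triangulable_homotopic[OF reflp_ladj symp_ladj link] by blast
  then have "triangulable (ladj H) c"
    by (rule triangulable_lift[OF cov sl r]) (use walk_successively_ladj cycle_walk[OF c(1)] in auto)
  from triangulable_imp_diagonal[OF this c(2)] obtain i j where
    ij: "i + 2 \<le> j" "j < length c" "\<not> (i = 0 \<and> j = length c - 1)" "ladj H (c ! i) (c ! j)" by blast
  then have "{c ! i, c ! j} \<in> edges H"
    using d nth_eq_iff_index_eq[OF d, of i j] by (auto simp: ladj_def)
  then show "has_chord H c" using has_chordI[OF d _ ij(1-3)] by blast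
qed

section \<open>Wheels\<close>

lemma graph_iso_edge_iff:
  assumes iso: "graph_iso f G H" and G: "simple_graph G" and ab: "a \<in> verts G" "b \<in> verts G"
  shows "{a, b} \<in> edges G \<longleftrightarrow> {f a, f b} \<in> edges H"
proof
  have im: "(\<lambda>e. f ` e) ` edges G = edges H" and inj: "inj_on f (verts G)"
    using iso by (auto simp: graph_iso_def bij_betw_def)
  show "{f a, f b} \<in> edges H" if "{a, b} \<in> edges G"
    using imageI[OF that, of "\<lambda>e. f ` e"] im by simp
  assume "{f a, f b} \<in> edges H"
  then have "{f a, f b} \<in> (\<lambda>e. f ` e) ` edges G" using im by simp
  then obtain e where e: "e \<in> edges G" "f ` e = f ` {a, b}" by (auto elim!: imageE)
  have "e \<subseteq> verts G" using e G by (auto simp: simple_graph_def)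
  then have "e = {a, b}" using inj_on_image_eq_iff[OF inj, of e "{a, b}"] e ab by simp
  then show "{a, b} \<in> edges G" using e by simp
qed

lemma graph_iso_inv:
  assumes iso: "graph_iso f G H" and G: "simple_graph G"
  shows "graph_iso (inv_into (verts G) f) H G"
proof -
  have im: "(\<lambda>e. f ` e) ` edges G = edges H" and bij: "bij_betw f (verts G) (verts H)"
    using iso by (auto simp: graph_iso_def)
  have "inv_into (verts G) f ` (f ` e) = e" if "e \<in> edges G" for e
    using that G bij by (intro inv_into_image_cancel) (auto simp: simple_graph_def bij_betw_def)
  then have "(\<lambda>e. inv_into (verts G) f ` e) ` edges H = edges G"
    unfolding im[symmetric] image_image by simp
  then show ?thesis using bij_betw_inv_into[OF bij] by (simp add: graph_iso_def)
qed

lemma graph_iso_cycle: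
  assumes iso: "graph_iso f G H" and c: "cycle G c"
  shows "cycle H (map f c)"
proof -
  have V: "set c \<subseteq> verts G" and E: "cycle_edges c \<subseteq> edges G" and "3 \<le> length c" "distinct c"
    using c by (auto simp: cycle_def)
  have "inj_on f (set c)" "f ` set c \<subseteq> verts H"
    using iso V by (auto simp: graph_iso_def bij_betw_def intro: inj_on_subset)
  moreover have im: "f ` e \<in> edges H" if "e \<in> edges G" for e
    using iso that by (auto simp: graph_iso_def)
  have "cycle_edges (map f c) \<subseteq> edges H"
  proof
    fix e assume "e \<in> cycle_edges (map f c)"
    then obtain i where i: "i < length c" "e = {map f c ! i, map f c ! (Suc i mod length c)}"
      by (auto simp: cycle_edges_def)
    have "Suc i mod length c < length c" using i by (intro mod_less_divisor) auto
    then have "e = f ` {c ! i, c ! (Suc i mod length c)}" using i by simp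
    moreover have "{c ! i, c ! (Suc i mod length c)} \<in> cycle_edges c" using i by (auto simp: cycle_edges_def)
    ultimately show "e \<in> edges H" using im E by blast
  qed
  ultimately show ?thesis using \<open>3 \<le> length c\<close> \<open>distinct c\<close> by (simp add: cycle_def distinct_map)
qed

lemma graph_iso_has_chord:
  assumes iso: "graph_iso f G H" and G: "simple_graph G" and H: "simple_graph H" and c: "cycle G c"
    and "has_chord H (map f c)"
  shows "has_chord G c"
proof -
  obtain i j where ij: "i + 2 \<le> j" "j < length (map f c)" "\<not> (i = 0 \<and> j = length (map f c) - 1)"
    "{map f c ! i, map f c ! j} \<in> edges H"
    by (rule has_chordE[OF H assms(5)])
  have "c ! i \<in> verts G" "c ! j \<in> verts G" using c ij by (auto simp: cycle_def)
  then have "{c ! i, c ! j} \<in> edges G" using graph_iso_edge_iff[OF iso G] ij by simp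
  then show ?thesis using c ij by (intro has_chordI[of c i j]) (auto simp: cycle_def)
qed

lemma simple_graph_wheel:
  assumes "4 \<le> n"
  shows "simple_graph (wheel n)"
  unfolding simple_graph_def
proof
  fix e assume "e \<in> edges (wheel n)"
  then consider "e \<in> cycle_edges [0..<n]" | i where "i < n" "e = {i, n}" by (auto simp: wheel_def)
  then show "e \<subseteq> verts (wheel n) \<and> card e = 2"
  proof cases
    case 1
    then show ?thesis by (cases rule: cycle_edgesE) (use assms in \<open>auto simp: wheel_def\<close>)
  next
    case 2
    then show ?thesis by (auto simp: wheel_def)
  qed
qed

lemma simple_graph_induced: "simple_graph G \<Longrightarrow> simple_graph (induced G S)"
  by (auto simp: simple_graph_def induced_def)

lemma not_wheel_freeD:
  assumes G: "simple_graph G" and "\<not> wheel_free G"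
  obtains h c where "cycle G c" "4 \<le> length c" "\<not> has_chord G c" "\<forall>x\<in>set c. {h, x} \<in> edges G"
proof -
  obtain n S f where n: "4 \<le> n" "S \<subseteq> verts G" and iso: "graph_iso f (induced G S) (wheel n)"
    using assms(2) by (auto simp: wheel_free_def)
  define g where "g = inv_into (verts (induced G S)) f"
  have iso': "graph_iso g (wheel n) (induced G S)"
    unfolding g_def by (rule graph_iso_inv[OF iso simple_graph_induced[OF G]])
  note W = simple_graph_wheel[OF n(1)]
  have rim: "cycle (wheel n) [0..<n]" using n by (auto simp: cycle_def wheel_def)
  have no: "\<not> has_chord (wheel n) [0..<n]"
    by (auto simp: has_chord_def wheel_def)
  let ?c = "map g [0..<n]"
  have c: "cycle (induced G S) ?c" by (rule graph_iso_cycle[OF iso' rim])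
  have nc: "\<not> has_chord (induced G S) ?c"
    using graph_iso_has_chord[OF iso' W simple_graph_induced[OF G] rim] no by blast
  have cG: "cycle G ?c" using c by (auto simp: cycle_def induced_def)
  moreover have "\<not> has_chord G ?c"
  proof
    assume "has_chord G ?c"
    moreover have "set ?c \<subseteq> S" using c by (auto simp: cycle_def induced_def)
    ultimately show False using nc unfolding has_chord_def induced_def by auto
  qed
  moreover have "{g n, x} \<in> edges G" if "x \<in> set ?c" for x
  proof -
    obtain i where i: "i < n" "x = g i" using \<open>x \<in> set ?c\<close> by auto
    then have "{i, n} \<in> edges (wheel n)" by (auto simp: wheel_def)
    then have "{g n, g i} \<in> edges (induced G S)"
      using graph_iso_edge_iff[OF iso' W, of n i] i by (auto simp: wheel_def insert_commute)
    then show ?thesis using i by (simp add: induced_def)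
  qed
  ultimately show ?thesis using that[of ?c "g n"] n by simp
qed

lemma wheel_freeD:
  assumes G: "simple_graph G" and wf: "wheel_free G"
    and c: "cycle G c" "4 \<le> length c" and hub: "\<forall>x\<in>set c. {h, x} \<in> edges G"
  shows "has_chord G c"
proof (rule ccontr)
  assume nc: "\<not> has_chord G c"
  define n where "n = length c"
  define g where "g i = (if i < n then c ! i else h)" for i
  define S where "S = insert h (set c)"
  have d: "distinct c" and V: "set c \<subseteq> verts G" and E: "cycle_edges c \<subseteq> edges G"
    using c by (auto simp: cycle_def)
  have h: "h \<notin> set c" using hub edge_verts(3)[OF G] by blast
  have ne: "c \<noteq> []" using c by auto
  have "h \<in> verts G" using hub ne edge_verts(1)[OF G] by (meson hd_in_set)
  then have SV: "S \<subseteq> verts G" using V by (simp add: S_def)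
  have inj: "inj_on g {0..n}"
    using d h by (auto simp: inj_on_def g_def n_def nth_eq_iff_index_eq)
  have im: "g ` {0..n} = S"
  proof
    show "g ` {0..n} \<subseteq> S" by (auto simp: g_def S_def n_def)
    show "S \<subseteq> g ` {0..n}"
    proof
      fix x assume "x \<in> S"
      then consider "x = g n" | i where "i < n" "x = g i"
        by (auto simp: S_def g_def n_def in_set_conv_nth)
      then show "x \<in> g ` {0..n}" by cases auto
    qed
  qed
  have "(\<lambda>e. g ` e) ` edges (wheel n) = {e \<in> edges G. e \<subseteq> S}"
  proof (intro equalityI subsetI)
    fix e assume "e \<in> (\<lambda>e. g ` e) ` edges (wheel n)"
    then obtain e' where e': "e' \<in> edges (wheel n)" "e = g ` e'" by blast
    then consider "e' \<in> cycle_edges [0..<n]" | i where "i < n" "e' = {i, n}" by (auto simp: wheel_def)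
    then show "e \<in> {e \<in> edges G. e \<subseteq> S}"
    proof cases
      case 1
      then show ?thesis
      proof (cases rule: cycle_edgesE)
        case (1 i)
        then show ?thesis using e' E cycle_edges_Suc[of i c] by (auto simp: g_def S_def n_def)
      next
        case 2
        then show ?thesis using e' E cycle_edges_last[OF ne] ne by (auto simp: g_def S_def n_def)
      qed
    next
      case 2
      then show ?thesis using e' hub by (auto simp: g_def S_def n_def insert_commute)
    qed
  next
    fix e assume e: "e \<in> {e \<in> edges G. e \<subseteq> S}"
    then obtain x y where xy: "e = {x, y}" "x \<noteq> y" using edgeE[OF G] by blast
    then obtain i j where "x = g i" "y = g j" "i \<le> n" "j \<le> n" using e im by (auto simp: image_iff)
    then have "\<exists>i j. i < j \<and> j \<le> n \<and> e = {g i, g j}"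
      using xy by (metis insert_commute linorder_neqE_nat)
    then obtain i j where ij: "i < j" "j \<le> n" "e = {g i, g j}" by blast
    have "{i, j} \<in> edges (wheel n)"
    proof (cases "j = n")
      case True
      then show ?thesis using ij by (auto simp: wheel_def)
    next
      case False
      then have "j < n" using ij by simp
      then have cij: "{c ! i, c ! j} \<in> edges G" using e ij by (simp add: g_def)
      have "j = Suc i \<or> i = 0 \<and> j = n - 1"
        using has_chordI[OF d cij] nc \<open>j < n\<close> ij(1) unfolding n_def by fastforce
      then show ?thesis
        using cycle_edges_Suc[of i "[0..<n]"] cycle_edges_last[of "[0..<n]"] \<open>j < n\<close>
        by (auto simp: wheel_def)
    qed
    then have "g ` {i, j} \<in> (\<lambda>e. g ` e) ` edges (wheel n)" by (rule imageI)
    then show "e \<in> (\<lambda>e. g ` e) ` edges (wheel n)" using ij by simp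
  qed
  then have "graph_iso g (wheel n) (induced G S)"
    using inj im SV by (auto simp: graph_iso_def bij_betw_def induced_def wheel_def)
  then have "graph_iso (inv_into (verts (wheel n)) g) (induced G S) (wheel n)"
    by (rule graph_iso_inv[OF _ simple_graph_wheel]) (use c n_def in simp)
  then show False using wf SV c(2) unfolding wheel_free_def n_def by blast
qed

text \<open>The walk lies in the closed neighbourhood of \<open>y\<close>. A cycle there that avoids
  \<open>y\<close> is the rim of a wheel unless it has a chord; in a cycle through \<open>y\<close>,
  all other vertices are adjacent to \<open>y\<close>, so the one two positions away gives a
  chord.\<close>

lemma wheel_free_links:
  assumes G: "simple_graph G" and wf: "wheel_free G"
  shows "links_triangulable (ladj G)"
  unfolding links_triangulable_def
proof (intro allI impI)
  fix y Z assume Z: "Z \<noteq> []" "successively (ladj G) Z" "ladj G (last Z) (hd Z)" "\<forall>z\<in>set Z. ladj G y z"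
  show "triangulable (ladj G) Z"
  proof (rule closed_walk_triangulable[OF G, of "{z. ladj G y z}" "length Z"])
    fix c assume c: "cycle G c" "set c \<subseteq> {z. ladj G y z}" "4 \<le> length c"
    have d: "distinct c" using c by (simp add: cycle_def)
    show "has_chord G c"
    proof (cases "y \<in> set c")
      case True
      then obtain i where i: "i < length c" "c ! i = y" by (auto simp: in_set_conv_nth)
      have adj: "{y, c ! j} \<in> edges G" if "j < length c" "j \<noteq> i" for j
      proof -
        have "ladj G y (c ! j)" using c(2) that(1) nth_mem by blast
        moreover have "y \<noteq> c ! j" using nth_eq_iff_index_eq[OF d] that i by metis
        ultimately show ?thesis by (simp add: ladj_def)
      qed
      show ?thesis
      proof (cases "i < 2")
        case True
        then show ?thesis
          using has_chordI[OF d, of i "i + 2" G] adj[of "i + 2"] i c(3) by fastforce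
      next
        case False
        then have "i - 2 + 2 \<le> i" "\<not> (i - 2 = 0 \<and> i = length c - 1)" using c(3) by linarith+
        then show ?thesis
          using has_chordI[OF d, of "i - 2" i G] adj[of "i - 2"] i False by (simp add: insert_commute)
      qed
    next
      case False
      then have "\<forall>x\<in>set c. {y, x} \<in> edges G" using c(2) by (auto simp: ladj_def)
      then show ?thesis by (rule wheel_freeD[OF G wf c(1,3)])
    qed
  qed (use Z in auto)
qed

section \<open>Balls\<close>

lemma shorten_walk:
  assumes F: "successively R F" and ij: "i + 2 \<le> j" "j < length F" "R (F ! i) (F ! j)"
  shows "\<exists>F'. length F' < length F \<and> F' \<noteq> [] \<and> successively R F' \<and> hd F' = hd F \<and> last F' = last F \<and>
    set F' \<subseteq> set F"
proof -
  define A x M y B where "A = take i F" "x = F ! i" "M = take (j - i - 1) (drop (Suc i) F)"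
    "y = F ! j" "B = drop (Suc j) F"
  note d = this
  have eq: "F = A @ x # M @ y # B"
    using list_split_two[of i j F] ij unfolding d by simp
  have "M \<noteq> []" "R x y" using ij by (auto simp: d)
  then show ?thesis
    using F unfolding eq
    by (intro exI[of _ "A @ x # y # B"])
      (auto simp: successively_append_iff successively_Cons hd_append)
qed

lemma induced_path:
  assumes "reflp R"
  shows "F \<noteq> [] \<Longrightarrow> successively R F \<Longrightarrow> \<exists>F'. F' \<noteq> [] \<and> successively R F' \<and> hd F' = hd F \<and>
    last F' = last F \<and> set F' \<subseteq> set F \<and> distinct F' \<and>
    (\<forall>i j. i + 2 \<le> j \<longrightarrow> j < length F' \<longrightarrow> \<not> R (F' ! i) (F' ! j))"
proof (induction "length F" arbitrary: F rule: less_induct)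
  case less
  show ?case
  proof (cases "distinct F \<and> (\<forall>i j. i + 2 \<le> j \<longrightarrow> j < length F \<longrightarrow> \<not> R (F ! i) (F ! j))")
    case True
    then show ?thesis using less.prems by blast
  next
    case False
    have "\<exists>F1. length F1 < length F \<and> F1 \<noteq> [] \<and> successively R F1 \<and> hd F1 = hd F \<and> last F1 = last F \<and>
      set F1 \<subseteq> set F"
    proof (cases "distinct F")
      case True
      then obtain i j where ij: "i + 2 \<le> j" "j < length F" "R (F ! i) (F ! j)" using False by blast
      then show ?thesis using shorten_walk less.prems(2) by blast
    next
      case False
      then obtain A M B x where F: "F = A @ [x] @ M @ [x] @ B"
        using not_distinct_decomp by blast
      show ?thesis
        using less.prems(2) unfolding F
        by (intro exI[of _ "A @ x # B"])
          (auto simp: successively_append_iff successively_Cons hd_append last_append)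
    qed
    then obtain F1 where F1: "length F1 < length F" "F1 \<noteq> []" "successively R F1" "hd F1 = hd F"
      "last F1 = last F" "set F1 \<subseteq> set F" by blast
    from less.hyps[OF F1(1,2,3)] F1(4-6) show ?thesis by (smt (verit) subset_trans)
  qed
qed

text \<open>The core of Dirac's argument that minimal separators of chordal graphs are cliques.
  Induced paths through the two sides close up to a cycle; a diagonal can neither lie within one
  path nor join the sides. It is used for separators and for balls.\<close>

lemma chordal_two_sides:
  assumes H: "simple_graph H" and ch: "chordal H" and xy: "\<not> ladj H x y"
    and F0: "F0 \<noteq> []" "successively (ladj H) F0" "hd F0 = x" "last F0 = y" "set F0 \<subseteq> A \<union> {x, y}"
    and K0: "K0 \<noteq> []" "successively (ladj H) K0" "hd K0 = x" "last K0 = y" "set K0 \<subseteq> B \<union> {x, y}"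
    and AB: "\<And>a b. a \<in> A \<Longrightarrow> b \<in> B \<Longrightarrow> \<not> ladj H a b"
  shows False
proof -
  obtain F where F: "F \<noteq> []" "successively (ladj H) F" "hd F = x" "last F = y" "set F \<subseteq> A \<union> {x, y}"
    "distinct F" and nF: "\<And>i j. i + 2 \<le> j \<Longrightarrow> j < length F \<Longrightarrow> \<not> ladj H (F ! i) (F ! j)"
    using induced_path[OF reflp_ladj F0(1,2)] F0(3-5) by (metis subset_trans)
  obtain K where K: "K \<noteq> []" "successively (ladj H) K" "hd K = x" "last K = y" "set K \<subseteq> B \<union> {x, y}"
    "distinct K" and nK: "\<And>i j. i + 2 \<le> j \<Longrightarrow> j < length K \<Longrightarrow> \<not> ladj H (K ! i) (K ! j)"
    using induced_path[OF reflp_ladj K0(1,2)] K0(3-5) by (metis subset_trans)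
  have len: "3 \<le> length D" if D: "D \<noteq> []" "successively (ladj H) D" "hd D = x" "last D = y" for D
  proof (rule ccontr)
    assume "\<not> 3 \<le> length D"
    then obtain a b where "D = [a] \<or> D = [a, b]" using D(1) by (cases D; cases "tl D"; cases "tl (tl D)") auto
    then show False using D xy by (auto simp: ladj_refl)
  qed
  have lF: "3 \<le> length F" and lK: "3 \<le> length K" using len F K by auto
  have F0': "F ! 0 = x" "F ! (length F - 1) = y" and K0': "K ! 0 = x" "K ! (length K - 1) = y"
    using F K by (auto simp: hd_conv_nth last_conv_nth)
  define I where "I = butlast (tl K)"
  have KI: "K = x # I @ [y]"
    using K(1,3,4) lK unfolding I_def
    by (cases K) (auto simp: append_butlast_last_id split: if_splits)
  have I: "I \<noteq> []" using lK KI by auto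
  let ?c = "F @ rev I"
  have sK: "successively (ladj H) (x # I)" "successively (ladj H) (I @ [y])"
    using K(2) I unfolding KI by (auto simp: successively_append_iff successively_Cons)
  have "successively (ladj H) (rev I)"
    using sK(1) by (intro successively_ladj_rev) (auto simp: successively_Cons)
  moreover have "ladj H y (hd (rev I))" using sK(2) I ladj_sym by (auto simp: successively_append_iff hd_rev)
  ultimately have c1: "successively (ladj H) ?c" using F by (auto simp: successively_append_iff)
  have c2: "ladj H (last ?c) (hd ?c)"
    using sK(1) I F(1,3) ladj_sym by (cases I) (auto simp: last_rev)
  have lc: "length ?c = length F + length K - 2" "4 \<le> length ?c" using lF lK KI by auto
  \<comment> \<open>Behind \<open>F\<close> the closed walk runs backwards through \<open>K\<close>
    without its two ends, which it shares with \<open>F\<close>.\<close>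
  have cK: "?c ! t = K ! (length F + length K - 2 - t)" if "length F \<le> t" "t < length ?c" for t
  proof -
    have "?c ! t = rev I ! (t - length F)" using that by (simp add: nth_append)
    also have "\<dots> = I ! (length I - Suc (t - length F))" using that by (intro rev_nth) auto
    also have "\<dots> = K ! Suc (length I - Suc (t - length F))"
    proof -
      have "length I - Suc (t - length F) < length I" using I by simp
      then show ?thesis by (simp add: KI nth_append)
    qed
    also have "Suc (length I - Suc (t - length F)) = length F + length K - 2 - t"
      using that KI by auto
    finally show ?thesis .
  qed
  obtain i j where ij: "i + 2 \<le> j" "j < length ?c" "\<not> (i = 0 \<and> j = length ?c - 1)"
    "ladj H (?c ! i) (?c ! j)"
    using closed_walk_diagonal[OF H c1 c2 lc(2)] ch lc(2) by (auto simp: chordal_def)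
  let ?m = "length F + length K - 2"
  consider "j < length F" | "length F \<le> i" | "i < length F" "length F \<le> j" by linarith
  then show False
  proof cases
    case 1
    then show ?thesis using nF[OF ij(1)] ij by (simp add: nth_append)
  next
    case 2
    have "ladj H (K ! (?m - j)) (K ! (?m - i))"
      using ij(4) cK[of i] cK[of j] 2 ij(1,2) ladj_sym by auto
    moreover have "?m - j + 2 \<le> ?m - i" "?m - i < length K" using 2 ij(1,2) lc lK by linarith+
    ultimately show ?thesis using nK by blast
  next
    case 3
    let ?k = "?m - j"
    have k: "1 \<le> ?k" "?k \<le> length K - 2" using 3 ij(2) lc lF lK by linarith+
    have l: "ladj H (F ! i) (K ! ?k)" using ij(4) cK[OF 3(2) ij(2)] 3(1) by (simp add: nth_append)
    \<comment> \<open>An end of \<open>F\<close> is also an end of \<open>K\<close>, so a diagonal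
      starting there is one of \<open>K\<close>; between inner vertices it would join the two
      sides.\<close>
    consider "i = 0" | "i = length F - 1" | "0 < i" "i < length F - 1" using 3 by linarith
    then show ?thesis
    proof cases
      case 1
      then have "2 \<le> ?k" using ij(3) lc k ij(2) by linarith
      then show ?thesis using nK[of 0 ?k] l 1 F0' K0' k lK by simp
    next
      case 2
      then have "?k + 2 \<le> length K - 1" using ij(1) lF lK by linarith
      then show ?thesis using nK[of ?k "length K - 1"] ladj_sym[OF l] 2 F0' K0' lK by simp
    next
      case 3
      have "i < length F" "0 < length F" "length F - 1 < length F" "i \<noteq> length F - 1" using 3 by linarith+
      then have "F ! i \<noteq> x \<and> F ! i \<noteq> y"
        using F0' nth_eq_iff_index_eq[OF F(6), of i 0] nth_eq_iff_index_eq[OF F(6), of i "length F - 1"] 3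
        by (metis less_numeral_extra(3))
      moreover have "F ! i \<in> set F" using 3 by simp
      ultimately have a: "F ! i \<in> A" using F(5) by blast
      have "?k < length K" "0 < length K" "length K - 1 < length K" "?k \<noteq> length K - 1" using k lK by linarith+
      then have "K ! ?k \<noteq> x \<and> K ! ?k \<noteq> y"
        using K0' nth_eq_iff_index_eq[OF K(6), of ?k 0] nth_eq_iff_index_eq[OF K(6), of ?k "length K - 1"] k
        by (metis not_one_le_zero)
      moreover have "K ! ?k \<in> set K" using k lK by simp
      ultimately have "K ! ?k \<in> B" using K(5) by blast
      then show ?thesis using AB a l by blast
    qed
  qed
qed

lemma cycle_neighbours:
  assumes "4 \<le> length c" "i < length c"
  obtains j k where "j + 2 \<le> k" "k < length c" "\<not> (j = 0 \<and> k = length c - 1)"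
    "{c ! i, c ! j} \<in> cycle_edges c" "{c ! i, c ! k} \<in> cycle_edges c"
proof -
  have ne: "c \<noteq> []" using assms by auto
  consider "i = 0" | "i = length c - 1" "0 < i" | l where "i = Suc l" "Suc i < length c"
    using assms by (cases i) force+
  then show ?thesis
  proof cases
    case 1
    then show ?thesis
      using that[of 1 "length c - 1"] assms cycle_edges_Suc[of 0 c] cycle_edges_last[OF ne] by auto
  next
    case 2
    have l: "Suc (length c - 2) = length c - 1" using assms by arith
    have "length c - 2 \<noteq> length c - 1" using assms by arith
    then show ?thesis
      using that[of 0 "length c - 2"] 2 assms cycle_edges_Suc[of "length c - 2" c] cycle_edges_last[OF ne] l
      by (simp add: insert_commute)
  next
    case 3
    have "\<not> (l = 0 \<and> Suc i = length c - 1)" using 3 assms by arith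
    then show ?thesis
      using that[of l "Suc i"] 3 cycle_edges_Suc[of i c] cycle_edges_Suc[of l c]
      by (auto simp: insert_commute)
  qed
qed

lemma walk_prefix:
  assumes "walk_betw G v xs a" "z \<in> set xs"
  shows "\<exists>ys. walk_betw G v ys z \<and> (z \<noteq> a \<longrightarrow> length ys < length xs)"
proof -
  obtain as bs where xs: "xs = (as @ [z]) @ bs"
    using assms(2) by (metis append.assoc append_Cons append_Nil split_list)
  have "walk_betw G v (as @ [z]) z"
    using assms(1) walk_appendD1[of G "as @ [z]" bs] unfolding xs by (auto simp: walk_betw_def hd_append)
  moreover have "z \<noteq> a \<Longrightarrow> bs \<noteq> []" using assms(1) unfolding xs by (auto simp: walk_betw_def)
  ultimately show ?thesis unfolding xs by (intro exI[of _ "as @ [z]"]) auto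
qed

text \<open>A chord in \<open>H\<close> can fail to be an edge of the ball only if its ends have
  distance exactly \<open>r / 2\<close>. If the cycle has a vertex that far out, its two neighbours
  on the cycle are closer to the centre and turn out to be adjacent; this chord lies in the
  ball.\<close>

lemma chordal_half_ball:
  assumes H: "simple_graph H" and ch: "chordal H"
  shows "chordal (half_ball H v r)"
  unfolding chordal_def
proof (intro allI impI)
  let ?B = "half_ball H v r"
  fix c assume "cycle ?B c \<and> 4 \<le> length c"
  then have c: "cycle ?B c" "4 \<le> length c" by auto
  have B: "simple_graph ?B" by (rule simple_graph_half_ball[OF H])
  have d: "distinct c" and cH: "cycle H c" using c(1) by (auto simp: cycle_def half_ball_def)
  show "has_chord ?B c"
  proof (cases "\<forall>y\<in>set c. \<exists>xs. walk_betw H v xs y \<and> 2 * (length xs - 1) < r")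
    case True
    have "has_chord H c" using ch cH c(2) by (simp add: chordal_def)
    then obtain i j where ij: "i + 2 \<le> j" "j < length c" "\<not> (i = 0 \<and> j = length c - 1)"
      "{c ! i, c ! j} \<in> edges H" by (rule has_chordE[OF H])
    have "c ! i \<in> set c" "c ! j \<in> set c" using ij by auto
    then obtain xs ys where "walk_betw H v xs (c ! i)" "2 * (length xs - 1) < r"
      "walk_betw H v ys (c ! j)" "2 * (length ys - 1) < r"
      using True by meson
    then have "{c ! i, c ! j} \<in> edges ?B"
      unfolding half_ball_edge_iff[OF H] using ij(4) by (intro conjI exI[of _ xs] exI[of _ ys]) auto
    then show ?thesis using has_chordI[OF d _ ij(1-3)] by blast
  next
    case False
    then obtain i where i: "i < length c" and
      far: "\<And>xs. walk_betw H v xs (c ! i) \<Longrightarrow> r \<le> 2 * (length xs - 1)"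
      by (auto simp: in_set_conv_nth not_less)
    let ?y = "c ! i"
    obtain j k where jk: "j + 2 \<le> k" "k < length c" "\<not> (j = 0 \<and> k = length c - 1)"
        "{?y, c ! j} \<in> cycle_edges c" "{?y, c ! k} \<in> cycle_edges c"
      by (rule cycle_neighbours[OF c(2) i])
    have near: "\<exists>xs. walk_betw H v xs a \<and> 2 * length xs \<le> r \<and> {?y, a} \<in> edges H"
      if "{?y, a} \<in> cycle_edges c" for a
    proof -
      have "{?y, a} \<in> edges ?B" using that c(1) by (auto simp: cycle_def)
      then obtain xs ys where w: "walk_betw H v xs ?y" "walk_betw H v ys a" "length xs + length ys < r + 2"
        "{?y, a} \<in> edges H"
        unfolding half_ball_edge_iff[OF H] by blast
      have "xs \<noteq> []" using w(1) by (auto simp: walk_betw_def walk_def)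
      then have "0 < length xs" by simp
      then show ?thesis using w far[OF w(1)] by (intro exI[of _ ys]) linarith
    qed
    let ?a = "c ! j" and ?b = "c ! k"
    obtain wa wb where wa: "walk_betw H v wa ?a" "2 * length wa \<le> r" "{?y, ?a} \<in> edges H"
      and wb: "walk_betw H v wb ?b" "2 * length wb \<le> r" "{?y, ?b} \<in> edges H"
      using near jk(4,5) by meson
    have "ladj H ?a ?b"
    proof (rule ccontr)
      assume n: "\<not> ladj H ?a ?b"
      \<comment> \<open>The vertices at distance at most \<open>r / 2 - 2\<close>: they contain the
        walks to \<open>?a\<close> and \<open>?b\<close> except for these two ends, and are too
        close to the centre to be adjacent to \<open>?y\<close>.\<close>
      let ?Z = "{z. \<exists>xs. walk_betw H v xs z \<and> 2 * (length xs + 1) \<le> r}"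
      have j: "walk_betw H ?a (rev wa @ tl wb) ?b" by (rule walk_betw_trans[OF walk_betw_rev[OF wa(1)] wb(1)])
      show False
      proof (rule chordal_two_sides[OF H ch n, of "[?a, ?y, ?b]" "{?y}" "rev wa @ tl wb" ?Z])
        show "successively (ladj H) [?a, ?y, ?b]" using wa wb by (auto simp: ladj_def insert_commute)
        show "rev wa @ tl wb \<noteq> []" "successively (ladj H) (rev wa @ tl wb)" "hd (rev wa @ tl wb) = ?a"
          "last (rev wa @ tl wb) = ?b"
          using j walk_successively_ladj[of H "rev wa @ tl wb"] unfolding walk_betw_def
          by (simp_all add: walk_def)
        show "set (rev wa @ tl wb) \<subseteq> ?Z \<union> {?a, ?b}"
        proof
          fix z assume "z \<in> set (rev wa @ tl wb)"
          then consider "z \<in> set wa" | "z \<in> set wb" by (cases wb) auto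
          then show "z \<in> ?Z \<union> {?a, ?b}"
          proof cases
            case 1
            obtain ys where "walk_betw H v ys z" "z \<noteq> ?a \<longrightarrow> length ys < length wa"
              using walk_prefix[OF wa(1) 1] by blast
            then show ?thesis using wa(2) by (cases "z = ?a") (auto intro!: exI[of _ ys])
          next
            case 2
            obtain ys where "walk_betw H v ys z" "z \<noteq> ?b \<longrightarrow> length ys < length wb"
              using walk_prefix[OF wb(1) 2] by blast
            then show ?thesis using wb(2) by (cases "z = ?b") (auto intro!: exI[of _ ys])
          qed
        qed
        fix y z assume "y \<in> {?y}" "z \<in> ?Z"
        then obtain xs where xs: "walk_betw H v xs z" "2 * (length xs + 1) \<le> r" and y: "y = ?y" by blast
        have "xs \<noteq> []" using xs(1) by (auto simp: walk_betw_def walk_def)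
        show "\<not> ladj H y z"
        proof
          assume "ladj H y z"
          then consider "z = ?y" | "{z, ?y} \<in> edges H" using y by (auto simp: ladj_def insert_commute)
          then show False
          proof cases
            case 1
            then show ?thesis using far[of xs] xs by simp
          next
            case 2
            have "walk_betw H v (xs @ [?y]) ?y"
              using walk_betw_trans[OF xs(1) walk_betw_edge[OF H 2]] by simp
            then show ?thesis using far[of "xs @ [?y]"] xs by simp
          qed
        qed
      qed auto
    qed
    moreover have "?a \<noteq> ?b" using nth_eq_iff_index_eq[OF d, of j k] jk by auto
    ultimately have "{?a, ?b} \<in> edges H" by (simp add: ladj_def)
    then have "{?a, ?b} \<in> edges ?B"
      unfolding half_ball_edge_iff[OF H] using wa wb by (intro conjI exI[of _ wa] exI[of _ wb]) auto
    then show ?thesis using has_chordI[OF d _ jk(1-3)] by blast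
  qed
qed

lemma chordal_cover_imp_locally_chordal:
  assumes cov: "covering p H G" and bp: "ball_preserving r p H G" and ch: "chordal H"
  shows "r_locally_chordal r G"
  unfolding r_locally_chordal_def chordal_def
proof (intro ballI allI impI)
  fix v c assume v: "v \<in> verts G" and "cycle (half_ball G v r) c \<and> 4 \<le> length c"
  then have c: "cycle (half_ball G v r) c" "4 \<le> length c" by auto
  obtain x where x: "x \<in> verts H" "p x = v" using covering_surj[OF cov v] by blast
  note H = simple_graph_half_ball[OF covering_simple(1)[OF cov], of x r]
    and G = simple_graph_half_ball[OF covering_simple(2)[OF cov], of v r]
  have "graph_iso p (half_ball H x r) (half_ball G v r)"
    using bp x by (auto simp: ball_preserving_def)
  then obtain g where g: "graph_iso g (half_ball G v r) (half_ball H x r)"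
    using graph_iso_inv[OF _ H] by blast
  have "has_chord (half_ball H x r) (map g c)"
    using chordal_half_ball[OF covering_simple(1)[OF cov] ch, of x r] graph_iso_cycle[OF g c(1)] c(2)
    by (simp add: chordal_def)
  then show "has_chord (half_ball G v r) c" by (rule graph_iso_has_chord[OF g G H c(1)])
qed

lemma cycle_in_subgraph:
  assumes B: "simple_graph B" and c: "cycle G c" "cycle_edges c \<subseteq> edges B"
  shows "cycle B c"
proof -
  have "set c \<subseteq> verts B"
  proof
    fix x assume "x \<in> set c"
    then obtain i where i: "i < length c" "x = c ! i" by (auto simp: in_set_conv_nth)
    then have "{c ! i, c ! (Suc i mod length c)} \<in> cycle_edges c" by (auto simp: cycle_edges_def)
    then show "x \<in> verts B" using edge_verts(1)[OF B] c(2) i by blast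
  qed
  then show ?thesis using c by (simp add: cycle_def)
qed

text \<open>The ball around any vertex of the cycle contains the cycle: running around both ways to
  the two ends of an edge takes \<open>length c - 1\<close> steps in total, fewer than
  \<open>r\<close>. The edge closing the list is reached with sum 1.\<close>

lemma locally_chordal_imp_r_chordal:
  assumes G: "simple_graph G" and r: "3 \<le> r" and lc: "r_locally_chordal r G"
  shows "r_chordal r G"
  unfolding r_chordal_def
proof (intro allI impI)
  fix c assume "cycle G c \<and> 4 \<le> length c \<and> length c \<le> r"
  then have c: "cycle G c" "4 \<le> length c" "length c \<le> r" by auto
  let ?v = "c ! 0" and ?n = "length c"
  let ?B = "half_ball G ?v r"
  have w: "walk G c" by (rule cycle_walk[OF c(1)])
  have ne: "c \<noteq> []" using c by auto
  have e: "{?v, c ! (?n - 1)} \<in> edges G" using cycle_edges_last[OF ne] c(1) by (auto simp: cycle_def)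
  have "cycle_edges c \<subseteq> edges ?B"
  proof
    fix f assume f: "f \<in> cycle_edges c"
    then show "f \<in> edges ?B"
    proof (cases rule: cycle_edgesE)
      case (1 i)
      have "walk_betw G ?v (take (Suc i) c) (c ! i)"
        using walk_take[OF w, of "Suc i"] 1(1) ne by (auto simp: walk_betw_def take_Suc_conv_app_nth hd_append hd_conv_nth)
      moreover have "walk_betw G (c ! Suc i) (drop (Suc i) c) (c ! (?n - 1))"
        using walk_drop[OF w 1(1)] 1(1) last_conv_nth[OF ne] by (simp add: walk_betw_def hd_drop_conv_nth)
      then have "walk_betw G ?v ([?v, c ! (?n - 1)] @ tl (rev (drop (Suc i) c))) (c ! Suc i)"
        using walk_betw_trans[OF walk_betw_edge[OF G e] walk_betw_rev] by blast
      moreover have "{c ! i, c ! Suc i} \<in> edges G" using f 1 c(1) by (auto simp: cycle_def)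
      moreover have "length (take (Suc i) c) + length ([?v, c ! (?n - 1)] @ tl (rev (drop (Suc i) c))) < r + 2"
        using 1(1) c(3) by simp
      ultimately show ?thesis unfolding 1(2) half_ball_edge_iff[OF G] by blast
    next
      case 2
      have "walk_betw G ?v [?v] ?v" using edge_verts[OF G e] by (intro walk_betw_refl)
      moreover have "length [?v] + length [?v, c ! (?n - 1)] < r + 2" using r by simp
      ultimately show ?thesis
        unfolding 2(2) half_ball_edge_iff[OF G] using e walk_betw_edge[OF G e] by blast
    qed
  qed
  then have "cycle ?B c" by (rule cycle_in_subgraph[OF simple_graph_half_ball[OF G] c(1)])
  then have "has_chord ?B c"
    using lc c(2) edge_verts(1)[OF G e] by (auto simp: r_locally_chordal_def chordal_def)
  then show "has_chord G c" by (auto simp: has_chord_def half_ball_def)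
qed

text \<open>Rim edges have distance sum 2 from the hub, so the rim lies in the ball around the
  hub.\<close>

lemma locally_chordal_imp_wheel_free:
  assumes G: "simple_graph G" and r: "3 \<le> r" and lc: "r_locally_chordal r G"
  shows "wheel_free G"
proof (rule ccontr)
  assume "\<not> wheel_free G"
  then obtain h c where c: "cycle G c" "4 \<le> length c" "\<not> has_chord G c" and
      hub: "\<forall>x\<in>set c. {h, x} \<in> edges G"
    by (rule not_wheel_freeD[OF G])
  let ?B = "half_ball G h r"
  have "cycle_edges c \<subseteq> edges ?B"
  proof
    fix f assume f: "f \<in> cycle_edges c"
    then have fG: "f \<in> edges G" using c(1) by (auto simp: cycle_def)
    obtain a b where ab: "f = {a, b}" "a \<in> set c" "b \<in> set c"
      using f by (cases rule: cycle_edgesE) (use c(2) in auto)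
    then have "walk_betw G h [h, a] a" "walk_betw G h [h, b] b"
      using walk_betw_edge[OF G] hub by auto
    moreover have "length [h, a] + length [h, b] < r + 2" using r by simp
    ultimately show "f \<in> edges ?B" unfolding ab(1) half_ball_edge_iff[OF G] using fG ab(1) by blast
  qed
  then have cB: "cycle ?B c" by (rule cycle_in_subgraph[OF simple_graph_half_ball[OF G] c(1)])
  have "c \<noteq> []" using c by auto
  then have "h \<in> verts G" using hub edge_verts(1)[OF G] by (meson hd_in_set)
  then have "has_chord ?B c" using lc c(2) cB by (auto simp: r_locally_chordal_def chordal_def)
  then show False using c(3) by (auto simp: has_chord_def half_ball_def)
qed

section \<open>Local separators\<close>

lemma walk_cycle_graph:
  assumes "cycle G c" "walk (cycle_graph c) xs"
  shows "walk G xs"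
proof -
  have "graph_hom id (cycle_graph c) G"
    using assms(1) by (auto simp: graph_hom_def cycle_graph_def cycle_def)
  from walk_map[OF this assms(2)] show ?thesis by simp
qed

lemma edge_boundaryI: "{x, a} \<in> edges G \<Longrightarrow> x \<in> X \<Longrightarrow> a \<notin> X \<Longrightarrow> {x, a} \<in> edge_boundary G X"
  by (simp add: edge_boundary_def)

lemma edge_boundaryE:
  assumes "simple_graph G" "e \<in> edge_boundary G X"
  obtains x a where "e = {x, a}" "x \<in> X" "a \<notin> X" "{x, a} \<in> edges G"
proof -
  have e: "e \<in> edges G" "card (e \<inter> X) = 1" using assms(2) by (auto simp: edge_boundary_def)
  obtain a b where ab: "e = {a, b}" "a \<noteq> b" by (rule edgeE[OF assms(1) e(1)])
  have "\<not> (a \<in> X \<and> b \<in> X)"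
  proof
    assume "a \<in> X \<and> b \<in> X"
    then have "e \<inter> X = {a, b}" using ab by blast
    then show False using e(2) ab(2) by simp
  qed
  moreover have "a \<in> X \<or> b \<in> X"
  proof (rule ccontr)
    assume "\<not> (a \<in> X \<or> b \<in> X)"
    then have "e \<inter> X = {}" using ab by blast
    then show False using e(2) by simp
  qed
  ultimately consider "a \<in> X" "b \<notin> X" | "b \<in> X" "a \<notin> X" by blast
  then show ?thesis
  proof cases
    case 1
    then show ?thesis using that[of a b] ab e(1) by simp
  next
    case 2
    moreover have "e = {b, a}" using ab by (simp add: insert_commute)
    ultimately show ?thesis using that[of b a] e(1) by simp
  qed
qed

lemma r_local_rel_refl: "e \<in> edge_boundary G X \<Longrightarrow> (e, e) \<in> r_local_rel r G X"
  unfolding r_local_rel_def by blast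

lemma r_local_relI:
  assumes c: "cycle G c" "length c \<le> r" "walk (cycle_graph c) (x # I @ [y])"
    and I: "I \<noteq> []" "x \<in> X" "y \<in> X" "set I \<inter> X = {}"
  shows "({x, hd I}, {last I, y}) \<in> r_local_rel r G X"
proof -
  let ?xs = "x # I @ [y]"
  have w: "walk G ?xs" by (rule walk_cycle_graph[OF c(1,3)])
  have "{x, hd I} \<in> edges G" "{y, last I} \<in> edges G"
    using w I(1) by (auto simp: walk_def successively_Cons successively_append_iff insert_commute)
  moreover have "hd I \<notin> X" "last I \<notin> X" using I hd_in_set[OF I(1)] last_in_set[OF I(1)] by blast+
  ultimately have b: "{x, hd I} \<in> edge_boundary G X" "{last I, y} \<in> edge_boundary G X"
    using edge_boundaryI[of x "hd I" G X] edge_boundaryI[of y "last I" G X] I(2,3)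
    by (simp_all add: insert_commute)
  have "X_walk G X ?xs" using w I by (auto simp: X_walk_def)
  moreover have "r_local_walk r G ?xs" using c by (auto simp: r_local_walk_def)
  moreover have "first_edge ?xs = {x, hd I}" using I(1) by (cases I) (auto simp: first_edge_def)
  moreover have "last_edge ?xs = {last I, y}"
    using I(1) by (cases I rule: rev_cases) (auto simp: last_edge_def nth_append)
  ultimately have "\<exists>xs. X_walk G X xs \<and> r_local_walk r G xs \<and> 2 \<le> length xs \<and>
      {x, hd I} = first_edge xs \<and> {last I, y} = last_edge xs"
    by (intro exI[of _ ?xs]) simp
  then show ?thesis using b unfolding r_local_rel_def by blast
qed

text \<open>An \<open>X\<close>-walk along a single edge has both ends in \<open>X\<close> and
  cannot start with a boundary edge. A relation between distinct edges thus comes from a walk on a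
  short cycle with nonempty interior.\<close>

lemma r_local_relE:
  assumes G: "simple_graph G" and "(e, f) \<in> r_local_rel r G X"
  obtains "e = f" "e \<in> edge_boundary G X"
  | x I y c where "I \<noteq> []" "x \<in> X" "y \<in> X" "set I \<inter> X = {}" "e = {x, hd I}" "f = {last I, y}"
      "cycle G c" "length c \<le> r" "walk (cycle_graph c) (x # I @ [y])"
proof (cases "e = f")
  case True
  then show ?thesis using that(1) assms(2) by (simp add: r_local_rel_def)
next
  case False
  then obtain xs where xs: "X_walk G X xs" "r_local_walk r G xs" "2 \<le> length xs"
      "e = first_edge xs" "f = last_edge xs" and e: "e \<in> edge_boundary G X"
    using assms(2) by (auto simp: r_local_rel_def)
  define x I y where "x = hd xs" "I = butlast (tl xs)" "y = last xs"
  note d = this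
  have w: "x \<in> X" "y \<in> X" "set I \<inter> X = {}"
    using xs(1) by (auto simp: X_walk_def d)
  have xI: "xs = x # I @ [y]"
    using xs(3) unfolding d by (cases xs; cases "tl xs" rule: rev_cases) auto
  have I: "I \<noteq> []"
  proof
    assume "I = []"
    then have "e = {x, y}" using xs(4) xI by (simp add: first_edge_def)
    then show False using w edge_boundaryE[OF G e] by (metis insertCI insertE singletonD)
  qed
  have "e = {x, hd I}" using I xs(4) unfolding xI by (cases I) (auto simp: first_edge_def)
  moreover have "f = {last I, y}"
    using I xs(5) unfolding xI by (cases I rule: rev_cases) (auto simp: last_edge_def nth_append)
  moreover obtain c where "cycle G c" "length c \<le> r" "walk (cycle_graph c) xs"
    using xs(2) xI I by (auto simp: r_local_walk_def)
  ultimately show ?thesis using that(2)[of I x y c] w I xI by simp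
qed

lemma r_local_rel_boundary: "r_local_rel r G X \<subseteq> edge_boundary G X \<times> edge_boundary G X"
  unfolding r_local_rel_def by blast

lemma r_local_rel_sym:
  assumes G: "simple_graph G" and ef: "(e, f) \<in> r_local_rel r G X"
  shows "(f, e) \<in> r_local_rel r G X"
  using r_local_relE[OF G ef]
proof cases
  case 1
  then show ?thesis by (simp add: r_local_rel_refl)
next
  case (2 x I y c)
  have "walk (cycle_graph c) (y # rev I @ [x])" using walk_rev[OF 2(9)] by simp
  from r_local_relI[OF 2(7,8) this] 2 have "({y, hd (rev I)}, {last (rev I), x}) \<in> r_local_rel r G X"
    by auto
  then show ?thesis using 2 by (simp add: hd_rev last_rev insert_commute)
qed

lemma equiv_r_local_rel:
  assumes "simple_graph G"
  shows "equiv (edge_boundary G X) ((r_local_rel r G X)\<^sup>+)"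
proof (rule equivI)
  show "(r_local_rel r G X)\<^sup>+ \<subseteq> edge_boundary G X \<times> edge_boundary G X"
    by (rule trancl_subset_Sigma[OF r_local_rel_boundary])
  show "refl_on (edge_boundary G X) ((r_local_rel r G X)\<^sup>+)"
    by (auto simp: refl_on_def r_local_rel_refl)
  show "sym ((r_local_rel r G X)\<^sup>+)"
    by (intro sym_trancl symI) (rule r_local_rel_sym[OF assms])
qed (rule trans_trancl)

lemma r_local_separator_iff:
  assumes G: "simple_graph G" and e: "{u, v} \<in> edges G" "{v, w} \<in> edges G"
  shows "r_local_separator r G u v w X \<longleftrightarrow> X \<subseteq> verts G \<and> u \<notin> X \<and> w \<notin> X \<and> v \<in> X \<and>
    ({u, v}, {v, w}) \<notin> (r_local_rel r G X)\<^sup>+"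
proof (cases "X \<subseteq> verts G \<and> u \<notin> X \<and> w \<notin> X \<and> v \<in> X")
  case True
  let ?R = "(r_local_rel r G X)\<^sup>+"
  have b: "{u, v} \<in> edge_boundary G X" "{v, w} \<in> edge_boundary G X"
    using True e edge_boundaryI[of v u G X] edge_boundaryI[of v w G X] by (simp_all add: insert_commute)
  note eq = equiv_r_local_rel[OF G, of X r]
  have "(\<exists>C\<in>r_local_components r G X. \<exists>D\<in>r_local_components r G X.
        C \<noteq> D \<and> {u, v} \<in> C \<and> {v, w} \<in> D) \<longleftrightarrow> ({u, v}, {v, w}) \<notin> ?R" (is "?L \<longleftrightarrow> _")
  proof
    assume ?L
    then obtain C D where CD: "C \<in> edge_boundary G X // ?R" "D \<in> edge_boundary G X // ?R" "C \<noteq> D"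
        "{u, v} \<in> C" "{v, w} \<in> D" unfolding r_local_components_def by blast
    show "({u, v}, {v, w}) \<notin> ?R"
      using quotient_eqI[OF eq CD(1,2,4,5)] CD(3) by blast
  next
    assume n: "({u, v}, {v, w}) \<notin> ?R"
    have "?R `` {{u, v}} \<in> r_local_components r G X" "?R `` {{v, w}} \<in> r_local_components r G X"
      using b by (auto simp: r_local_components_def intro: quotientI)
    moreover have "{u, v} \<in> ?R `` {{u, v}}" "{v, w} \<in> ?R `` {{v, w}}"
      using equiv_class_self[OF eq] b by auto
    moreover have "?R `` {{u, v}} \<noteq> ?R `` {{v, w}}"
      using n eq_equiv_class[OF _ eq b(2)] by metis
    ultimately show ?L by meson
  qed
  then show ?thesis using True by (simp add: r_local_separator_def)
qed (auto simp: r_local_separator_def)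

section \<open>Existence of minimal local separators\<close>

text \<open>A chain of local walks has finitely many vertices outside \<open>Y\<close>. Enlarging
  \<open>Y\<close> without touching them keeps the ends of all walks inside and their interiors
  outside, so the chain survives.\<close>

lemma r_local_rel_finite_support:
  assumes G: "simple_graph G"
  shows "(e, f) \<in> (r_local_rel r G Y)\<^sup>+ \<Longrightarrow> \<exists>T. finite T \<and> T \<subseteq> verts G \<and> T \<inter> Y = {} \<and>
    (\<forall>X. Y \<subseteq> X \<longrightarrow> X \<inter> T = {} \<longrightarrow> (e, f) \<in> (r_local_rel r G X)\<^sup>+)"
proof -
  have one: "\<exists>T. finite T \<and> T \<subseteq> verts G \<and> T \<inter> Y = {} \<and>
    (\<forall>X. Y \<subseteq> X \<longrightarrow> X \<inter> T = {} \<longrightarrow> (e, f) \<in> r_local_rel r G X)" if ef: "(e, f) \<in> r_local_rel r G Y" for e f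
    using r_local_relE[OF G ef]
  proof cases
    case 1
    obtain x a where xa: "e = {x, a}" "x \<in> Y" "a \<notin> Y" "{x, a} \<in> edges G" by (rule edge_boundaryE[OF G 1(2)])
    have "(e, e) \<in> r_local_rel r G X" if "Y \<subseteq> X" "X \<inter> {a} = {}" for X
      unfolding xa(1) using xa that by (intro r_local_rel_refl edge_boundaryI) auto
    then show ?thesis using 1 xa edge_verts[OF G xa(4)] by (intro exI[of _ "{a}"]) auto
  next
    case (2 x I y c)
    have "(e, f) \<in> r_local_rel r G X" if "Y \<subseteq> X" "X \<inter> set I = {}" for X
      unfolding 2(5,6) using 2 that by (intro r_local_relI[OF 2(7,8,9)]) auto
    moreover have "set I \<subseteq> verts G" using walk_cycle_graph[OF 2(7,9)] by (auto simp: walk_def)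
    ultimately show ?thesis using 2(4) by (intro exI[of _ "set I"]) auto
  qed
  show "(e, f) \<in> (r_local_rel r G Y)\<^sup>+ \<Longrightarrow> ?thesis"
  proof (induction rule: trancl_induct)
    case (base f)
    from one[OF base] show ?case by (meson r_into_trancl)
  next
    case (step f g)
    from step.IH obtain T where T: "finite T" "T \<subseteq> verts G" "T \<inter> Y = {}"
      "\<And>X. Y \<subseteq> X \<Longrightarrow> X \<inter> T = {} \<Longrightarrow> (e, f) \<in> (r_local_rel r G X)\<^sup>+" by blast
    from one[OF step.hyps(2)] obtain S where S: "finite S" "S \<subseteq> verts G" "S \<inter> Y = {}"
      "\<And>X. Y \<subseteq> X \<Longrightarrow> X \<inter> S = {} \<Longrightarrow> (f, g) \<in> r_local_rel r G X" by blast
    have "(e, g) \<in> (r_local_rel r G X)\<^sup>+" if "Y \<subseteq> X" "X \<inter> (T \<union> S) = {}" for X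
    proof -
      have "X \<inter> T = {}" "X \<inter> S = {}" using that by blast+
      then show ?thesis using T(4)[OF that(1)] S(4)[OF that(1)] by (blast intro: trancl_into_trancl)
    qed
    then show ?case using T S by (intro exI[of _ "T \<union> S"]) auto
  qed
qed

text \<open>With only the non-adjacent vertices \<open>u\<close> and \<open>w\<close> outside, an
  \<open>X\<close>-walk entering \<open>u\<close> leaves it at once, so edges at \<open>u\<close>
  are related only to edges at \<open>u\<close>.\<close>

lemma r_local_separator_exists:
  assumes G: "simple_graph G" and e: "{u, v} \<in> edges G" "{v, w} \<in> edges G" and n: "\<not> ladj G u w"
  shows "r_local_separator r G u v w (verts G - {u, w})"
proof -
  let ?X = "verts G - {u, w}"
  have uvw: "u \<in> verts G" "v \<in> verts G" "w \<in> verts G" "u \<noteq> v" "v \<noteq> w" "u \<noteq> w"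
    using edge_verts[OF G e(1)] edge_verts[OF G e(2)] n by (auto simp: ladj_def)
  have step: "u \<in> g" if u: "u \<in> f" and fg: "(f, g) \<in> r_local_rel r G ?X" for f g
    using r_local_relE[OF G fg]
  proof cases
    case 1
    then show ?thesis using u by simp
  next
    case (2 x I y c)
    have w: "walk G (x # I @ [y])" by (rule walk_cycle_graph[OF 2(7,9)])
    have I: "set I \<subseteq> {u, w}" using w 2(4) by (auto simp: walk_def)
    have hI: "hd I = u" using 2(2,5) u by auto
    have "tl I = []"
    proof (rule ccontr)
      assume "tl I \<noteq> []"
      then obtain b J where IJ: "I = u # b # J" using hI 2(1) by (cases I; cases "tl I") auto
      then have "{u, b} \<in> edges G" "b \<in> {u, w}"
        using w I by (auto simp: walk_def)
      then show False using n edge_verts(3)[OF G] by (auto simp: ladj_def)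
    qed
    then have "I = [u]" using hI 2(1) by (cases I) auto
    then show ?thesis using 2(6) by simp
  qed
  have "u \<in> f" if "({u, v}, f) \<in> (r_local_rel r G ?X)\<^sup>+" for f
    using that by (induction rule: trancl_induct) (use step in blast)+
  then show ?thesis unfolding r_local_separator_iff[OF G e] using uvw by blast
qed

lemma gdist_eq_2_iff:
  assumes G: "simple_graph G" and e: "{u, v} \<in> edges G" "{v, w} \<in> edges G"
  shows "gdist G u w = 2 \<longleftrightarrow> \<not> ladj G u w"
proof -
  have "walk_betw G u [u, v, w] w"
    using walk_betw_trans[OF walk_betw_edge[OF G e(1)] walk_betw_edge[OF G e(2)]] by simp
  then have le: "gdist G u w \<le> enat 2" unfolding gdist_le_iff by (intro exI[of _ "[u, v, w]"]) simp
  have "gdist G u w \<le> enat 1 \<longleftrightarrow> ladj G u w"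
  proof
    assume "gdist G u w \<le> enat 1"
    then obtain xs where xs: "walk_betw G u xs w" "length xs \<le> 2" unfolding gdist_le_iff by auto
    then have "xs = [u] \<and> u = w \<or> xs = [u, w]"
      by (cases xs; cases "tl xs"; cases "tl (tl xs)") (auto simp: walk_betw_def walk_def)
    then show "ladj G u w"
    proof
      assume "xs = [u, w]"
      then have "walk G [u, w]" using xs(1) by (simp add: walk_betw_def)
      then show ?thesis by (simp add: walk_def ladj_def)
    qed (simp add: ladj_refl)
  next
    assume "ladj G u w"
    then consider "u = w" | "{u, w} \<in> edges G" by (auto simp: ladj_def)
    then show "gdist G u w \<le> enat 1"
    proof cases
      case 1
      then show ?thesis unfolding gdist_le_iff
        using walk_betw_refl[OF edge_verts(1)[OF G e(1)]] by (intro exI[of _ "[u]"]) auto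
    next
      case 2
      then show ?thesis unfolding gdist_le_iff
        using walk_betw_edge[OF G 2] by (intro exI[of _ "[u, w]"]) auto
    qed
  qed
  then show ?thesis using le by (cases "gdist G u w") (auto simp: numeral_eq_enat)
qed

text \<open>Zorn's lemma for the complements of separators. If the union of a chain of complements
  failed, a connection would use a finite set of vertices outside the corresponding separator; this
  set lies in one member of the chain, which then fails already.\<close>

lemma minimal_r_local_separator_exists:
  assumes G: "simple_graph G" and e: "{u, v} \<in> edges G" "{v, w} \<in> edges G" and n: "\<not> ladj G u w"
  obtains X where "minimal_r_local_separator r G X" "r_local_separator r G u v w X"
proof -
  let ?s = "r_local_separator r G u v w"
  define F where "F = {Z. Z \<subseteq> verts G \<and> ?s (verts G - Z)}"
  have uvw: "u \<in> verts G" "v \<in> verts G" "w \<in> verts G"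
    using edge_verts[OF G e(1)] edge_verts[OF G e(2)] by auto
  have "\<exists>M\<in>F. \<forall>Z\<in>F. M \<subseteq> Z \<longrightarrow> Z = M"
  proof (rule subset_Zorn_nonempty)
    have "{u, w} \<in> F" using r_local_separator_exists[OF G e n] uvw by (simp add: F_def)
    then show "F \<noteq> {}" by blast
    fix C assume C: "C \<noteq> {}" "subset.chain F C"
    then have CF: "C \<subseteq> F" by (simp add: subset.chain_def)
    let ?Y = "verts G - \<Union>C"
    have CV: "\<Union>C \<subseteq> verts G" using CF by (auto simp: F_def)
    have sep: "?s (verts G - Z)" if "Z \<in> C" for Z using that CF by (auto simp: F_def)
    have "({u, v}, {v, w}) \<notin> (r_local_rel r G ?Y)\<^sup>+"
    proof
      assume "({u, v}, {v, w}) \<in> (r_local_rel r G ?Y)\<^sup>+"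
      then obtain T where T: "finite T" "T \<subseteq> verts G" "T \<inter> ?Y = {}"
        "\<And>X. ?Y \<subseteq> X \<Longrightarrow> X \<inter> T = {} \<Longrightarrow> ({u, v}, {v, w}) \<in> (r_local_rel r G X)\<^sup>+"
        using r_local_rel_finite_support[OF G] by metis
      have "T \<subseteq> \<Union>C" using T(2,3) by blast
      then obtain Z where Z: "Z \<in> C" "T \<subseteq> Z" using finite_subset_Union_chain[OF T(1) _ C] by blast
      then have "({u, v}, {v, w}) \<in> (r_local_rel r G (verts G - Z))\<^sup>+" by (intro T(4)) auto
      then show False using sep[OF Z(1)] unfolding r_local_separator_iff[OF G e] by blast
    qed
    moreover obtain Z where "Z \<in> C" using C(1) by blast
    moreover have "u \<notin> ?Y" "w \<notin> ?Y"
      using sep[OF \<open>Z \<in> C\<close>] \<open>Z \<in> C\<close> uvw unfolding r_local_separator_iff[OF G e] by auto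
    moreover have "v \<in> ?Y" using sep uvw unfolding r_local_separator_iff[OF G e] by blast
    ultimately have "?s ?Y" unfolding r_local_separator_iff[OF G e] by blast
    then show "\<Union>C \<in> F" using CV by (simp add: F_def)
  qed
  then obtain M where M: "M \<in> F" "\<And>Z. Z \<in> F \<Longrightarrow> M \<subseteq> Z \<Longrightarrow> Z = M" by blast
  let ?X = "verts G - M"
  have s: "?s ?X" using M(1) by (simp add: F_def)
  have "\<not> ?s Y" if Y: "Y \<subset> ?X" for Y
  proof
    assume "?s Y"
    moreover have "verts G - (verts G - Y) = Y" using Y by blast
    ultimately have "verts G - Y \<in> F" by (simp add: F_def)
    moreover have "M \<subseteq> verts G - Y" using M(1) Y by (auto simp: F_def)
    ultimately have "verts G - Y = M" by (rule M(2))
    then show False using Y by blast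
  qed
  then have "minimal_r_local_separator r G ?X"
    unfolding minimal_r_local_separator_def using s uvw e gdist_eq_2_iff[OF G e] n by blast
  then show ?thesis using that s by blast
qed

section \<open>Chords from clique separators\<close>

text \<open>For a chordless short cycle, take a minimal separator \<open>X\<close> of the two
  neighbours of \<open>c ! 0\<close>. As a clique it contains no further vertex of the cycle, for
  that would give a chord at \<open>c ! 0\<close>. Hence the cycle itself, run through once, is a
  local \<open>X\<close>-walk joining the two edges that \<open>X\<close> separates.\<close>

lemma clique_separators_imp_r_chordal:
  assumes G: "simple_graph G" and cl: "\<And>X. minimal_r_local_separator r G X \<Longrightarrow> clique G X"
  shows "r_chordal r G"
  unfolding r_chordal_def
proof (intro allI impI, rule ccontr)
  fix c assume "cycle G c \<and> 4 \<le> length c \<and> length c \<le> r" and nc: "\<not> has_chord G c"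
  then have c: "cycle G c" "4 \<le> length c" "length c \<le> r" by auto
  have d: "distinct c" and E: "cycle_edges c \<subseteq> edges G" using c(1) by (auto simp: cycle_def)
  let ?n = "length c"
  let ?v = "c ! 0" and ?u = "c ! 1" and ?w = "c ! (?n - 1)"
  have ne: "c \<noteq> []" using c by auto
  have e: "{?u, ?v} \<in> edges G" "{?v, ?w} \<in> edges G"
    using E cycle_edges_Suc[of 0 c] cycle_edges_last[OF ne] c(2) by (auto simp: insert_commute)
  have "?u \<noteq> ?w" using nth_eq_iff_index_eq[OF d, of 1 "?n - 1"] c(2) by auto
  moreover have "{?u, ?w} \<notin> edges G" 
  proof -
    have "1 + 2 \<le> ?n - 1" "?n - 1 < ?n" using c(2) by linarith+
    then show ?thesis using has_chordI[OF d, of 1 "?n - 1" G] nc by auto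
  qed
  ultimately have "\<not> ladj G ?u ?w" by (simp add: ladj_def)
  then obtain X where X: "minimal_r_local_separator r G X" "r_local_separator r G ?u ?v ?w X"
    by (rule minimal_r_local_separator_exists[OF G e])
  have s: "?u \<notin> X" "?w \<notin> X" "?v \<in> X" "({?u, ?v}, {?v, ?w}) \<notin> (r_local_rel r G X)\<^sup>+"
    using X(2) unfolding r_local_separator_iff[OF G e] by auto
  have cX: "clique G X" by (rule cl[OF X(1)])
  have out: "c ! j \<notin> X" if j: "0 < j" "j < ?n" for j
  proof
    assume jX: "c ! j \<in> X"
    then have "j \<noteq> 1" "j \<noteq> ?n - 1" using s by metis+
    then have j2: "0 + 2 \<le> j" using j by linarith
    have "0 < ?n" using j by linarith
    then have "?v \<noteq> c ! j" using nth_eq_iff_index_eq[OF d, of 0 j] j by auto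
    then have "{?v, c ! j} \<in> edges G" using cX s(3) jX by (simp add: clique_def)
    then show False using has_chordI[OF d _ j2 j(2)] nc \<open>j \<noteq> ?n - 1\<close> by blast
  qed
  define t where "t = tl c"
  have lt: "length t = ?n - 1" and nt: "i < length t \<Longrightarrow> t ! i = c ! Suc i" for i
    by (auto simp: t_def nth_tl)
  have t: "?v # t = c" using ne by (simp add: t_def flip: hd_conv_nth)
  have "length t \<noteq> 0" using c(2) lt by simp
  then have tne: "t \<noteq> []" by blast
  have w: "walk (cycle_graph c) (?v # t @ [?v])"
  proof -
    have "walk (cycle_graph c) c"
      using ne cycle_edges_Suc[of _ c] by (auto simp: walk_def cycle_graph_def successively_conv_nth)
    moreover have "{last c, ?v} \<in> edges (cycle_graph c)"
      using cycle_edges_last[OF ne] ne by (simp add: cycle_graph_def last_conv_nth insert_commute)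
    ultimately have "walk (cycle_graph c) (c @ [?v])"
      using ne by (auto simp: walk_append_iff walk_single_iff cycle_graph_def)
    then show ?thesis using t by (metis append_Cons)
  qed
  have "set t \<inter> X = {}"
  proof -
    have "x \<notin> X" if x: "x \<in> set t" for x
    proof -
      obtain i where "i < length t" "x = t ! i" using x by (auto simp: in_set_conv_nth)
      then show ?thesis using out[of "Suc i"] lt nt by simp
    qed
    then show ?thesis by blast
  qed
  from r_local_relI[OF c(1,3) w tne s(3,3) this]
  have "({?v, hd t}, {last t, ?v}) \<in> r_local_rel r G X" .
  moreover have "hd t = ?u" using tne nt[of 0] by (simp add: hd_conv_nth)
  moreover have "last t = ?w" using tne ne t by (metis last_ConsR last_conv_nth)
  ultimately have "({?u, ?v}, {?v, ?w}) \<in> r_local_rel r G X" by (simp add: insert_commute)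
  then show False using s(4) by blast
qed

text \<open>The triangle is run through once as an \<open>X\<close>-walk from \<open>v\<close> to
  \<open>v\<close>.\<close>

lemma r_local_rel_triangle:
  assumes G: "simple_graph G" and r: "3 \<le> r"
    and e: "{v, a} \<in> edges G" "{v, b} \<in> edges G" "{a, b} \<in> edges G"
    and X: "v \<in> X" "a \<notin> X" "b \<notin> X"
  shows "({v, a}, {v, b}) \<in> r_local_rel r G X"
proof -
  let ?c = "[v, a, b]"
  have ce: "{v, a} \<in> cycle_edges ?c" "{a, b} \<in> cycle_edges ?c" "{v, b} \<in> cycle_edges ?c"
    using cycle_edges_Suc[of 0 ?c] cycle_edges_Suc[of 1 ?c] cycle_edges_last[of ?c] by auto
  have "cycle_edges ?c \<subseteq> edges G"
    by (rule subsetI, erule cycle_edgesE) (use e in \<open>auto simp: less_Suc_eq\<close>)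
  then have c: "cycle G ?c"
    using edge_verts[OF G e(1)] edge_verts[OF G e(2)] edge_verts[OF G e(3)] by (simp add: cycle_def)
  have "walk (cycle_graph ?c) (v # [a, b] @ [v])"
    using ce by (auto simp: walk_def cycle_graph_def insert_commute)
  from r_local_relI[OF c _ this] r X have "({v, a}, {b, v}) \<in> r_local_rel r G X" by auto
  then show ?thesis by (simp add: insert_commute)
qed

lemma r_local_rel_fan:
  assumes G: "simple_graph G" and r: "3 \<le> r" and v: "v \<in> X"
  shows "F \<noteq> [] \<Longrightarrow> successively (ladj G) F \<Longrightarrow> set F \<inter> X = {} \<Longrightarrow> \<forall>x\<in>set F. {v, x} \<in> edges G \<Longrightarrow>
    ({v, hd F}, {v, last F}) \<in> (r_local_rel r G X)\<^sup>+"
proof (induction F rule: induct_list012)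
  case (2 x)
  then show ?case using v by (auto intro!: r_into_trancl r_local_rel_refl edge_boundaryI)
next
  case (3 x y F)
  have "({v, x}, {v, y}) \<in> r_local_rel r G X"
  proof (cases "x = y")
    case True
    then show ?thesis using 3 v by (auto intro!: r_local_rel_refl edge_boundaryI)
  next
    case False
    then show ?thesis using 3 v by (intro r_local_rel_triangle[OF G r]) (auto simp: ladj_def)
  qed
  moreover have "({v, y}, {v, last (y # F)}) \<in> (r_local_rel r G X)\<^sup>+" using 3 by auto
  ultimately show ?case by (auto intro: trancl_into_trancl2)
qed simp

text \<open>The hub plays the role of \<open>v\<close>, and \<open>X\<close> separates
  \<open>c ! 0\<close> from \<open>c ! 2\<close>. An arc of the rim avoiding \<open>X\<close> would
  connect the two spokes through triangles at the hub, so \<open>X\<close> meets both open arcs; two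
  such vertices are not consecutive on the rim, and the clique gives a chord.\<close>

lemma clique_separators_imp_wheel_free:
  assumes G: "simple_graph G" and r: "3 \<le> r"
    and cl: "\<And>X. minimal_r_local_separator r G X \<Longrightarrow> clique G X"
  shows "wheel_free G"
proof (rule ccontr)
  assume "\<not> wheel_free G"
  then obtain h c where c: "cycle G c" "4 \<le> length c" "\<not> has_chord G c" and
      hub: "\<forall>x\<in>set c. {h, x} \<in> edges G"
    by (rule not_wheel_freeD[OF G])
  have d: "distinct c" and E: "cycle_edges c \<subseteq> edges G" using c(1) by (auto simp: cycle_def)
  have ne: "c \<noteq> []" using c by auto
  let ?u = "c ! 0" and ?w = "c ! 2" and ?n = "length c"
  have hub': "{h, c ! i} \<in> edges G" if "i < ?n" for i using hub that by simp
  have e: "{?u, h} \<in> edges G" "{h, ?w} \<in> edges G"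
    using hub'[of 0] hub'[of 2] c(2) ne by (auto simp: insert_commute)
  have "?u \<noteq> ?w" 
  proof -
    have "0 < ?n" "2 < ?n" using c(2) by linarith+
    then show ?thesis using nth_eq_iff_index_eq[OF d, of 0 2] by auto
  qed
  moreover have "{?u, ?w} \<notin> edges G" 
  proof -
    have "2 < ?n" "2 \<noteq> ?n - 1" using c(2) by linarith+
    then show ?thesis using has_chordI[OF d, of 0 2 G] c(3) by auto
  qed
  ultimately have "\<not> ladj G ?u ?w" by (simp add: ladj_def)
  then obtain X where X: "minimal_r_local_separator r G X" "r_local_separator r G ?u h ?w X"
    by (rule minimal_r_local_separator_exists[OF G e])
  have s: "?u \<notin> X" "?w \<notin> X" "h \<in> X" "({?u, h}, {h, ?w}) \<notin> (r_local_rel r G X)\<^sup>+"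
    using X(2) unfolding r_local_separator_iff[OF G e] by auto
  have s': "({h, ?u}, {h, ?w}) \<notin> (r_local_rel r G X)\<^sup>+" using s(4) by (simp add: insert_commute)
  have cX: "clique G X" by (rule cl[OF X(1)])
  have step: "ladj G (c ! i) (c ! Suc i)" if "Suc i < ?n" for i
    using E cycle_edges_Suc[OF that] by (auto simp: ladj_def)
  have "c ! 1 \<in> X"
  proof (rule ccontr)
    assume "c ! 1 \<notin> X"
    then have "({h, hd [?u, c ! 1, ?w]}, {h, last [?u, c ! 1, ?w]}) \<in> (r_local_rel r G X)\<^sup>+"
      using step[of 0] step[of 1] s c(2) hub'[of 0] hub'[of 1] hub'[of 2] ne
      by (intro r_local_rel_fan[OF G r s(3)]) (auto simp: numeral_2_eq_2)
    then show False using s' by simp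
  qed
  moreover have "\<exists>j. 3 \<le> j \<and> j < ?n \<and> c ! j \<in> X"
  proof (rule ccontr)
    assume no: "\<not> ?thesis"
    let ?F = "drop 2 c @ [?u]"
    have Fne: "drop 2 c \<noteq> []" using c(2) by simp
    have out: "x \<notin> X" if x: "x \<in> set (drop 2 c)" for x
    proof -
      have "drop 2 c = ?w # drop 3 c" using c(2) Cons_nth_drop_Suc[of 2 c] by simp
      then consider "x = ?w" | "x \<in> set (drop 3 c)" using x by auto
      then show ?thesis
      proof cases
        case 2
        then obtain i where "i < length (drop 3 c)" "x = drop 3 c ! i" by (auto simp: in_set_conv_nth)
        then show ?thesis using no c(2) by auto
      qed (use s(2) in simp)
    qed
    have "successively (ladj G) (drop 2 c)"
      using walk_successively_ladj[OF walk_drop[OF cycle_walk(1)[OF c(1)], of 2]] c(2) by simp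
    moreover have "ladj G (last (drop 2 c)) ?u"
      using cycle_walk(2)[OF c(1)] ne c(2) by (auto simp: ladj_def hd_conv_nth)
    ultimately have "successively (ladj G) ?F" using Fne by (simp add: successively_append_iff)
    moreover have "set ?F \<inter> X = {}" using out s(1) by auto
    moreover have "\<forall>x\<in>set ?F. {h, x} \<in> edges G" using hub ne by (auto dest: in_set_dropD)
    ultimately have "({h, hd ?F}, {h, last ?F}) \<in> (r_local_rel r G X)\<^sup>+"
      by (intro r_local_rel_fan[OF G r s(3)]) auto
    then have "({h, ?w}, {h, ?u}) \<in> (r_local_rel r G X)\<^sup>+"
      using Fne c(2) by (simp add: hd_drop_conv_nth)
    then have "({h, ?u}, {h, ?w}) \<in> (r_local_rel r G X)\<^sup>+"
      using equiv_r_local_rel[OF G, of X r] by (meson equiv_def symD)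
    then show False using s' by simp
  qed
  then obtain j where j: "3 \<le> j" "j < ?n" "c ! j \<in> X" by blast
  moreover have "c ! 1 \<noteq> c ! j" using nth_eq_iff_index_eq[OF d, of 1 j] j by auto
  ultimately have "{c ! 1, c ! j} \<in> edges G" using cX by (simp add: clique_def)
  then show False using has_chordI[OF d, of 1 j G] j c(3) by auto
qed

section \<open>Lifting walks on short cycles\<close>

lemma cycle_edges_rotate_subset: "cycle_edges (rotate k c) \<subseteq> cycle_edges c"
proof
  fix e assume "e \<in> cycle_edges (rotate k c)"
  then obtain i where i: "i < length c" "e = {rotate k c ! i, rotate k c ! (Suc i mod length c)}"
    by (auto simp: cycle_edges_def)
  let ?j = "(k + i) mod length c"
  have "Suc i mod length c < length c" using i by (intro mod_less_divisor) auto
  then have "rotate k c ! (Suc i mod length c) = c ! ((k + Suc i mod length c) mod length c)"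
    by (rule nth_rotate)
  moreover have "(k + Suc i mod length c) mod length c = Suc ?j mod length c" by (simp add: mod_simps)
  ultimately have "e = {c ! ?j, c ! (Suc ?j mod length c)}" using i nth_rotate[OF i(1)] by simp
  moreover have "?j < length c" using i by (intro mod_less_divisor) auto
  ultimately show "e \<in> cycle_edges c" by (auto simp: cycle_edges_def)
qed

lemma cycle_edges_rotate: "cycle_edges (rotate k c) = cycle_edges c"
proof
  \<comment> \<open>Rotating on to a multiple of the length undoes \<open>rotate k\<close>, which
    yields the converse inclusion.\<close>
  have "rotate (length c * k - k) (rotate k c) = rotate (length c * k - k + k) c" by (rule rotate_rotate)
  also have "\<dots> = c"
  proof (cases "length c = 0")
    case False
    then have "length c * k - k + k = length c * k" by (cases "length c") auto
    then show ?thesis using rotate_conv_mod[of "length c * k" c] by simp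
  qed simp
  finally show "cycle_edges c \<subseteq> cycle_edges (rotate k c)"
    using cycle_edges_rotate_subset[of "length c * k - k" "rotate k c"] by simp
qed (rule cycle_edges_rotate_subset)

lemma cycle_rotate: "cycle G c \<Longrightarrow> cycle G (rotate k c)"
  by (simp add: cycle_def cycle_edges_rotate)

text \<open>The lift \<open>D\<close> of the cycle through \<open>y\<close> is closed and maps
  injectively to \<open>G\<close>, so an inverse \<open>s\<close> of \<open>p\<close> on it lifts
  every walk on the cycle, however often it winds around. For the last claim the walk is replaced by
  the arc of \<open>D\<close> from \<open>y\<close> to the same end: it has at most \<open>r\<close>
  vertices and can be compared with the edge \<open>[y, z]\<close>.\<close>

lemma cycle_lift:
  assumes cov: "covering p H G" and sl: "short_walks_lift r p H"
    and c: "cycle G c" "length c \<le> r" and ws: "walk (cycle_graph c) ws"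
    and y: "y \<in> verts H" "p y = hd ws"
  obtains L where "walk H L" "hd L = y" "map p L = ws" "last ws = hd ws \<Longrightarrow> last L = y"
    "\<And>z. {y, z} \<in> edges H \<Longrightarrow> p z = last ws \<Longrightarrow> last L = z"
proof -
  note H = covering_simple(1)[OF cov]
  have hc: "hd ws \<in> set c" using walk_hd_in[OF ws] by (simp add: cycle_graph_def)
  then obtain k where k: "k < length c" "c ! k = hd ws" by (auto simp: in_set_conv_nth)
  define d where "d = rotate k c"
  have d: "cycle G d" "length d \<le> r" "cycle_edges d = cycle_edges c" "set d = set c"
    using cycle_rotate[OF c(1)] c(2) by (auto simp: d_def cycle_edges_rotate)
  have "hd d = hd ws" using k hd_rotate_conv_nth[of c k] by (cases "c = []") (auto simp: d_def)
  moreover have dne: "d \<noteq> []" using d(1) by (auto simp: cycle_def)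
  ultimately obtain D where D: "walk H D" "hd D = y" "map p D = d"
    using covering_lift_walk[OF cov cycle_walk(1)[OF d(1)] y(1)] y(2) by metis
  have Dne: "D \<noteq> []" using D(1) by (simp add: walk_def)
  have lD: "length D = length d" using D(3) by auto
  have "{p (last D), p y} \<in> edges G"
    using cycle_walk(2)[OF d(1)] D Dne by (metis hd_map last_map)
  then obtain z where z: "{last D, z} \<in> edges H" "p z = p y"
    using covering_lift_edge[OF cov walk_last_in[OF D(1)]] by blast
  have "z = y"
  proof (rule short_walks_liftD[OF sl _ walk_betw_refl[OF y(1)] z(2)])
    show "walk_betw H y (D @ [z]) z"
      using walk_snoc[OF H D(1) z(1)] D(2) Dne by (simp add: walk_betw_def)
    show "length (D @ [z]) + length [y] \<le> r + 2" using lD d(2) by simp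
  qed
  then have close: "{last D, hd D} \<in> edges H" using z(1) D(2) by simp
  have inj: "inj_on p (set D)" using D(3) d(1) by (auto simp: cycle_def distinct_map)
  define s where "s = inv_into (set D) p"
  have sp: "s (p x) = x" if "x \<in> set D" for x
    using inv_into_f_f[OF inj that] by (simp add: s_def)
  have pim: "p ` set D = set d" using D(3) by (metis set_map)
  have ps: "p (s g) = g" "s g \<in> set D" if "g \<in> set d" for g
  proof -
    have "g \<in> p ` set D" using that pim by simp
    then show "p (s g) = g" "s g \<in> set D" by (auto simp: s_def f_inv_into_f inv_into_into)
  qed
  have nth: "d ! i = p (D ! i)" if "i < length d" for i using D(3) that lD by (metis nth_map)
  have hom: "graph_hom s (cycle_graph c) H"
    unfolding graph_hom_def
  proof (intro conjI ballI subsetI)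
    fix x assume "x \<in> s ` verts (cycle_graph c)"
    then show "x \<in> verts H" using ps(2) d(4) D(1) by (auto simp: cycle_graph_def walk_def)
  next
    fix e assume "e \<in> edges (cycle_graph c)"
    then have "e \<in> cycle_edges d" using d(3) by (simp add: cycle_graph_def)
    then show "s ` e \<in> edges H"
    proof (cases rule: cycle_edgesE)
      case (1 i)
      then have "s ` e = {D ! i, D ! Suc i}" using nth sp lD by simp
      moreover have "{D ! i, D ! Suc i} \<in> edges H"
        using D(1) 1(1) lD by (auto simp: walk_def successively_conv_nth)
      ultimately show ?thesis by simp
    next
      case 2
      then have "s ` e = {D ! 0, D ! (length D - 1)}" using nth sp lD Dne by simp
      then show ?thesis using close Dne by (simp add: hd_conv_nth last_conv_nth insert_commute)
    qed
  qed
  let ?L = "map s ws"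
  have wne: "ws \<noteq> []" and wc: "set ws \<subseteq> set d" using ws d(4) by (auto simp: walk_def cycle_graph_def)
  have "s (hd ws) = y" using sp[of y] y D(2) Dne by auto
  have hL: "hd ?L = y" using \<open>s (hd ws) = y\<close> wne by (simp add: hd_map)
  have lL: "last ?L = s (last ws)" using wne by (simp add: last_map)
  show ?thesis
  proof (rule that[of ?L])
    show "walk H ?L" by (rule walk_map[OF hom ws])
    show "hd ?L = y" by (rule hL)
    show "map p ?L = ws" using ps(1) wc by (simp add: map_idI subset_iff)
    show "last ?L = y" if "last ws = hd ws" using that \<open>s (hd ws) = y\<close> lL by simp
    fix z assume z: "{y, z} \<in> edges H" "p z = last ws"
    have lw: "last ws \<in> set d" using wc wne by auto
    then obtain i where i: "i < length D" "D ! i = s (last ws)"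
      using ps(2) by (metis in_set_conv_nth)
    show "last ?L = z"
      unfolding lL
    proof (rule short_walks_liftD[OF sl _ walk_betw_edge[OF H z(1)]])
      show "walk_betw H y (take (Suc i) D) (s (last ws))"
        using walk_take[OF D(1), of "Suc i"] i D(2) Dne
        by (auto simp: walk_betw_def take_Suc_conv_app_nth hd_append hd_conv_nth)
      show "p (s (last ws)) = p z" using ps(1)[OF lw] z(2) by simp
      show "length (take (Suc i) D) + length [y, z] \<le> r + 2" using i lD d(2) by simp
    qed
  qed
qed

section \<open>Separators of the chordal cover\<close>

inductive_set lazy_component :: "'a ugraph \<Rightarrow> 'a set \<Rightarrow> 'a \<Rightarrow> 'a set" for G S x where
  start: "x \<in> S \<Longrightarrow> x \<in> lazy_component G S x"
| step: "y \<in> lazy_component G S x \<Longrightarrow> {y, z} \<in> edges G \<Longrightarrow> z \<in> S \<Longrightarrow> z \<in> lazy_component G S x"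

lemma lazy_component_subset: "y \<in> lazy_component G S x \<Longrightarrow> y \<in> S"
  by (induction rule: lazy_component.induct)

lemma lazy_component_path:
  "y \<in> lazy_component G S x \<Longrightarrow>
    \<exists>F. F \<noteq> [] \<and> successively (ladj G) F \<and> hd F = x \<and> last F = y \<and> set F \<subseteq> lazy_component G S x"
proof (induction rule: lazy_component.induct)
  case start
  then show ?case by (intro exI[of _ "[x]"]) (auto intro: lazy_component.start)
next
  case (step y z)
  then obtain F where F: "F \<noteq> []" "successively (ladj G) F" "hd F = x" "last F = y"
    "set F \<subseteq> lazy_component G S x" by blast
  then show ?case using step.hyps
    by (intro exI[of _ "F @ [z]"])
      (auto simp: successively_append_iff ladj_def intro: lazy_component.step)
qed

lemma lazy_component_connected:
  assumes "a \<in> lazy_component G S x" "b \<in> lazy_component G S x"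
  shows "\<exists>F. F \<noteq> [] \<and> successively (ladj G) F \<and> hd F = a \<and> last F = b \<and> set F \<subseteq> lazy_component G S x"
proof -
  obtain E F where E: "E \<noteq> []" "successively (ladj G) E" "hd E = x" "last E = a"
      "set E \<subseteq> lazy_component G S x"
    and F: "F \<noteq> []" "successively (ladj G) F" "hd F = x" "last F = b" "set F \<subseteq> lazy_component G S x"
    using lazy_component_path[OF assms(1)] lazy_component_path[OF assms(2)] by blast
  have "successively (ladj G) (rev E @ F)"
    using successively_ladj_rev[OF E(2)] F E by (auto simp: successively_append_iff last_rev ladj_refl)
  then show ?thesis using E F by (intro exI[of _ "rev E @ F"]) (auto simp: hd_rev)
qed

text \<open>In a chordal graph, neighbours of \<open>v\<close> that are joined outside
  \<open>X\<close> are joined by neighbours of \<open>v\<close> outside \<open>X\<close>: in the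
  closed walk \<open>v # F\<close>, a diagonal at \<open>v\<close> splits \<open>F\<close>, and any
  other one shortens it. \<open>Q\<close> will be membership of the projected edges in the same
  local component.\<close>

lemma chordal_link_walk:
  assumes H: "simple_graph H" and ch: "chordal H" and v: "v \<in> X"
    and tr: "\<And>a b c. Q a b \<Longrightarrow> Q b c \<Longrightarrow> Q a c"
    and refl: "\<And>a. {v, a} \<in> edges H \<Longrightarrow> a \<notin> X \<Longrightarrow> Q a a"
    and tri: "\<And>a b. {v, a} \<in> edges H \<Longrightarrow> {v, b} \<in> edges H \<Longrightarrow> {a, b} \<in> edges H \<Longrightarrow> a \<notin> X \<Longrightarrow>
      b \<notin> X \<Longrightarrow> Q a b"
  shows "F \<noteq> [] \<Longrightarrow> successively (ladj H) F \<Longrightarrow> set F \<inter> X = {} \<Longrightarrow> {v, hd F} \<in> edges H \<Longrightarrow>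
    {v, last F} \<in> edges H \<Longrightarrow> Q (hd F) (last F)"
proof (induction "length F" arbitrary: F rule: less_induct)
  case less
  consider a where "F = [a]" | a b where "F = [a, b]" | "3 \<le> length F"
    using less.prems(1) by (cases F; cases "tl F"; cases "tl (tl F)") auto
  then show ?case
  proof cases
    case 1
    then show ?thesis using less.prems refl by auto
  next
    case 2
    then show ?thesis using less.prems refl tri by (auto simp: ladj_def)
  next
    case 3
    let ?c = "v # F"
    have c: "successively (ladj H) ?c" "ladj H (last ?c) (hd ?c)" "4 \<le> length ?c"
      using less.prems 3 by (auto simp: successively_Cons ladj_def insert_commute)
    obtain i j where ij: "i + 2 \<le> j" "j < length ?c" "\<not> (i = 0 \<and> j = length ?c - 1)"
        "ladj H (?c ! i) (?c ! j)"
      using closed_walk_diagonal[OF H c] ch c(3) by (auto simp: chordal_def)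
    obtain j' where j': "j = Suc j'" using ij(1) by (cases j) auto
    show ?thesis
    proof (cases i)
      case 0
      have jj: "0 < j'" "Suc j' < length F" using 0 ij j' by auto
      have "v \<noteq> F ! j'" using less.prems(3) v jj by (metis Int_iff Suc_lessD empty_iff nth_mem)
      then have vj: "{v, F ! j'} \<in> edges H" using ij(4) 0 j' by (simp add: ladj_def)
      define A m B where "A = take j' F" "m = F ! j'" "B = drop (Suc j') F"
      note d = this
      have F: "F = A @ m # B" unfolding d using jj by (intro id_take_nth_drop) simp
      have ne: "A \<noteq> []" "B \<noteq> []" using jj by (auto simp: d)
      have vm: "{v, m} \<in> edges H" using vj by (simp add: d)
      have "Q (hd (A @ [m])) (last (A @ [m]))"
      proof (rule less.hyps)
        show "length (A @ [m]) < length F" using ne by (subst F) simp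
        show "successively (ladj H) (A @ [m])"
          using less.prems(2) unfolding F by (auto simp: successively_append_iff)
        show "set (A @ [m]) \<inter> X = {}" using less.prems(3) unfolding F by auto
        show "{v, hd (A @ [m])} \<in> edges H" using less.prems(4) ne unfolding F by simp
      qed (use vm in auto)
      moreover have "Q (hd (m # B)) (last (m # B))"
      proof (rule less.hyps)
        show "length (m # B) < length F" using ne by (subst F) simp
        show "successively (ladj H) (m # B)"
          using less.prems(2) unfolding F by (auto simp: successively_append_iff)
        show "set (m # B) \<inter> X = {}" using less.prems(3) unfolding F by auto
        show "{v, last (m # B)} \<in> edges H" using less.prems(5) ne unfolding F by simp
      qed (use vm in auto)
      moreover have "hd (A @ [m]) = hd F" "last (A @ [m]) = m" "hd (m # B) = m" "last (m # B) = last F"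
        using ne unfolding F by auto
      ultimately show ?thesis using tr by metis
    next
      case (Suc i')
      have "i' + 2 \<le> j'" "j' < length F" "ladj H (F ! i') (F ! j')" using ij Suc j' by auto
      from shorten_walk[OF less.prems(2) this] obtain F' where F': "length F' < length F" "F' \<noteq> []"
        "successively (ladj H) F'" "hd F' = hd F" "last F' = last F" "set F' \<subseteq> set F" by blast
      have "set F' \<inter> X = {}" using F'(6) less.prems(3) by blast
      from less.hyps[OF F'(1-3) this] show ?thesis using F'(4,5) less.prems(4,5) by simp
    qed
  qed
qed

text \<open>The preimage of the separator separates the lifts of \<open>u\<close> and \<open>w\<close> in the chordal cover, hence
  contains a minimal separator there, which is a clique. The image of that clique is still a local
  separator, because short cycles lift to cycles.\<close>

lemma chordal_cover_imp_clique_separators: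
  assumes cov: "covering p H G" and sl: "short_walks_lift r p H" and ch: "chordal H" and r: "3 \<le> r"
    and min: "minimal_r_local_separator r G X"
  shows "clique G X"
proof -
  note H = covering_simple(1)[OF cov] and G = covering_simple(2)[OF cov] and hom = covering_hom[OF cov]
  obtain u v w where e: "{u, v} \<in> edges G" "{v, w} \<in> edges G" and sep: "r_local_separator r G u v w X"
    and minimal: "\<And>Y. Y \<subset> X \<Longrightarrow> \<not> r_local_separator r G u v w Y" and v: "v \<in> verts G"
    using min unfolding minimal_r_local_separator_def by blast
  have X: "X \<subseteq> verts G" "u \<notin> X" "w \<notin> X" "v \<in> X" "({u, v}, {v, w}) \<notin> (r_local_rel r G X)\<^sup>+"
    using sep unfolding r_local_separator_iff[OF G e] by auto
  obtain v' where v': "v' \<in> verts H" "p v' = v" using covering_surj[OF cov v] by blast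
  obtain u' where u': "{v', u'} \<in> edges H" "p u' = u"
    using covering_lift_edge[OF cov v'(1)] e(1) v'(2) by (metis insert_commute)
  obtain w' where w': "{v', w'} \<in> edges H" "p w' = w"
    using covering_lift_edge[OF cov v'(1)] e(2) v'(2) by metis
  define X' where "X' = {x. p x \<in> X}"
  have fan: "({v, p (hd F)}, {v, p (last F)}) \<in> (r_local_rel r G X)\<^sup>+"
    if "F \<noteq> []" "successively (ladj H) F" "set F \<inter> X' = {}" "{v', hd F} \<in> edges H"
      "{v', last F} \<in> edges H" for F
  proof (rule chordal_link_walk[OF H ch, of v' X' "\<lambda>a b. ({v, p a}, {v, p b}) \<in> (r_local_rel r G X)\<^sup>+"])
    show "v' \<in> X'" using v' X(4) by (simp add: X'_def)
    show "({v, p a}, {v, p c}) \<in> (r_local_rel r G X)\<^sup>+"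
      if "({v, p a}, {v, p b}) \<in> (r_local_rel r G X)\<^sup>+" "({v, p b}, {v, p c}) \<in> (r_local_rel r G X)\<^sup>+"
      for a b c using that by (rule trancl_trans)
    show "({v, p a}, {v, p a}) \<in> (r_local_rel r G X)\<^sup>+" if "{v', a} \<in> edges H" "a \<notin> X'" for a
    proof -
      have "{v, p a} \<in> edges G" using graph_hom_edge[OF hom that(1)] v'(2) by simp
      moreover have "p a \<notin> X" using that(2) by (simp add: X'_def)
      ultimately show ?thesis using X(4) by (intro r_into_trancl r_local_rel_refl edge_boundaryI)
    qed
    show "({v, p a}, {v, p b}) \<in> (r_local_rel r G X)\<^sup>+"
      if "{v', a} \<in> edges H" "{v', b} \<in> edges H" "{a, b} \<in> edges H" "a \<notin> X'" "b \<notin> X'" for a b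
    proof -
      have "{v, p a} \<in> edges G" "{v, p b} \<in> edges G" "{p a, p b} \<in> edges G"
        using graph_hom_edge[OF hom that(1)] graph_hom_edge[OF hom that(2)]
          graph_hom_edge[OF hom that(3)] v'(2) by simp_all
      then show ?thesis
        using that(4,5) X(4) by (intro r_into_trancl r_local_rel_triangle[OF G r]) (auto simp: X'_def)
    qed
  qed (use that in auto)
  define A where "A = lazy_component H (- X') u'"
  have u'X: "u' \<notin> X'" and w'X: "w' \<notin> X'" using u' w' X by (auto simp: X'_def)
  have u'A: "u' \<in> A" unfolding A_def using u'X by (intro lazy_component.start) simp
  have w'A: "w' \<notin> A"
  proof
    assume "w' \<in> A"
    then obtain F where F: "F \<noteq> []" "successively (ladj H) F" "hd F = u'" "last F = w'" "set F \<subseteq> A"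
      unfolding A_def using lazy_component_path by metis
    moreover have "set F \<inter> X' = {}" using F(5) lazy_component_subset unfolding A_def by fastforce
    ultimately have "({v, u}, {v, w}) \<in> (r_local_rel r G X)\<^sup>+" using fan[of F] u' w' by simp
    then show False using X(5) by (simp add: insert_commute)
  qed
  \<comment> \<open>Taking neighbourhoods twice makes the separator minimal: \<open>NA\<close>
    borders the component \<open>A\<close> of \<open>u'\<close>, and \<open>Y\<close> consists of
    those vertices of \<open>NA\<close> that also border the component \<open>B\<close> of
    \<open>w'\<close>. Every vertex of \<open>Y\<close> thus has neighbours in \<open>A\<close> and
    in \<open>B\<close>, as the argument with two sides requires.\<close>
  define NA where "NA = {x. x \<notin> A \<and> (\<exists>a\<in>A. {a, x} \<in> edges H)}"
  have NA: "NA \<subseteq> X'"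
    unfolding NA_def A_def using lazy_component.step[of _ H "- X'" u'] by blast
  define B where "B = lazy_component H (- NA) w'"
  have w'B: "w' \<in> B" unfolding B_def using w'X NA by (intro lazy_component.start) blast
  have B_NA: "b \<notin> NA" if "b \<in> B" for b using lazy_component_subset that unfolding B_def by fastforce
  have B_A: "b \<notin> A" if "b \<in> B" for b
    using that unfolding B_def
  proof (induction rule: lazy_component.induct)
    case (step y z)
    show ?case
    proof
      assume "z \<in> A"
      then have "y \<in> NA" using step by (auto simp: NA_def insert_commute)
      then show False using step.hyps(1) lazy_component_subset by fastforce
    qed
  qed (rule w'A)
  have AB: "\<not> ladj H a b" if "a \<in> A" "b \<in> B" for a b
  proof
    assume "ladj H a b"
    then have "{a, b} \<in> edges H" using B_A[OF that(2)] that(1) by (auto simp: ladj_def)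
    then have "b \<in> NA" using that(1) B_A[OF that(2)] by (auto simp: NA_def)
    then show False using B_NA[OF that(2)] by blast
  qed
  define Y where "Y = {x. x \<notin> B \<and> (\<exists>b\<in>B. {b, x} \<in> edges H)}"
  have Y_NA: "Y \<subseteq> NA"
    unfolding Y_def B_def using lazy_component.step[of _ H "- NA" w'] by blast
  have Y_clique: "{x, y} \<in> edges H" if xy: "x \<in> Y" "y \<in> Y" "x \<noteq> y" for x y
  proof (rule ccontr)
    assume "{x, y} \<notin> edges H"
    then have n: "\<not> ladj H x y" using xy(3) by (simp add: ladj_def)
    have path: "\<exists>F. F \<noteq> [] \<and> successively (ladj H) F \<and> hd F = x \<and> last F = y \<and> set F \<subseteq> C \<union> {x, y}"
      if C: "C = lazy_component H S z" "a \<in> C" "{a, x} \<in> edges H" "b \<in> C" "{b, y} \<in> edges H"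
      for C S z a b
    proof -
      obtain F where F: "F \<noteq> []" "successively (ladj H) F" "hd F = a" "last F = b" "set F \<subseteq> C"
        using lazy_component_connected C(1,2,4) by metis
      have "successively (ladj H) (x # F @ [y])"
        using F C(3,5) by (auto simp: successively_Cons successively_append_iff ladj_def insert_commute)
      then show ?thesis using F by (intro exI[of _ "x # F @ [y]"]) auto
    qed
    obtain a b where "a \<in> A" "{a, x} \<in> edges H" "b \<in> A" "{b, y} \<in> edges H"
      using xy Y_NA unfolding NA_def by blast
    then obtain F where F: "F \<noteq> []" "successively (ladj H) F" "hd F = x" "last F = y" "set F \<subseteq> A \<union> {x, y}"
      using path[OF A_def] by metis
    obtain a b where "a \<in> B" "{a, x} \<in> edges H" "b \<in> B" "{b, y} \<in> edges H"
      using xy unfolding Y_def by blast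
    then obtain K where K: "K \<noteq> []" "successively (ladj H) K" "hd K = x" "last K = y" "set K \<subseteq> B \<union> {x, y}"
      using path[OF B_def] by metis
    show False by (rule chordal_two_sides[OF H ch n F K AB])
  qed
  have v'Y: "v' \<in> Y"
  proof -
    have "v' \<notin> A" using v' X(4) lazy_component_subset[of v' H "- X'" u'] by (auto simp: A_def X'_def)
    then have "v' \<in> NA" using u'A u'(1) by (auto simp: NA_def insert_commute)
    then have "v' \<notin> B" using B_NA by blast
    then show ?thesis using w'B w'(1) by (auto simp: Y_def insert_commute)
  qed
  have YV: "Y \<subseteq> verts H" unfolding Y_def using edge_verts(2)[OF H] by blast
  let ?Y = "p ` Y"
  \<comment> \<open>Adjacent vertices have distinct images, so \<open>p\<close> is injective on the
    clique \<open>Y\<close>.\<close>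
  have pinj: "y = z" if "y \<in> Y" "z \<in> Y" "p y = p z" for y z
    using Y_clique[OF that(1,2)] graph_hom_edge[OF hom] edge_verts(3)[OF G] that(3) by metis
  have YX: "?Y \<subseteq> X" using Y_NA NA by (auto simp: X'_def)
  \<comment> \<open>The invariant along local walks: the edge lifts to an edge from \<open>Y\<close>
    to a vertex outside \<open>B\<close>. It holds for \<open>{u, v}\<close> by way of
    \<open>u'\<close>, but the only lift of \<open>{v, w}\<close> starting in \<open>Y\<close> leads
    from \<open>v'\<close> to \<open>w'\<close>, which lies in \<open>B\<close>.\<close>
  define Inv where "Inv f \<longleftrightarrow> (\<exists>y\<in>Y. \<exists>b. b \<notin> B \<and> p b \<notin> ?Y \<and> {y, b} \<in> edges H \<and> f = {p y, p b})" for f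
  have u'B: "u' \<notin> B" using B_A u'A by blast
  have start: "Inv {u, v}"
    unfolding Inv_def
  proof (intro bexI[OF _ v'Y] exI conjI)
    show "u' \<notin> B" "p u' \<notin> ?Y" "{v', u'} \<in> edges H" "{u, v} = {p v', p u'}"
      using u'B u' v'(2) X(2) YX by (auto simp: insert_commute)
  qed
  have step: "Inv g" if f: "Inv f" and fg: "(f, g) \<in> r_local_rel r G ?Y" for f g
    using r_local_relE[OF G fg]
  proof cases
    case 1
    then show ?thesis using f by simp
  next
    case (2 x I t c)
    obtain y b where y: "y \<in> Y" and b: "b \<notin> B" "p b \<notin> ?Y" "{y, b} \<in> edges H" "f = {p y, p b}"
      using f unfolding Inv_def by blast
    have "hd I \<notin> ?Y" using 2(1,4) hd_in_set by blast
    then have px: "p y = x" "p b = hd I"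
      using b(2,4) 2(2,5) y by (metis doubleton_eq_iff imageI)+
    obtain L where L: "walk H L" "hd L = y" "map p L = x # I @ [t]"
      "t = x \<Longrightarrow> last L = y" "\<And>z. {y, z} \<in> edges H \<Longrightarrow> p z = t \<Longrightarrow> last L = z"
      using cycle_lift[OF cov sl 2(7,8,9), of y] y YV px(1) by auto
    \<comment> \<open>The lift could end at another vertex over \<open>t = p y'\<close>. As
      \<open>Y\<close> is a clique, \<open>y'\<close> equals \<open>y\<close> or is adjacent to it,
      and in both cases \<open>cycle_lift\<close> identifies the end as \<open>y'\<close>.\<close>
    have "last L \<in> Y"
    proof -
      obtain y' where y': "y' \<in> Y" "t = p y'" using 2(3) by blast
      show ?thesis
      proof (cases "y' = y")
        case True
        then show ?thesis using L(4) y' px(1) by simp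
      next
        case False
        then show ?thesis using L(5)[OF Y_clique[OF y y'(1)]] y' by auto
      qed
    qed
    obtain J where J: "L = y # J @ [last L]" "map p J = I"
    proof -
      have "L \<noteq> []" "tl L \<noteq> []" using L(3) by auto
      then have "L = y # butlast (tl L) @ [last L]"
        using L(2) by (metis append_butlast_last_id hd_Cons_tl last_tl)
      moreover have "map p (butlast (tl L)) = I"
        using L(3) by (simp add: map_butlast map_tl)
      ultimately show ?thesis using that by blast
    qed
    have Jne: "J \<noteq> []" using J(2) 2(1) by auto
    have w: "walk H (y # J @ [last L])" using L(1) J(1) by simp
    have "{y, hd J} \<in> edges H" using w Jne by (auto simp: walk_def successively_Cons)
    then have hJ: "hd J = b"
      using covering_unique_edge[OF cov _ b(3)] px(2) J(2) Jne by (metis hd_map)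
    have out: "z \<notin> Y" if "z \<in> set J" for z
    proof -
      have "p z \<in> set I" using that J(2) by auto
      then show ?thesis using 2(4) by blast
    qed
    have "successively (\<lambda>x y. {x, y} \<in> edges H) J" using w by (auto simp: walk_def successively_Cons successively_append_iff)
    \<comment> \<open>\<open>B\<close> can be entered only through \<open>Y\<close>, which the
      interior of the lifted walk avoids.\<close>
    then have "last J \<notin> B"
      using Jne out hJ b(1)
    proof (induction J arbitrary: b rule: induct_list012)
      case (3 z z' J)
      then have "z' \<notin> B" by (auto simp: Y_def insert_commute)
      then show ?case using "3.IH"(2)[of z'] 3 by auto
    qed auto
    moreover have "p (last J) = last I" using J(2) Jne by (metis last_map)
    moreover have "last I \<notin> ?Y" using 2(1,4) last_in_set by blast
    moreover have "{last J, last L} \<in> edges H"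
      using w Jne by (auto simp: walk_def successively_Cons successively_append_iff)
    moreover have "p (last L) = t" using L(1,3) by (metis append_is_Nil_conv last.simps last_map last_snoc list.distinct(1) walk_def)
    ultimately show ?thesis
      unfolding Inv_def using \<open>last L \<in> Y\<close> 2(6) by (intro bexI[of _ "last L"] exI[of _ "last J"]) (auto simp: insert_commute)
  qed
  have inv: "Inv f" if "({u, v}, f) \<in> (r_local_rel r G ?Y)\<^sup>+" for f
    using that by (induction rule: trancl_induct) (use start step in blast)+
  have "({u, v}, {v, w}) \<notin> (r_local_rel r G ?Y)\<^sup>+"
  proof
    assume "({u, v}, {v, w}) \<in> (r_local_rel r G ?Y)\<^sup>+"
    then obtain y b where y: "y \<in> Y" and b: "b \<notin> B" "{y, b} \<in> edges H" "{v, w} = {p y, p b}"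
      using inv unfolding Inv_def by blast
    have "w \<notin> ?Y" using YX X(3) by blast
    then have "p y = v" "p b = w" using b(3) y by (metis doubleton_eq_iff imageI)+
    then have "y = v'" using pinj[OF y v'Y] v'(2) by simp
    then have "b = w'" using covering_unique_edge[OF cov _ w'(1)] b(2) \<open>p b = w\<close> w'(2) by simp
    then show False using b(1) w'B by simp
  qed
  then have "r_local_separator r G u v w ?Y"
    unfolding r_local_separator_iff[OF G e] using YX X v'Y v'(2) by blast
  then have "X = ?Y" using minimal[of ?Y] YX by blast
  moreover have "clique G ?Y"
    unfolding clique_def
  proof (intro conjI ballI impI)
    show "?Y \<subseteq> verts G" using YX X(1) by blast
    fix a b assume "a \<in> ?Y" "b \<in> ?Y" "a \<noteq> b"
    then obtain x y where "x \<in> Y" "y \<in> Y" "a = p x" "b = p y" "x \<noteq> y" by blast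
    then show "{a, b} \<in> edges G" using graph_hom_edge[OF hom Y_clique] by simp
  qed
  ultimately show ?thesis by simp
qed

theorem theorem1:
  fixes G :: "'a ugraph" and r :: nat
  assumes "simple_graph G" and "3 \<le> r"
  shows "(r_locally_chordal r G \<longleftrightarrow> r_chordal r G \<and> wheel_free G) \<and>
    (r_locally_chordal r G \<longleftrightarrow> chordal (r_local_cover r G)) \<and>
    (r_locally_chordal r G \<longleftrightarrow>
       (\<forall>X. minimal_r_local_separator r G X \<longrightarrow> clique G X))"
proof -
  let ?i = "r_locally_chordal r G" and ?ii = "r_chordal r G \<and> wheel_free G"
    and ?iii = "chordal (r_local_cover r G)"
    and ?iv = "\<forall>X. minimal_r_local_separator r G X \<longrightarrow> clique G X"
  have "2 \<le> r" using assms(2) by simp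
  then obtain p where p: "r_local_covering r p (r_local_cover r G) G"
    using r_local_cover_exists[OF assms(1)] by blast
  then have cov: "covering p (r_local_cover r G) G" and bp: "ball_preserving r p (r_local_cover r G) G"
    by (auto simp: r_local_covering_def)
  have "?i \<Longrightarrow> ?ii"
    using locally_chordal_imp_r_chordal[OF assms] locally_chordal_imp_wheel_free[OF assms] by blast
  moreover have "?ii \<Longrightarrow> ?iii"
    using r_chordal_links_imp_chordal_cover[OF assms _ wheel_free_links[OF assms(1)] p] by blast
  moreover have "?iii \<Longrightarrow> ?i" by (rule chordal_cover_imp_locally_chordal[OF cov bp])
  moreover have "?iii \<Longrightarrow> ?iv"
    using chordal_cover_imp_clique_separators[OF cov ball_preservingD[OF cov bp] _ assms(2)] by blast
  moreover have "?iv \<Longrightarrow> ?ii"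
    using clique_separators_imp_r_chordal[OF assms(1)] clique_separators_imp_wheel_free[OF assms] by blast
  ultimately show ?thesis by blast
qed

end
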